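(* Let $(P^1_t)_{t\ge0}$ and $(P^2_t)_{t\ge0}$ be two non-explosive homogeneous PDMP semigroups on $\mathsf M$ with characteristics $(\varphi,\lambda_1,Q_1)$ and $(\varphi,\lambda_2,Q_2)$ respectively. Let $\mu_1,\mu_2\in\mathcal P(\mathsf M)$ be invariant for $(P^1_t)_{t\ge0}$ and $(P^2_t)_{t\ge0}$ respectively. Suppose that $(P^1_t)_{t\ge0}$ is $V$-uniformly geometrically ergodic with constants $C,\rho\in(0,+\infty)$ for a (measurable) function $V:\mathsf M\to[1,+\infty)$ such that $\mu_2(V)<+\infty$. Assume in addition that $$C^1_c(\mathsf M)\subset B^1_0(\mathsf M)=\{f\in B(\mathsf M):\lim_{t\to0}\|P^1_tf-f\|_\infty=0\},$$ and that for all $t\in\mathbb R_+$ and $f\in C^1_c(\mathsf M)$, the function $x\mapsto\int_0^tP^1_sf(x)\,ds$ belongs to $D(\bar{\mathcal A}_2)$, where $(\bar{\mathcal A}_2,D(\bar{\mathcal A}_2))$ is the strong generator of $(P^2_t)_{t\ge0}$. Then $$\|\mu_1-\mu_2\|_V\le C\rho^{-1}\sup\Big\{\int_{\mathsf M}\big|\lambda_1Q_1h-\lambda_2Q_2h+(\lambda_2-\lambda_1)h\big|\,d\mu_2\ :\ \|h/V\|_\infty\le1\Big\},$$ where the supremum is over measurable functions $h:\mathsf M\to\mathbb R$.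
   Context: $\mathsf M$ is a smooth closed Riemannian submanifold of $\mathbb R^N$ with Borel $\sigma$-field $\mathcal B(\mathsf M)$; $\infty\notin\mathsf M$ is a cemetery point; $\inf\emptyset=+\infty$; $\mathcal P(\mathsf M)$: probability measures on $\mathsf M$; $B(\mathsf M)$: bounded measurable real functions with uniform norm $\|\cdot\|_\infty$; $C^1_c(\mathsf M)$: continuously differentiable functions with compact support; $\mu(V)=\int V\,d\mu$. A homogeneous differential flow is a measurable map $(t,x)\mapsto\varphi_t(x)$ from $\mathbb R_+\times\mathsf M$ to $\mathsf M$ with $\varphi_0=\mathrm{Id}$, $\varphi_{t+s}=\varphi_s\circ\varphi_t$, $t\mapsto\varphi_t(x)$ continuously differentiable for all $x$, and each $\varphi_t$ a $C^1$-diffeomorphism of $\mathsf M$. A homogeneous jump rate is a measurable $\lambda:\mathsf M\to\mathbb R_+$ bounded on compact sets, and a homogeneous Markov kernel $Q$ is a Markov kernel on $(\mathsf M,\mathcal B(\mathsf M))$; $Qf(x)=\int f(y)Q(x,dy)$. Together $(\varphi,\lambda,Q)$ are homogeneous characteristics. A PDMP with these characteristics and initial law $\mu_0$ is a process with the law of the following one. Let $G:\mathsf M\times[0,1]\to\mathsf M$ be measurable with $Q(x,A)=\mathbb P(G(x,U)\in A)$, $U$ uniform on $[0,1]$; let $W_0\sim\mu_0$ and, independently, $(E_k,U_k)_{k\ge1}$ i.i.d., $E_k$ exponential with parameter $1$, $U_k$ uniform on $[0,1]$, independent. Set $S_0=0$, $X_0=X'_0=W_0$; given $X_k'\in\mathsf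 M$, $S_k<\infty$, set $S_{k+1}=\inf\{t\ge S_k:E_{k+1}<\int_{S_k}^t\lambda(\varphi_{s-S_k}(X'_k))\,ds\}$; if $S_{k+1}=+\infty$, set $S_m=+\infty$ for $m>k$ and $X_t=\varphi_{t-S_k}(X_k')$ for $t\ge S_k$; otherwise $X_t=\varphi_{t-S_k}(X'_k)$ for $t\in(S_k,S_{k+1})$ and $X_{S_{k+1}}=X'_{k+1}=G(\varphi_{S_{k+1}-S_k}(X'_k),U_{k+1})$. For $t\ge\sup_kS_k$, $X_t=\infty$. The characteristics (and semigroup) are non-explosive if for every initial law $\inf\{t:X_t=\infty\}=+\infty$ a.s. The semigroup is $P_t(x,A)=\mathbb P(X_t\in A)$ with $X_0=x$, $P_tf(x)=\mathbb E[f(X_t)]$, $\nu P_t(A)=\int P_t(x,A)\nu(dx)$; $\mu$ is invariant if $\mu P_t=\mu$ for all $t\ge0$. Strong generator of $(P_t)$: with $B_0(\mathsf M)=\{f\in B(\mathsf M):\lim_{t\to0}\|P_tf-f\|_\infty=0\}$, $D(\bar{\mathcal A})$ is the set of $f\in B_0(\mathsf M)$ for which there is $g:\mathsf M\to\mathbb R$ with $\lim_{t\to0}\|t^{-1}(P_tf-f)-g\|_\infty=0$, and $\bar{\mathcal A}f=g$. For measurable $V:\mathsf M\to[1,+\infty)$ and $\nu_1,\nu_2\in\mathcal P(\mathsf M)$ with $\nu_1(V),\nu_2(V)<+\infty$, $\|\nu_1-\nu_2\|_V=\sup\{|\int f\,d\nu_1-\int f\,d\nu_2|:\|f/V\|_\infty\le1\}$.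 A semigroup with invariant probability measure $\mu$ is $V$-uniformly geometrically ergodic with constants $C,\rho>0$ if $\|\mu-\nu P_t\|_V\le Ce^{-\rho t}\nu(V)$ for all $\nu\in\mathcal P(\mathsf M)$ with $\nu(V)<+\infty$ and all $t\ge0$. *)

theory Defs
  imports "HOL-Probability.Probability"
begin

text \<open>Continuous differentiability of order \<open>k\<close> on an open set, by recursion on directional
  derivatives (the type of the iterated Frechet derivative would change with \<open>k\<close>).\<close>

primrec Ck_on :: "nat \<Rightarrow> 'a::euclidean_space set \<Rightarrow> ('a \<Rightarrow> 'b::real_normed_vector) \<Rightarrow> bool" where
  "Ck_on 0 U f \<longleftrightarrow> continuous_on U f"
| "Ck_on (Suc k) U f \<longleftrightarrow>
     (\<forall>x\<in>U. f differentiable (at x)) \<and> (\<forall>v. Ck_on k U (\<lambda>x. frechet_derivative f (at x) v))"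

definition smooth_on :: "'a::euclidean_space set \<Rightarrow> ('a \<Rightarrow> 'b::real_normed_vector) \<Rightarrow> bool" where
  "smooth_on U f \<longleftrightarrow> (\<forall>k. Ck_on k U f)"

text \<open>Embedded submanifold without boundary (slice charts), closed as a subset of the ambient space.
  The Riemannian metric is the induced one and carries no additional data.\<close>

definition smooth_closed_submanifold :: "'a::euclidean_space set \<Rightarrow> bool" where
  "smooth_closed_submanifold M \<longleftrightarrow> closed M \<and>
     (\<exists>d. \<forall>x\<in>M. \<exists>U W \<psi> \<psi>' S.
        open U \<and> x \<in> U \<and> open W \<and> homeomorphism U W \<psi> \<psi>' \<and> smooth_on U \<psi> \<and> smooth_on W \<psi>' \<and>
        subspace (S :: 'a set) \<and> dim S = d \<and> \<psi> ` (U \<inter> M) = W \<inter> S)"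

text \<open>A map on a submanifold is \<open>C\<^sup>1\<close> if it locally extends to a \<open>C\<^sup>1\<close> map on
  an open subset of the ambient space.  All functions on \<open>M\<close> are total functions on the ambient
  type; their values outside \<open>M\<close> are irrelevant.\<close>

definition C1_on :: "'a::euclidean_space set \<Rightarrow> ('a \<Rightarrow> 'b::real_normed_vector) \<Rightarrow> bool" where
  "C1_on M f \<longleftrightarrow>
     (\<forall>x\<in>M. \<exists>U g. open U \<and> x \<in> U \<and> Ck_on 1 U g \<and> (\<forall>y\<in>U \<inter> M. g y = f y))"

definition C1_diffeomorphism :: "'a::euclidean_space set \<Rightarrow> ('a \<Rightarrow> 'a) \<Rightarrow> bool" where
  "C1_diffeomorphism M f \<longleftrightarrow> bij_betw f M M \<and> C1_on M f \<and> C1_on M (the_inv_into M f)"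

definition C1c :: "'a::euclidean_space set \<Rightarrow> ('a \<Rightarrow> real) set" where
  "C1c M = {f. C1_on M f \<and> compact (closure {x \<in> M. f x \<noteq> 0})}"

abbreviation borel_on :: "'a::topological_space set \<Rightarrow> 'a measure" where
  "borel_on M \<equiv> restrict_space borel M"

abbreviation probs_on :: "'a::topological_space set \<Rightarrow> 'a measure set" where
  "probs_on M \<equiv> space (prob_algebra (borel_on M))"

definition bounded_measurable :: "'a::topological_space set \<Rightarrow> ('a \<Rightarrow> real) set" where
  "bounded_measurable M = {f \<in> borel_measurable (borel_on M). bounded (f ` M)}"

definition uniform_norm :: "'a set \<Rightarrow> ('a \<Rightarrow> real) \<Rightarrow> ennreal" where
  "uniform_norm M f = (SUP x\<in>M. ennreal \<bar>f x\<bar>)"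

text \<open>Only meaningful if \<open>V\<close> is integrable for both measures.\<close>

definition V_distance ::
  "'a::topological_space set \<Rightarrow> ('a \<Rightarrow> real) \<Rightarrow> 'a measure \<Rightarrow> 'a measure \<Rightarrow> ennreal" where
  "V_distance M V \<nu>1 \<nu>2 =
     (SUP f\<in>{f \<in> borel_measurable (borel_on M). uniform_norm M (\<lambda>x. f x / V x) \<le> 1}.
        ennreal \<bar>(\<integral>x. f x \<partial>\<nu>1) - (\<integral>x. f x \<partial>\<nu>2)\<bar>)"

definition homogeneous_flow :: "'a::euclidean_space set \<Rightarrow> (real \<Rightarrow> 'a \<Rightarrow> 'a) \<Rightarrow> bool" where
  "homogeneous_flow M \<phi> \<longleftrightarrow>
     (\<lambda>(t, x). \<phi> t x) \<in> borel_on {0..} \<Otimes>\<^sub>M borel_on M \<rightarrow>\<^sub>M borel_on M \<and>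
     (\<forall>x\<in>M. \<phi> 0 x = x) \<and>
     (\<forall>t\<ge>0. \<forall>s\<ge>0. \<forall>x\<in>M. \<phi> (t + s) x = \<phi> s (\<phi> t x)) \<and>
     (\<forall>x\<in>M. \<exists>v. continuous_on {0..} v \<and>
        (\<forall>t\<ge>0. ((\<lambda>s. \<phi> s x) has_vector_derivative v t) (at t within {0..}))) \<and>
     (\<forall>t\<ge>0. C1_diffeomorphism M (\<phi> t))"

definition jump_rate :: "'a::euclidean_space set \<Rightarrow> ('a \<Rightarrow> real) \<Rightarrow> bool" where
  "jump_rate M r \<longleftrightarrow>
     r \<in> borel_measurable (borel_on M) \<and> (\<forall>x\<in>M. 0 \<le> r x) \<and>
     (\<forall>K\<subseteq>M. compact K \<longrightarrow> bounded (r ` K))"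

definition markov_kernel :: "'a::euclidean_space set \<Rightarrow> ('a \<Rightarrow> 'a measure) \<Rightarrow> bool" where
  "markov_kernel M Q \<longleftrightarrow> Q \<in> borel_on M \<rightarrow>\<^sub>M prob_algebra (borel_on M)"

definition homogeneous_characteristics ::
  "'a::euclidean_space set \<Rightarrow> (real \<Rightarrow> 'a \<Rightarrow> 'a) \<Rightarrow> ('a \<Rightarrow> real) \<Rightarrow> ('a \<Rightarrow> 'a measure) \<Rightarrow> bool"
where
  "homogeneous_characteristics M \<phi> r Q \<longleftrightarrow>
     homogeneous_flow M \<phi> \<and> jump_rate M r \<and> markov_kernel M Q"

definition uniform01 :: "real measure" where
  "uniform01 = restrict_space lborel {0..1}"

definition represents_kernel ::
  "'a::euclidean_space set \<Rightarrow> ('a \<Rightarrow> 'a measure) \<Rightarrow> ('a \<Rightarrow> real \<Rightarrow> 'a) \<Rightarrow> bool" where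
  "represents_kernel M Q G \<longleftrightarrow>
     (\<lambda>(x, u). G x u) \<in> borel_on M \<Otimes>\<^sub>M borel_on {0..1} \<rightarrow>\<^sub>M borel_on M \<and>
     (\<forall>x\<in>M. \<forall>A\<in>sets (borel_on M).
        emeasure (Q x) A = emeasure uniform01 {u \<in> space uniform01. G x u \<in> A})"

definition next_jump_time ::
  "(real \<Rightarrow> 'a \<Rightarrow> 'a) \<Rightarrow> ('a \<Rightarrow> real) \<Rightarrow> real \<Rightarrow> 'a \<Rightarrow> real \<Rightarrow> ereal" where
  "next_jump_time \<phi> r S y e =
     Inf {ereal t | t. S \<le> t \<and> e < (LBINT s:{S..t}. r (\<phi> (s - S) y))}"

text \<open>A sample point \<open>(w, \<omega>)\<close> consists of the initial position \<open>w\<close> and the pairs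
  \<open>\<omega> k\<close>, standing for \<open>(E, U)\<close> with index \<open>k + 1\<close>.  The \<open>k\<close>-th skeleton point is
  the \<open>k\<close>-th jump time together with the post-jump position; once the jump time is infinite,
  the second component is a dummy.\<close>

primrec pdmp_skeleton ::
  "(real \<Rightarrow> 'a \<Rightarrow> 'a) \<Rightarrow> ('a \<Rightarrow> real) \<Rightarrow> ('a \<Rightarrow> real \<Rightarrow> 'a) \<Rightarrow> 'a \<times> (nat \<Rightarrow> real \<times> real) \<Rightarrow>
   nat \<Rightarrow> ereal \<times> 'a" where
  "pdmp_skeleton \<phi> r G p 0 = (0, fst p)"
| "pdmp_skeleton \<phi> r G p (Suc k) =
     (let (S, y) = pdmp_skeleton \<phi> r G p k; (e, u) = snd p k in
      if S = \<infinity> then (\<infinity>, y)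
      else let S' = next_jump_time \<phi> r (real_of_ereal S) y e in
        if S' = \<infinity> then (\<infinity>, y)
        else (S', G (\<phi> (real_of_ereal S' - real_of_ereal S) y) u))"

text \<open>\<open>None\<close> is the cemetery point.\<close>

definition pdmp ::
  "(real \<Rightarrow> 'a \<Rightarrow> 'a) \<Rightarrow> ('a \<Rightarrow> real) \<Rightarrow> ('a \<Rightarrow> real \<Rightarrow> 'a) \<Rightarrow> real \<Rightarrow>
   'a \<times> (nat \<Rightarrow> real \<times> real) \<Rightarrow> 'a option" where
  "pdmp \<phi> r G t p =
     (let S = (\<lambda>k. fst (pdmp_skeleton \<phi> r G p k)); X' = (\<lambda>k. snd (pdmp_skeleton \<phi> r G p k)) in
      if ereal t < (SUP k. S k)
      then let k = (LEAST k. ereal t < S (Suc k)) in Some (\<phi> (t - real_of_ereal (S k)) (X' k))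
      else None)"

definition pdmp_space :: "'a measure \<Rightarrow> ('a \<times> (nat \<Rightarrow> real \<times> real)) measure" where
  "pdmp_space \<mu>0 =
     \<mu>0 \<Otimes>\<^sub>M (\<Pi>\<^sub>M k\<in>UNIV. density lborel (exponential_density 1) \<Otimes>\<^sub>M uniform01)"

definition non_explosive ::
  "'a::euclidean_space set \<Rightarrow> (real \<Rightarrow> 'a \<Rightarrow> 'a) \<Rightarrow> ('a \<Rightarrow> real) \<Rightarrow> ('a \<Rightarrow> real \<Rightarrow> 'a) \<Rightarrow> bool"
where
  "non_explosive M \<phi> r G \<longleftrightarrow>
     (\<forall>\<mu>0\<in>probs_on M. AE p in pdmp_space \<mu>0.
        Inf {ereal t | t. 0 \<le> t \<and> pdmp \<phi> r G t p = None} = \<infinity>)"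

definition pdmp_transition ::
  "'a::euclidean_space set \<Rightarrow> (real \<Rightarrow> 'a \<Rightarrow> 'a) \<Rightarrow> ('a \<Rightarrow> real) \<Rightarrow> ('a \<Rightarrow> real \<Rightarrow> 'a) \<Rightarrow>
   real \<Rightarrow> 'a \<Rightarrow> 'a measure" where
  "pdmp_transition M \<phi> r G t x =
     measure_of M (sets (borel_on M))
       (\<lambda>A. let \<Omega> = pdmp_space (return (borel_on M) x)
            in emeasure \<Omega> {p \<in> space \<Omega>. pdmp \<phi> r G t p \<in> Some ` A})"

text \<open>The law of the process does not depend on the function \<open>G\<close> representing \<open>Q\<close>.\<close>

definition non_explosive_pdmp_semigroup ::
  "'a::euclidean_space set \<Rightarrow> (real \<Rightarrow> 'a \<Rightarrow> 'a) \<Rightarrow> ('a \<Rightarrow> real) \<Rightarrow> ('a \<Rightarrow> 'a measure) \<Rightarrow>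
   (real \<Rightarrow> 'a \<Rightarrow> 'a measure) \<Rightarrow> bool" where
  "non_explosive_pdmp_semigroup M \<phi> r Q P \<longleftrightarrow>
     homogeneous_characteristics M \<phi> r Q \<and>
     (\<exists>G. represents_kernel M Q G \<and> non_explosive M \<phi> r G \<and>
        (\<forall>t\<ge>0. \<forall>x\<in>M. P t x = pdmp_transition M \<phi> r G t x))"

definition act :: "('a \<Rightarrow> 'a measure) \<Rightarrow> ('a \<Rightarrow> real) \<Rightarrow> 'a \<Rightarrow> real" where
  "act K f x = (\<integral>y. f y \<partial>K x)"

definition invariant_measure ::
  "(real \<Rightarrow> 'a \<Rightarrow> 'a measure) \<Rightarrow> 'a measure \<Rightarrow> bool" where
  "invariant_measure P \<mu> \<longleftrightarrow> (\<forall>t\<ge>0. \<mu> \<bind> P t = \<mu>)"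

definition B0 ::
  "'a::topological_space set \<Rightarrow> (real \<Rightarrow> 'a \<Rightarrow> 'a measure) \<Rightarrow> ('a \<Rightarrow> real) set" where
  "B0 M P = {f \<in> bounded_measurable M.
     ((\<lambda>t. uniform_norm M (\<lambda>x. act (P t) f x - f x)) \<longlongrightarrow> 0) (at_right 0)}"

definition strong_generator_domain ::
  "'a::topological_space set \<Rightarrow> (real \<Rightarrow> 'a \<Rightarrow> 'a measure) \<Rightarrow> ('a \<Rightarrow> real) set" where
  "strong_generator_domain M P = {f \<in> B0 M P. \<exists>g.
     ((\<lambda>t. uniform_norm M (\<lambda>x. (act (P t) f x - f x) / t - g x)) \<longlongrightarrow> 0) (at_right 0)}"

text \<open>The two finiteness requirements are those under which the distance is defined.\<close>

definition V_uniformly_geometrically_ergodic ::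
  "'a::topological_space set \<Rightarrow> (real \<Rightarrow> 'a \<Rightarrow> 'a measure) \<Rightarrow> 'a measure \<Rightarrow> ('a \<Rightarrow> real) \<Rightarrow>
   real \<Rightarrow> real \<Rightarrow> bool" where
  "V_uniformly_geometrically_ergodic M P \<mu> V C \<rho> \<longleftrightarrow>
     (\<integral>\<^sup>+x. V x \<partial>\<mu>) < \<infinity> \<and>
     (\<forall>\<nu>\<in>probs_on M. (\<integral>\<^sup>+x. V x \<partial>\<nu>) < \<infinity> \<longrightarrow> (\<forall>t\<ge>0.
        (\<integral>\<^sup>+x. V x \<partial>(\<nu> \<bind> P t)) < \<infinity> \<and>
        V_distance M V \<mu> (\<nu> \<bind> P t) \<le> ennreal (C * exp (- \<rho> * t)) * (\<integral>\<^sup>+x. V x \<partial>\<nu>)))"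

end

theory Submission
  imports Defs
begin

text \<open>Let \<open>g\<close> be the potential \<open>\<integral>\<^sub>0\<^sup>t P\<^sup>1\<^sub>s f ds\<close>. Both strong generators are defined at
  \<open>g\<close>, with \<open>A\<^sub>1 g = P\<^sup>1\<^sub>t f - f\<close> and \<open>\<mu>2 (A\<^sub>2 g) = 0\<close>. Since the flows agree,
  \<open>A\<^sub>1 g - A\<^sub>2 g\<close> is the jump operator \<open>K g\<close> (\<open>defect\<close>) of the right-hand side. The rates
  being merely measurable, this only holds almost everywhere along each orbit of the flow (by Lebesgue
  differentiation), but the occupation measures of the process charge no set that is null along all
  orbits, hence neither does \<open>\<mu>2\<close>. So \<open>\<mu>2 (P\<^sup>1\<^sub>t f) - \<mu>2 f = \<mu>2 (K g)\<close>. As \<open>K\<close>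
  annihilates constants, \<open>g\<close> may be replaced by \<open>g - t \<mu>1 f\<close>, which geometric ergodicity bounds
  by \<open>C / \<rho> V\<close>; then let \<open>t\<close> tend to infinity.

  This argument works for \<open>f\<close> in \<open>C\<^sup>1\<^sub>c\<close>, but such functions bounded by a merely measurable
  \<open>V\<close> need not be dense among all measurable ones. The linear identity, unlike the bound, extends to
  all bounded measurable \<open>f\<close> by a monotone class argument, since \<open>K\<close> is order continuous into
  \<open>L\<^sup>1 (\<mu>2)\<close> as soon as the supremum on the right is finite.\<close>

section \<open>Flows with a jump rate\<close>

text \<open>Two obstacles shape the proof. The rates are bounded only on compact pieces of orbits,
  so renewal equations at the first jump admit no contraction argument. Uniqueness comes from
  non-explosion instead: iterating a homogeneous renewal inequality \<open>n\<close> times leaves a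
  constant times the probability of at least \<open>n\<close> jumps. The semigroup law and the
  vanishing of occupation times are both instances of this uniqueness. Secondly, no hypothesis makes
  the rates \<open>\<mu>2\<close>-integrable, so the jump operator has no integrable majorant and
  dominated convergence cannot carry the identity beyond C1 functions. What is known is a uniform
  \<open>L1\<close> bound on the images of functions bounded by a constant, valid when the supremum
  is finite (if it is infinite, the claim is trivial); a gliding hump converts this bound into order
  continuity. The flow is never differentiated: the increments of a function along it are the same
  for both processes and cancel before the limit is taken. Test functions that are only bounded by
  \<open>V\<close> come last, by truncation, with \<open>V\<close> itself as majorant under both
  invariant measures.\<close>

lemma set_integral_shift:
  fixes f :: "real \<Rightarrow> real"
  shows "(LBINT s:{a + c..b + c}. f (s - c)) = (LBINT s:{a..b}. f s)"
  unfolding set_lebesgue_integral_def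
  by (subst lborel_integral_real_affine[where c=1 and t="-c"])
    (auto intro!: Bochner_Integration.integral_cong simp: indicator_def)

lemma set_integral_Icc_split:
  fixes f :: "real \<Rightarrow> real"
  assumes "a \<le> b" "b \<le> c" "set_integrable lborel {a..c} f"
  shows "(LBINT s:{a..c}. f s) = (LBINT s:{a..b}. f s) + (LBINT s:{b..c}. f s)"
proof -
  have i: "set_integrable lborel {a..b} f" "set_integrable lborel {b..c} f"
    by (rule set_integrable_subset[OF assms(3)]; use assms in auto)+
  have "{a..c} = {a..b} \<union> {b..c}" using assms by auto
  moreover have "AE x in lborel. \<not> (x \<in> {a..b} \<and> x \<in> {b..c})"
    by (rule AE_I[where N="{b}"]) auto
  ultimately show ?thesis
    using set_integral_Un_AE[OF _ _ _ i] by simp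
qed

lemma set_integral_Icc_le:
  fixes f :: "real \<Rightarrow> real"
  assumes "a \<le> b" "set_integrable lborel {a..b} f" "\<And>u. u \<in> {a..b} \<Longrightarrow> f u \<le> L"
  shows "(LBINT u:{a..b}. f u) \<le> L * (b - a)"
proof -
  have "(LBINT u:{a..b}. f u) \<le> (LBINT u:{a..b}. L)"
    using assms borel_integrable_atLeastAtMost'[OF continuous_on_const, of a b L]
    by (intro set_integral_mono) auto
  then show ?thesis using assms by (simp add: set_integral_const mult.commute)
qed

text \<open>Orbit functions are known to be measurable only through nonnegative times, hence the
  \<open>max 0\<close> in the measurability assumption; on an interval with \<open>0 \<le> a\<close>
  it changes nothing.\<close>

lemma set_integrable_Icc_bounded:
  fixes f :: "real \<Rightarrow> real"
  assumes "(\<lambda>s. f (max 0 s)) \<in> borel_measurable borel" "0 \<le> a" "\<And>s. s \<in> {a..b} \<Longrightarrow> \<bar>f s\<bar> \<le> B"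
  shows "set_integrable lborel {a..b} f"
proof -
  have "set_integrable lborel {a..b} (\<lambda>s. f (max 0 s))"
    unfolding set_integrable_def
  proof (rule integrableI_bounded_set_indicator[where B=B])
    show "AE s in lborel. s \<in> {a..b} \<longrightarrow> norm (f (max 0 s)) \<le> B"
      using assms by (auto intro!: AE_I2)
    show "emeasure lborel {a..b} < \<infinity>" by (cases "a \<le> b") auto
  qed (use assms in auto)
  moreover have "set_integrable lborel {a..b} (\<lambda>s. f (max 0 s)) \<longleftrightarrow> set_integrable lborel {a..b} f"
    using assms(2) by (intro set_integrable_cong) auto
  ultimately show ?thesis by simp
qed

lemma set_integral_Icc_abs_le:
  fixes f :: "real \<Rightarrow> real"
  assumes "a \<le> b" "set_integrable lborel {a..b} f" "\<And>u. u \<in> {a..b} \<Longrightarrow> \<bar>f u\<bar> \<le> L"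
  shows "\<bar>LBINT u:{a..b}. f u\<bar> \<le> L * (b - a)"
proof -
  have c: "set_integrable lborel {a..b} (\<lambda>_. c)" for c :: real
    by (rule borel_integrable_atLeastAtMost'[OF continuous_on_const])
  have "(LBINT u:{a..b}. f u) \<le> (LBINT u:{a..b}. L)"
    using assms by (intro set_integral_mono c) (auto simp: abs_le_iff)
  moreover have "(LBINT u:{a..b}. - L) \<le> (LBINT u:{a..b}. f u)"
    using assms by (intro set_integral_mono c) (auto simp: abs_le_iff minus_le_iff)
  ultimately show ?thesis using assms(1) by (simp add: set_integral_const abs_le_iff mult.commute)
qed

text \<open>What the construction retains of the manifold: a measurable space, a semiflow and a rate
  that is bounded on finite pieces of orbits. The guard \<open>max 0\<close> turns the flow into a
  jointly measurable function of all real times, so that measurability propagates through integrals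
  over the whole line.\<close>

locale flow_with_rate =
  fixes N :: "'a measure" and \<phi> :: "real \<Rightarrow> 'a \<Rightarrow> 'a" and r :: "'a \<Rightarrow> real"
  assumes flow_measurable: "(\<lambda>(t, x). \<phi> (max 0 t) x) \<in> borel \<Otimes>\<^sub>M N \<rightarrow>\<^sub>M N"
    and flow_0: "x \<in> space N \<Longrightarrow> \<phi> 0 x = x"
    and flow_add: "\<lbrakk>0 \<le> t; 0 \<le> s; x \<in> space N\<rbrakk> \<Longrightarrow> \<phi> (t + s) x = \<phi> s (\<phi> t x)"
    and rate_measurable [measurable]: "r \<in> borel_measurable N"
    and rate_nonneg: "x \<in> space N \<Longrightarrow> 0 \<le> r x"
    and rate_orbit_bounded: "x \<in> space N \<Longrightarrow> \<exists>L. \<forall>s\<in>{0..T}. r (\<phi> s x) \<le> L"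
begin

definition cumrate :: "real \<Rightarrow> 'a \<Rightarrow> real" where
  "cumrate t x = (LBINT s:{0..t}. r (\<phi> s x))"

lemma flow_measurable' [measurable (raw)]:
  assumes [measurable]: "f \<in> borel_measurable K" "g \<in> K \<rightarrow>\<^sub>M N"
  shows "(\<lambda>z. \<phi> (max 0 (f z)) (g z)) \<in> K \<rightarrow>\<^sub>M N"
proof -
  have "(\<lambda>z. (f z, g z)) \<in> K \<rightarrow>\<^sub>M borel \<Otimes>\<^sub>M N" by measurable
  from measurable_compose[OF this flow_measurable] show ?thesis by simp
qed

lemma flow_in_space:
  assumes "0 \<le> t" "x \<in> space N"
  shows "\<phi> t x \<in> space N"
proof -
  \<comment> \<open>Invariance of the space is contained in measurability of the flow: it is read
    off from a measurable map on a one-point space.\<close>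
  have "(\<lambda>_. \<phi> (max 0 t) x) \<in> count_space {()} \<rightarrow>\<^sub>M N"
    using assms by measurable
  from measurable_space[OF this, of "()"] assms show ?thesis by (simp add: max_def)
qed

lemma cumrate_eq: "cumrate t x = (\<integral>s. indicator {0..t} s * r (\<phi> (max 0 s) x) \<partial>lborel)"
  unfolding cumrate_def set_lebesgue_integral_def
  by (intro Bochner_Integration.integral_cong) (auto simp: indicator_def)

lemma cumrate_measurable [measurable (raw)]:
  assumes [measurable]: "f \<in> borel_measurable K" "g \<in> K \<rightarrow>\<^sub>M N"
  shows "(\<lambda>z. cumrate (f z) (g z)) \<in> borel_measurable K"
proof -
  have "(\<lambda>z. \<integral>s. (if 0 \<le> s \<and> s \<le> f z then 1 else 0) * r (\<phi> (max 0 s) (g z)) \<partial>lborel) \<in> borel_measurable K"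
    by measurable
  also have "(\<lambda>z. \<integral>s. (if 0 \<le> s \<and> s \<le> f z then 1 else 0) * r (\<phi> (max 0 s) (g z)) \<partial>lborel) = (\<lambda>z. cumrate (f z) (g z))"
    unfolding cumrate_eq by (intro ext Bochner_Integration.integral_cong) (auto simp: indicator_def)
  finally show ?thesis .
qed

lemma set_integrable_bounded_orbit:
  fixes h :: "'a \<Rightarrow> real" and c :: "real \<Rightarrow> real"
  assumes x: "x \<in> space N" and a: "0 \<le> a"
    and [measurable]: "h \<in> borel_measurable N" "c \<in> borel_measurable borel"
    and B: "\<And>s. s \<in> {a..b} \<Longrightarrow> \<bar>c s * h (\<phi> s x)\<bar> \<le> B"
  shows "set_integrable lborel {a..b} (\<lambda>s. c s * h (\<phi> s x))"
proof -
  have [measurable]: "(\<lambda>s. h (\<phi> (max 0 s) x)) \<in> borel_measurable borel"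
    using x by measurable
  have "set_integrable lborel {a..b} (\<lambda>s. c s * h (\<phi> (max 0 s) x))"
    unfolding set_integrable_def
  proof (rule integrableI_bounded_set_indicator[where B=B])
    show "AE s in lborel. s \<in> {a..b} \<longrightarrow> norm (c s * h (\<phi> (max 0 s) x)) \<le> B"
      using a B by (auto simp: max_def intro!: AE_I2)
    show "emeasure lborel {a..b} < \<infinity>" by (cases "a \<le> b") auto
  qed measurable
  moreover have "set_integrable lborel {a..b} (\<lambda>s. c s * h (\<phi> (max 0 s) x)) \<longleftrightarrow>
      set_integrable lborel {a..b} (\<lambda>s. c s * h (\<phi> s x))"
    using a by (intro set_integrable_cong) (auto simp: max_def)
  ultimately show ?thesis by simp
qed

lemma rate_bound:
  assumes "x \<in> space N"
  obtains L where "0 \<le> L" "\<And>s. s \<in> {0..T} \<Longrightarrow> r (\<phi> s x) \<le> L"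
proof -
  obtain L where "\<forall>s\<in>{0..T}. r (\<phi> s x) \<le> L"
    using rate_orbit_bounded[OF assms] by blast
  then show ?thesis by (intro that[of "max 0 L"]) (auto simp: le_max_iff_disj)
qed

lemma set_integrable_rate:
  assumes "x \<in> space N" "0 \<le> a"
  shows "set_integrable lborel {a..b} (\<lambda>s. r (\<phi> s x))"
proof -
  obtain L where "0 \<le> L" "\<And>s. s \<in> {0..b} \<Longrightarrow> r (\<phi> s x) \<le> L"
    using rate_bound[OF assms(1)] by metis
  then show ?thesis
    using set_integrable_bounded_orbit[OF assms(1,2), of r "\<lambda>_. 1" b L] assms
      rate_nonneg[OF flow_in_space] by auto
qed

lemma cumrate_0 [simp]: "cumrate 0 x = 0"
  unfolding cumrate_def set_lebesgue_integral_def
  by (rule integral_eq_zero_AE, rule AE_I[where N="{0}"]) (auto simp: indicator_def split: if_splits)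

lemma set_integral_orbit_shift:
  fixes h :: "'a \<Rightarrow> real"
  assumes "0 \<le> t" "x \<in> space N"
  shows "(LBINT s:{0..u}. h (\<phi> s (\<phi> t x))) = (LBINT s:{t..t + u}. h (\<phi> s x))"
proof -
  have "(LBINT s:{0..u}. h (\<phi> s (\<phi> t x))) = (LBINT s:{0..u}. h (\<phi> (t + s) x))"
    using assms by (intro set_lebesgue_integral_cong) (auto simp: flow_add)
  also have "\<dots> = (LBINT s:{0 + t..u + t}. h (\<phi> s x))"
    using set_integral_shift[of 0 t u "\<lambda>s. h (\<phi> (t + s) x)"] by simp
  finally show ?thesis by (simp add: add.commute)
qed

lemma cumrate_add:
  assumes "0 \<le> t" "0 \<le> s" "x \<in> space N"
  shows "cumrate (t + s) x = cumrate t x + cumrate s (\<phi> t x)"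
  unfolding cumrate_def set_integral_orbit_shift[OF assms(1,3)]
  using assms by (intro set_integral_Icc_split set_integrable_rate) auto

lemma cumrate_nonneg: "x \<in> space N \<Longrightarrow> 0 \<le> cumrate t x"
  unfolding cumrate_eq
  by (intro integral_nonneg_AE AE_I2) (auto simp: rate_nonneg flow_in_space)

lemma cumrate_mono:
  assumes "0 \<le> s" "s \<le> t" "x \<in> space N"
  shows "cumrate s x \<le> cumrate t x"
  using cumrate_add[of s "t - s" x] cumrate_nonneg[OF flow_in_space[of s x], of "t - s"] assms by simp

lemma cumrate_diff:
  assumes "0 \<le> s" "s \<le> t" "x \<in> space N"
  shows "cumrate t x - cumrate s x = (LBINT u:{s..t}. r (\<phi> u x))"
  using set_integral_Icc_split[OF assms(1,2) set_integrable_rate[OF assms(3) order_refl]]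
  unfolding cumrate_def by simp

lemma cumrate_Lipschitz:
  assumes "x \<in> space N"
  obtains L where "0 \<le> L"
    "\<And>s t. \<lbrakk>0 \<le> s; s \<le> t; t \<le> T\<rbrakk> \<Longrightarrow> cumrate t x - cumrate s x \<le> L * (t - s)"
    "\<And>s. s \<in> {0..T} \<Longrightarrow> r (\<phi> s x) \<le> L"
proof -
  obtain L where L: "0 \<le> L" "\<And>s. s \<in> {0..T} \<Longrightarrow> r (\<phi> s x) \<le> L"
    using rate_bound[OF assms] by metis
  have "cumrate t x - cumrate s x \<le> L * (t - s)" if "0 \<le> s" "s \<le> t" "t \<le> T" for s t
    using that L unfolding cumrate_diff[OF that(1,2) assms]
    by (intro set_integral_Icc_le set_integrable_rate assms) auto
  with L show ?thesis using that by blast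
qed

lemma continuous_on_cumrate:
  assumes "x \<in> space N"
  shows "continuous_on {0..T} (\<lambda>t. cumrate t x)"
proof -
  obtain L where L: "0 \<le> L"
    "\<And>s t. \<lbrakk>0 \<le> s; s \<le> t; t \<le> T\<rbrakk> \<Longrightarrow> cumrate t x - cumrate s x \<le> L * (t - s)"
    using cumrate_Lipschitz[OF assms] by metis
  have "L-lipschitz_on {0..T} (\<lambda>t. cumrate t x)"
  proof (rule lipschitz_onI)
    fix s t assume st: "s \<in> {0..T}" "t \<in> {0..T}"
    show "dist (cumrate s x) (cumrate t x) \<le> L * dist s t"
      using L(2)[of s t] L(2)[of t s] cumrate_mono[of s t x] cumrate_mono[of t s x] st assms
      by (cases "s \<le> t") (auto simp: dist_real_def)
  qed (fact L)
  then show ?thesis by (rule lipschitz_on_continuous_on)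
qed

text \<open>\<open>exp (- cumrate t x)\<close> is the probability of no jump up to time
  \<open>t\<close> when starting at \<open>x\<close>; formally this is minus its derivative, the
  density of the first jump time on finite times. Its total mass may be less than one.\<close>

definition jump_density :: "real \<Rightarrow> 'a \<Rightarrow> real" where
  "jump_density t x = r (\<phi> t x) * exp (- cumrate t x)"

lemma jump_density_nonneg: "\<lbrakk>0 \<le> t; x \<in> space N\<rbrakk> \<Longrightarrow> 0 \<le> jump_density t x"
  by (simp add: jump_density_def rate_nonneg flow_in_space)

lemma jump_density_le: "\<lbrakk>0 \<le> t; x \<in> space N\<rbrakk> \<Longrightarrow> jump_density t x \<le> r (\<phi> t x)"
  unfolding jump_density_def
  by (rule mult_right_le_one_le) (auto simp: rate_nonneg flow_in_space cumrate_nonneg)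

lemma jump_density_measurable [measurable (raw)]:
  assumes [measurable]: "f \<in> borel_measurable K" "g \<in> K \<rightarrow>\<^sub>M N"
  shows "(\<lambda>z. jump_density (max 0 (f z)) (g z)) \<in> borel_measurable K"
  unfolding jump_density_def by measurable

lemma set_integrable_jump_density:
  assumes "x \<in> space N" "0 \<le> a"
  shows "set_integrable lborel {a..b} (\<lambda>s. jump_density s x)"
proof -
  obtain L where L: "0 \<le> L" "\<And>s. s \<in> {0..b} \<Longrightarrow> r (\<phi> s x) \<le> L"
    using rate_bound[OF assms(1)] by metis
  have [measurable]: "(\<lambda>s. exp (- cumrate s x)) \<in> borel_measurable borel"
    using assms by measurable
  have "set_integrable lborel {a..b} (\<lambda>s. exp (- cumrate s x) * r (\<phi> s x))"
  proof (rule set_integrable_bounded_orbit[OF assms(1,2), where B=L])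
    fix s assume "s \<in> {a..b}"
    with jump_density_nonneg[of s x] jump_density_le[of s x] L(2)[of s] assms
    show "\<bar>exp (- cumrate s x) * r (\<phi> s x)\<bar> \<le> L"
      by (simp add: jump_density_def mult.commute)
  qed auto
  then show ?thesis by (simp add: jump_density_def mult.commute)
qed

text \<open>Only Lebesgue-a.e. differentiability of \<open>cumrate\<close> is available; but both sides have
  the same increments up to a quadratic error, so their difference has derivative zero.\<close>

lemma integral_jump_density:
  assumes x: "x \<in> space N" and T: "0 \<le> T"
  shows "(LBINT s:{0..T}. jump_density s x) = 1 - exp (- cumrate T x)"
proof -
  define D where "D t = 1 - exp (- cumrate t x) - (LBINT s:{0..t}. jump_density s x)" for t
  obtain L where L: "0 \<le> L"
    "\<And>s t. \<lbrakk>0 \<le> s; s \<le> t; t \<le> T\<rbrakk> \<Longrightarrow> cumrate t x - cumrate s x \<le> L * (t - s)"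
    using cumrate_Lipschitz[OF x] by metis
  \<comment> \<open>Between \<open>s\<close> and \<open>t\<close> the survival factor stays between
    its endpoint values, so the integral and the increment of \<open>1 - exp (- cumrate)\<close>
    both lie between \<open>exp (- cumrate t x) * ?d\<close> and
    \<open>exp (- cumrate s x) * ?d\<close>. These bounds differ by at most the square of
    \<open>?d\<close>, and \<open>?d\<close> is at most \<open>L * (t - s)\<close>.\<close>
  have incr: "\<bar>D t - D s\<bar> \<le> L\<^sup>2 * (t - s)\<^sup>2" if st: "0 \<le> s" "s \<le> t" "t \<le> T" for s t
  proof -
    let ?d = "cumrate t x - cumrate s x"
    have d: "0 \<le> ?d" using cumrate_mono[OF st(1,2) x] by simp
    have split: "(LBINT u:{0..t}. jump_density u x) - (LBINT u:{0..s}. jump_density u x) =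
        (LBINT u:{s..t}. jump_density u x)"
      using set_integral_Icc_split[OF st(1,2) set_integrable_jump_density[OF x order_refl]] by simp
    have mono: "cumrate s x \<le> cumrate u x" "cumrate u x \<le> cumrate t x" if "u \<in> {s..t}" for u
      using that st x by (auto intro!: cumrate_mono)
    have up: "(LBINT u:{s..t}. jump_density u x) \<le> exp (- cumrate s x) * ?d"
    proof -
      have "(LBINT u:{s..t}. jump_density u x) \<le> (LBINT u:{s..t}. exp (- cumrate s x) * r (\<phi> u x))"
        using st x mono
        by (intro set_integral_mono set_integrable_jump_density set_integrable_mult_right set_integrable_rate)
          (auto simp: jump_density_def mult.commute intro!: mult_left_mono rate_nonneg flow_in_space)
      then show ?thesis by (simp add: cumrate_diff[OF st(1,2) x])
    qed
    have lo: "exp (- cumrate t x) * ?d \<le> (LBINT u:{s..t}. jump_density u x)"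
    proof -
      have "(LBINT u:{s..t}. exp (- cumrate t x) * r (\<phi> u x)) \<le> (LBINT u:{s..t}. jump_density u x)"
        using st x mono
        by (intro set_integral_mono set_integrable_jump_density set_integrable_mult_right set_integrable_rate)
          (auto simp: jump_density_def mult.commute intro!: mult_left_mono rate_nonneg flow_in_space)
      then show ?thesis by (simp add: cumrate_diff[OF st(1,2) x])
    qed
    have e1: "exp (- cumrate s x) - exp (- cumrate t x) \<le> exp (- cumrate s x) * ?d"
    proof -
      have "exp (- cumrate t x) = exp (- cumrate s x) * exp (- ?d)" by (simp flip: exp_add)
      moreover have "exp (- cumrate s x) * (1 - ?d) \<le> exp (- cumrate s x) * exp (- ?d)"
        using exp_ge_add_one_self[of "- ?d"] by (intro mult_left_mono exp_ge_zero) linarith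
      ultimately show ?thesis by (simp add: algebra_simps)
    qed
    have e2: "exp (- cumrate t x) * ?d \<le> exp (- cumrate s x) - exp (- cumrate t x)"
    proof -
      have "exp (- cumrate s x) = exp (- cumrate t x) * exp ?d" by (simp flip: exp_add)
      moreover have "exp (- cumrate t x) * (1 + ?d) \<le> exp (- cumrate t x) * exp ?d"
        using exp_ge_add_one_self[of ?d] by (intro mult_left_mono exp_ge_zero) linarith
      ultimately show ?thesis by (simp add: algebra_simps)
    qed
    have "\<bar>D t - D s\<bar> \<le> (exp (- cumrate s x) - exp (- cumrate t x)) * ?d"
      using up lo e1 e2 split unfolding D_def by (simp add: algebra_simps abs_le_iff)
    also have "\<dots> \<le> (exp (- cumrate s x) * ?d) * ?d"
      using e1 d by (intro mult_right_mono) auto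
    also have "\<dots> \<le> (1 * ?d) * ?d"
      using d cumrate_nonneg[OF x, of s] by (intro mult_right_mono) auto
    also have "\<dots> \<le> (L * (t - s)) * (L * (t - s))"
      using L(2)[OF st] d by (simp add: mult_mono)
    finally show ?thesis by (simp add: power2_eq_square algebra_simps)
  qed
  have "(D has_field_derivative 0) (at s within {0..T})" if s: "s \<in> {0..T}" for s
    unfolding has_field_derivative_iff
  proof (rule Lim_null_comparison)
    show "\<forall>\<^sub>F t in at s within {0..T}. norm ((D t - D s) / (t - s)) \<le> L\<^sup>2 * \<bar>t - s\<bar>"
      unfolding eventually_at_filter
    proof (intro always_eventually allI impI)
      fix t assume "t \<noteq> s" "t \<in> {0..T}"
      then have "\<bar>D t - D s\<bar> \<le> L\<^sup>2 * \<bar>t - s\<bar> * \<bar>t - s\<bar>"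
        using incr[of s t] incr[of t s] s
        by (cases "s \<le> t") (auto simp: power2_eq_square abs_minus_commute algebra_simps)
      with \<open>t \<noteq> s\<close> show "norm ((D t - D s) / (t - s)) \<le> L\<^sup>2 * \<bar>t - s\<bar>"
        by (simp add: divide_simps)
    qed
    show "((\<lambda>t. L\<^sup>2 * \<bar>t - s\<bar>) \<longlongrightarrow> 0) (at s within {0..T})"
      by (rule tendsto_eq_intros refl | simp)+
  qed
  then obtain c where "\<And>t. t \<in> {0..T} \<Longrightarrow> D t = c"
    using has_field_derivative_zero_constant[of "{0..T}" D] by auto
  then have "D T = D 0" using T by simp
  moreover have "D 0 = 0"
  proof -
    have "(LBINT s:{0..0::real}. jump_density s x) = 0"
      unfolding set_lebesgue_integral_def
      by (rule integral_eq_zero_AE, rule AE_I[where N="{0}"]) (auto simp: indicator_def split: if_splits)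
    then show ?thesis by (simp add: D_def)
  qed
  ultimately show ?thesis by (simp add: D_def)
qed

end

section \<open>The waiting time until a jump\<close>

lemma prob_space_uniform01: "prob_space uniform01"
  unfolding uniform01_def by (rule prob_space_restrict_space) auto

definition jump_noise :: "(real \<times> real) measure" where
  "jump_noise = density lborel (exponential_density 1) \<Otimes>\<^sub>M uniform01"

lemma sets_jump_noise [measurable_cong]: "sets jump_noise = sets (borel \<Otimes>\<^sub>M uniform01)"
  unfolding jump_noise_def by (intro sets_pair_measure_cong) auto

definition noise :: "(nat \<Rightarrow> real \<times> real) measure" where
  "noise = (\<Pi>\<^sub>M k\<in>UNIV. jump_noise)"

lemma sets_noise [measurable_cong]: "sets noise = sets (\<Pi>\<^sub>M k\<in>(UNIV :: nat set). borel \<Otimes>\<^sub>M uniform01)"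
  unfolding noise_def by (intro sets_PiM_cong) (auto simp: sets_jump_noise)

lemma prob_space_jump_noise: "prob_space jump_noise"
proof -
  interpret E: prob_space "density lborel (exponential_density 1)"
    by (rule prob_space_exponential_density) simp
  interpret U: prob_space uniform01 by (rule prob_space_uniform01)
  interpret pair_prob_space "density lborel (exponential_density 1)" uniform01 ..
  show ?thesis unfolding jump_noise_def by (rule P.prob_space_axioms)
qed

interpretation jump_noise: prob_space jump_noise
  by (rule prob_space_jump_noise)

interpretation noise_seq: sequence_space jump_noise ..

interpretation noise: prob_space noise
  unfolding noise_def by (rule noise_seq.P.prob_space_axioms)

text \<open>The noise is its first pair together with an independent copy of the whole sequence.
  Exposing that first pair is what makes the process restart at its first jump.\<close>

lemma nn_integral_noise_split:
  assumes [measurable]: "f \<in> borel_measurable noise"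
  shows "(\<integral>\<^sup>+\<omega>. f \<omega> \<partial>noise) =
    (\<integral>\<^sup>+e. \<integral>\<^sup>+u. \<integral>\<^sup>+\<omega>. f (case_nat (e, u) \<omega>) \<partial>noise \<partial>uniform01 \<partial>density lborel (exponential_density 1))"
proof -
  interpret E: prob_space "density lborel (exponential_density 1)"
    by (rule prob_space_exponential_density) simp
  interpret U: prob_space uniform01 by (rule prob_space_uniform01)
  have [measurable]: "(\<lambda>(d, \<omega>). case_nat d \<omega>) \<in> jump_noise \<Otimes>\<^sub>M noise \<rightarrow>\<^sub>M noise"
    unfolding noise_def by measurable
  have "(\<integral>\<^sup>+\<omega>. f \<omega> \<partial>noise) = (\<integral>\<^sup>+\<omega>. f \<omega> \<partial>distr (jump_noise \<Otimes>\<^sub>M noise) noise (\<lambda>(d, \<omega>). case_nat d \<omega>))"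
    using noise_seq.PiM_iter by (simp add: noise_def)
  also have "\<dots> = (\<integral>\<^sup>+z. f (case z of (d, \<omega>) \<Rightarrow> case_nat d \<omega>) \<partial>(jump_noise \<Otimes>\<^sub>M noise))"
    by (subst nn_integral_distr) auto
  also have "\<dots> = (\<integral>\<^sup>+d. \<integral>\<^sup>+\<omega>. f (case_nat d \<omega>) \<partial>noise \<partial>jump_noise)"
    by (subst noise.nn_integral_fst[symmetric]) auto
  also have "\<dots> = (\<integral>\<^sup>+e. \<integral>\<^sup>+u. \<integral>\<^sup>+\<omega>. f (case_nat (e, u) \<omega>) \<partial>noise \<partial>uniform01 \<partial>density lborel (exponential_density 1))"
    unfolding jump_noise_def
    by (subst U.nn_integral_fst[symmetric]) (simp_all flip: jump_noise_def)
  finally show ?thesis .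
qed

lemma emeasure_exponential_lessThan:
  assumes "0 \<le> c"
  shows "emeasure (density lborel (exponential_density 1)) {..<c} = ennreal (1 - exp (- c))"
proof -
  have "emeasure (density lborel (exponential_density 1)) {..<c} =
      emeasure (density lborel (exponential_density 1)) {..c}"
  proof (rule emeasure_eq_AE)
    show "AE x in density lborel (exponential_density 1). x \<in> {..<c} \<longleftrightarrow> x \<in> {..c}"
      by (subst AE_density) (auto intro!: AE_I[where N="{c}"])
  qed auto
  then show ?thesis
    using emeasure_erlang_density[of 1 0 c] assms by (simp add: erlang_CDF_0)
qed

context flow_with_rate
begin

definition wait :: "'a \<Rightarrow> real \<Rightarrow> ereal" where
  "wait y e = Inf {ereal t | t. 0 \<le> t \<and> e < cumrate t y}"

lemma next_jump_time_eq: "next_jump_time \<phi> r S y e = ereal S + wait y e"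
proof -
  have eq: "{ereal t | t. S \<le> t \<and> e < (LBINT s:{S..t}. r (\<phi> (s - S) y))} =
      (\<lambda>t. ereal S + t) ` {ereal t | t. 0 \<le> t \<and> e < cumrate t y}"
  proof (intro set_eqI iffI)
    fix z assume "z \<in> {ereal t | t. S \<le> t \<and> e < (LBINT s:{S..t}. r (\<phi> (s - S) y))}"
    then obtain t where t: "z = ereal t" "S \<le> t" "e < (LBINT s:{S..t}. r (\<phi> (s - S) y))" by auto
    with set_integral_shift[of 0 S "t - S" "\<lambda>s. r (\<phi> s y)"]
    show "z \<in> (\<lambda>t. ereal S + t) ` {ereal t | t. 0 \<le> t \<and> e < cumrate t y}"
      by (auto simp: cumrate_def intro!: image_eqI[of _ _ "ereal (t - S)"])
  next
    fix z assume "z \<in> (\<lambda>t. ereal S + t) ` {ereal t | t. 0 \<le> t \<and> e < cumrate t y}"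
    then obtain t where t: "z = ereal (S + t)" "0 \<le> t" "e < cumrate t y" by auto
    with set_integral_shift[of 0 S t "\<lambda>s. r (\<phi> s y)"]
    show "z \<in> {ereal t | t. S \<le> t \<and> e < (LBINT s:{S..t}. r (\<phi> (s - S) y))}"
      by (auto simp: cumrate_def add.commute)
  qed
  \<comment> \<open>The empty set is treated apart: it means that no jump occurs, and both sides are
    infinite.\<close>
  have "(INF t\<in>A. ereal S + t) = ereal S + Inf A" if "\<And>z. z \<in> A \<Longrightarrow> 0 \<le> z" for A :: "ereal set"
    using that INF_ereal_add_right[of A "ereal S" "\<lambda>z. z"]
    by (cases "A = {}") (auto simp: top_ereal_def)
  from this[of "{ereal t | t. 0 \<le> t \<and> e < cumrate t y}"] show ?thesis
    unfolding next_jump_time_def wait_def eq by fastforce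
qed

lemma wait_nonneg: "0 \<le> wait y e"
  unfolding wait_def by (rule Inf_greatest) auto

text \<open>Monotonicity of \<open>cumrate\<close> lets rational times witness the infimum, so
  measurability of \<open>wait\<close> reduces to countable unions.\<close>

lemma wait_less_iff:
  assumes "y \<in> space N"
  shows "wait y e < c \<longleftrightarrow>
    (\<exists>q::rat. 0 \<le> real_of_rat q \<and> ereal (real_of_rat q) < c \<and> e < cumrate (real_of_rat q) y)"
proof
  assume "wait y e < c"
  then obtain t where t: "0 \<le> t" "e < cumrate t y" "ereal t < c"
    unfolding wait_def Inf_less_iff by auto
  then obtain q where q: "ereal t < ereal (real_of_rat q)" "ereal (real_of_rat q) < c"
    using ereal_dense3 by blast
  with t cumrate_mono[of t "real_of_rat q" y] assms
  show "\<exists>q::rat. 0 \<le> real_of_rat q \<and> ereal (real_of_rat q) < c \<and> e < cumrate (real_of_rat q) y"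
    by (intro exI[of _ q]) (auto simp del: zero_le_of_rat_iff)
next
  assume "\<exists>q::rat. 0 \<le> real_of_rat q \<and> ereal (real_of_rat q) < c \<and> e < cumrate (real_of_rat q) y"
  then show "wait y e < c" unfolding wait_def Inf_less_iff by blast
qed

lemma wait_measurable [measurable (raw)]:
  assumes [measurable]: "g \<in> K \<rightarrow>\<^sub>M N" "f \<in> borel_measurable K"
  shows "(\<lambda>z. wait (g z) (f z)) \<in> borel_measurable K"
proof (rule borel_measurableI_less)
  fix c :: ereal
  have "{z \<in> space K. wait (g z) (f z) < c} = {z \<in> space K. \<exists>q::rat. 0 \<le> real_of_rat q \<and>
      ereal (real_of_rat q) < c \<and> f z < cumrate (real_of_rat q) (g z)}"
    using wait_less_iff measurable_space[OF assms(1)] by auto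
  also have "\<dots> \<in> sets K" by measurable
  finally show "{z \<in> space K. wait (g z) (f z) < c} \<in> sets K" .
qed

text \<open>An excess of \<open>cumrate\<close> over \<open>e\<close> at time \<open>t\<close> is
  already present slightly earlier, since \<open>cumrate\<close> is Lipschitz on
  \<open>{0..t}\<close>; hence the strict inequality on the left.\<close>

lemma wait_less_real_iff:
  assumes y: "y \<in> space N" and t: "0 < t"
  shows "wait y e < ereal t \<longleftrightarrow> e < cumrate t y"
proof
  assume "wait y e < ereal t"
  then obtain q where "0 \<le> real_of_rat q" "real_of_rat q < t" "e < cumrate (real_of_rat q) y"
    using wait_less_iff[OF y] by auto
  then show "e < cumrate t y" using cumrate_mono[of "real_of_rat q" t y] y by auto
next
  assume e: "e < cumrate t y"
  obtain L where L: "0 \<le> L"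
    "\<And>s u. \<lbrakk>0 \<le> s; s \<le> u; u \<le> t\<rbrakk> \<Longrightarrow> cumrate u y - cumrate s y \<le> L * (u - s)"
    using cumrate_Lipschitz[OF y] by metis
  \<comment> \<open>Going back by \<open>d\<close> lowers \<open>cumrate\<close> by at most half of
    the excess over \<open>e\<close>; \<open>L + 1\<close> keeps the denominator positive when
    \<open>L = 0\<close>, and the cap at \<open>t\<close> keeps the time nonnegative.\<close>
  define d where "d = min t ((cumrate t y - e) / (2 * (L + 1)))"
  have d: "0 < d" "d \<le> t" using e t L by (auto simp: d_def)
  have "cumrate t y - cumrate (t - d) y \<le> L * d" using L(2)[of "t - d" t] d by simp
  also have "\<dots> \<le> (L + 1) * ((cumrate t y - e) / (2 * (L + 1)))"
    using L d by (intro mult_mono) (auto simp: d_def)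
  also have "\<dots> = (cumrate t y - e) / 2" using L by (simp add: field_simps)
  also have "\<dots> < cumrate t y - e" using e by simp
  finally have "wait y e \<le> ereal (t - d)"
    unfolding wait_def using d by (intro Inf_lower) auto
  also have "\<dots> < ereal t" using d by simp
  finally show "wait y e < ereal t" .
qed

lemma nn_integral_jump_density:
  assumes x: "x \<in> space N" and t: "0 \<le> t"
  shows "(\<integral>\<^sup>+s. indicator {0..t} s * ennreal (jump_density (max 0 s) x) \<partial>lborel) = ennreal (1 - exp (- cumrate t x))"
proof -
  have "(\<integral>\<^sup>+s. indicator {0..t} s * ennreal (jump_density (max 0 s) x) \<partial>lborel) =
      (\<integral>\<^sup>+s. ennreal (indicator {0..t} s * jump_density s x) \<partial>lborel)"
    by (intro nn_integral_cong) (auto simp: indicator_def)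
  also have "\<dots> = ennreal (\<integral>s. indicator {0..t} s * jump_density s x \<partial>lborel)"
    using set_integrable_jump_density[OF x order_refl, of t] x
    by (intro nn_integral_eq_integral)
      (auto simp: set_integrable_def jump_density_nonneg indicator_def)
  also have "\<dots> = ennreal (1 - exp (- cumrate t x))"
    using integral_jump_density[OF x t] by (simp add: set_lebesgue_integral_def)
  finally show ?thesis .
qed

text \<open>The exponential law pushed forward by \<open>wait\<close>, restricted to finite values,
  and the measure with density \<open>jump_density\<close> agree on all open left rays, which are
  stable under intersection and generate the Borel sets. Both may have total mass below one.\<close>

lemma nn_integral_wait:
  assumes y: "y \<in> space N" and [measurable]: "F \<in> borel_measurable borel"
  shows "(\<integral>\<^sup>+e. (if wait y e < \<infinity> then F (real_of_ereal (wait y e)) else 0) \<partial>density lborel (exponential_density 1)) =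
    (\<integral>\<^sup>+s. indicator {0..} s * ennreal (jump_density (max 0 s) y) * F s \<partial>lborel)"
proof -
  let ?X = "density lborel (exponential_density 1)"
  have [measurable]: "(\<lambda>e. wait y e) \<in> borel_measurable borel" using y by measurable
  have [measurable]: "(\<lambda>s. jump_density (max 0 s) y) \<in> borel_measurable borel" using y by measurable
  define m1 where "m1 = distr (density ?X (indicator {e. wait y e < \<infinity>})) borel (\<lambda>e. real_of_ereal (wait y e))"
  define m2 where "m2 = density lborel (\<lambda>s. indicator {0..} s * ennreal (jump_density (max 0 s) y))"
  have m1: "emeasure m1 {..<t} = (if 0 < t then ennreal (1 - exp (- cumrate t y)) else 0)" for t
  proof -
    have "emeasure m1 {..<t} = emeasure (density ?X (indicator {e. wait y e < \<infinity>})) {e. real_of_ereal (wait y e) < t}"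
      unfolding m1_def by (subst emeasure_distr) (auto simp: vimage_def)
    also have "\<dots> = emeasure ?X {e. wait y e < \<infinity> \<and> real_of_ereal (wait y e) < t}"
    proof (subst emeasure_density)
      show "(\<integral>\<^sup>+e. indicator {e. wait y e < \<infinity>} e * indicator {e. real_of_ereal (wait y e) < t} e \<partial>?X) =
          emeasure ?X {e. wait y e < \<infinity> \<and> real_of_ereal (wait y e) < t}"
        by (subst nn_integral_indicator[symmetric], measurable)
          (auto intro!: nn_integral_cong simp: indicator_def simp del: nn_integral_indicator)
    qed auto
    also have "{e. wait y e < \<infinity> \<and> real_of_ereal (wait y e) < t} = {e. wait y e < ereal t}"
    proof (intro Collect_cong)
      fix e show "(wait y e < \<infinity> \<and> real_of_ereal (wait y e) < t) = (wait y e < ereal t)"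
        using wait_nonneg[of y e] by (cases "wait y e") auto
    qed
    also have "\<dots> = (if 0 < t then {..<cumrate t y} else {})"
    proof (cases "0 < t")
      case True then show ?thesis using wait_less_real_iff[OF y] by auto
    next
      case False
      then have "ereal t \<le> wait y e" for e by (intro order_trans[OF _ wait_nonneg]) simp
      with False show ?thesis by (auto simp: not_less)
    qed
    finally show ?thesis
      using emeasure_exponential_lessThan[OF cumrate_nonneg[OF y], of t] by simp
  qed
  have m2: "emeasure m2 {..<t} = (if 0 < t then ennreal (1 - exp (- cumrate t y)) else 0)" for t
  proof (cases "0 < t")
    case True
    have "emeasure m2 {..<t} = (\<integral>\<^sup>+s. indicator {0..} s * ennreal (jump_density (max 0 s) y) * indicator {..<t} s \<partial>lborel)"
      unfolding m2_def by (subst emeasure_density) auto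
    also have "\<dots> = (\<integral>\<^sup>+s. indicator {0..t} s * ennreal (jump_density (max 0 s) y) \<partial>lborel)"
      by (intro nn_integral_cong_AE AE_I[where N="{t}"]) (auto simp: indicator_def)
    finally show ?thesis using True nn_integral_jump_density[OF y] by simp
  next
    case False
    have "emeasure m2 {..<t} = (\<integral>\<^sup>+s. indicator {0..} s * ennreal (jump_density (max 0 s) y) * indicator {..<t} s \<partial>lborel)"
      unfolding m2_def by (subst emeasure_density) auto
    also have "\<dots> = (\<integral>\<^sup>+s. 0 \<partial>(lborel :: real measure))"
      using False by (intro nn_integral_cong) (auto simp: indicator_def)
    finally show ?thesis using False by simp
  qed
  have "m1 = m2"
  proof (rule measure_eqI_generator_eq[where E="range (\<lambda>t. {..<t})" and \<Omega>=UNIV and A="\<lambda>n. {..<real n}"])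
    show "Int_stable (range (\<lambda>t::real. {..<t}))"
    proof (clarsimp simp: Int_stable_def)
      fix a b :: real
      have "{..<a} \<inter> {..<b} = {..<min a b}" by auto
      then show "{..<a} \<inter> {..<b} \<in> range lessThan" by blast
    qed
    show "sets m1 = sigma_sets UNIV (range (\<lambda>t::real. {..<t}))"
      "sets m2 = sigma_sets UNIV (range (\<lambda>t::real. {..<t}))"
      by (simp_all add: m1_def m2_def borel_eq_lessThan eucl_lessThan)
    show "(\<Union>n. {..<real n}) = UNIV" using reals_Archimedean2 by auto
    show "emeasure m1 {..<real n} \<noteq> \<infinity>" for n by (simp add: m1)
  qed (auto simp: m1 m2)
  moreover have "(\<integral>\<^sup>+s. F s \<partial>m1) = (\<integral>\<^sup>+e. (if wait y e < \<infinity> then F (real_of_ereal (wait y e)) else 0) \<partial>?X)"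
    unfolding m1_def
    by (subst nn_integral_distr, simp, simp, subst nn_integral_density)
      (auto intro!: nn_integral_cong simp: indicator_def)
  moreover have "(\<integral>\<^sup>+s. F s \<partial>m2) = (\<integral>\<^sup>+s. indicator {0..} s * ennreal (jump_density (max 0 s) y) * F s \<partial>lborel)"
    unfolding m2_def by (subst nn_integral_density) auto
  ultimately show ?thesis by simp
qed

end

section \<open>Decomposition at the first jump\<close>

text \<open>Non-explosion is stated for a fixed starting point and all times at once; Dirac initial
  laws supply it. The kernel is the image of the uniform law under \<open>G\<close>, the form in
  which it appears in expectations over the noise.\<close>

locale pdmp_construction = flow_with_rate N \<phi> r
  for N :: "'a measure" and \<phi> :: "real \<Rightarrow> 'a \<Rightarrow> 'a" and r :: "'a \<Rightarrow> real" +
  fixes Q :: "'a \<Rightarrow> 'a measure" and G :: "'a \<Rightarrow> real \<Rightarrow> 'a"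
  assumes kernel_measurable: "Q \<in> N \<rightarrow>\<^sub>M prob_algebra N"
    and G_measurable: "(\<lambda>(x, u). G x u) \<in> N \<Otimes>\<^sub>M uniform01 \<rightarrow>\<^sub>M N"
    and kernel_eq: "x \<in> space N \<Longrightarrow> Q x = distr uniform01 N (G x)"
    and non_explosive: "x \<in> space N \<Longrightarrow> AE \<omega> in noise. \<forall>t\<ge>0. pdmp \<phi> r G t (x, \<omega>) \<noteq> None"
begin

lemma G_measurable' [measurable (raw)]:
  assumes [measurable]: "g \<in> K \<rightarrow>\<^sub>M N" "f \<in> K \<rightarrow>\<^sub>M uniform01"
  shows "(\<lambda>z. G (g z) (f z)) \<in> K \<rightarrow>\<^sub>M N"
proof -
  have "(\<lambda>z. (g z, f z)) \<in> K \<rightarrow>\<^sub>M N \<Otimes>\<^sub>M uniform01" by measurable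
  from measurable_compose[OF this G_measurable] show ?thesis by simp
qed

lemma kernel_measurable_subprob [measurable]: "Q \<in> N \<rightarrow>\<^sub>M subprob_algebra N"
  by (rule measurable_prob_algebraD[OF kernel_measurable])

lemma prob_space_kernel: "x \<in> space N \<Longrightarrow> prob_space (Q x)"
  using measurable_space[OF kernel_measurable] by (auto simp: space_prob_algebra)

lemma sets_kernel_N: "x \<in> space N \<Longrightarrow> sets (Q x) = sets N"
  using measurable_space[OF kernel_measurable] by (auto simp: space_prob_algebra)

text \<open>One jump of \<open>pdmp_skeleton\<close>, rewritten with the relative waiting time and
  the guarded flow: the time increment and the new position then do not depend on absolute time, and
  the recursion is visibly measurable.\<close>

definition step :: "ereal \<times> 'a \<Rightarrow> real \<times> real \<Rightarrow> ereal \<times> 'a" where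
  "step q d = (if fst q = \<infinity> \<or> wait (snd q) (fst d) = \<infinity> then (\<infinity>, snd q)
     else (fst q + wait (snd q) (fst d), G (\<phi> (max 0 (real_of_ereal (wait (snd q) (fst d)))) (snd q)) (snd d)))"

primrec skel :: "'a \<Rightarrow> (nat \<Rightarrow> real \<times> real) \<Rightarrow> nat \<Rightarrow> ereal \<times> 'a" where
  "skel x \<omega> 0 = (0, x)"
| "skel x \<omega> (Suc k) = step (skel x \<omega> k) (\<omega> k)"

lemma fst_skel_nonneg: "0 \<le> fst (skel x \<omega> k)"
  by (induction k) (auto simp: step_def wait_nonneg)

lemma pdmp_skeleton_eq: "pdmp_skeleton \<phi> r G (x, \<omega>) k = skel x \<omega> k"
proof (induction k)
  case (Suc k)
  obtain S y where q: "skel x \<omega> k = (S, y)" by (cases "skel x \<omega> k")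
  obtain e u where d: "\<omega> k = (e, u)" by (cases "\<omega> k")
  have S: "0 \<le> S" using fst_skel_nonneg[of x \<omega> k] q by simp
  show ?case
  proof (cases "S = \<infinity> \<or> wait y e = \<infinity>")
    case True
    then show ?thesis using S
      by (cases S) (auto simp: Suc q d step_def next_jump_time_eq)
  next
    case False
    with S wait_nonneg[of y e] obtain s w where "S = ereal s" "wait y e = ereal w" "0 \<le> s" "0 \<le> w"
      by (cases S; cases "wait y e") auto
    then show ?thesis by (auto simp: Suc q d step_def next_jump_time_eq)
  qed
qed simp

lemma fst_skel_mono: "fst (skel x \<omega> k) \<le> fst (skel x \<omega> (Suc k))"
  using wait_nonneg by (auto simp: step_def intro: add_increasing2)

lemma incseq_skel: "incseq (\<lambda>k. fst (skel x \<omega> k))"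
  by (intro incseq_SucI fst_skel_mono)

text \<open>Restart at the first jump: from then on the skeleton is that of the post-jump point
  driven by the remaining noise, with all times delayed by the first waiting time. Once a time is
  infinite, so are all later ones, which accounts for the dummy branch.\<close>

lemma skel_case_nat:
  "skel x (case_nat d \<omega>) (Suc k) = (if wait x (fst d) = \<infinity> then (\<infinity>, x) else
     (wait x (fst d) + fst (skel (G (\<phi> (max 0 (real_of_ereal (wait x (fst d)))) x) (snd d)) \<omega> k),
      snd (skel (G (\<phi> (max 0 (real_of_ereal (wait x (fst d)))) x) (snd d)) \<omega> k)))"
proof (induction k)
  case 0
  then show ?case by (simp add: step_def)
next
  case (Suc k)
  have "skel x (case_nat d \<omega>) (Suc (Suc k)) = step (skel x (case_nat d \<omega>) (Suc k)) (\<omega> k)"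
    by simp
  also have "\<dots> = (if wait x (fst d) = \<infinity> then (\<infinity>, x) else
     (wait x (fst d) + fst (skel (G (\<phi> (max 0 (real_of_ereal (wait x (fst d)))) x) (snd d)) \<omega> (Suc k)),
      snd (skel (G (\<phi> (max 0 (real_of_ereal (wait x (fst d)))) x) (snd d)) \<omega> (Suc k))))"
    unfolding Suc by (auto simp: step_def ac_simps)
  finally show ?case .
qed

lemma skel_measurable:
  "(\<lambda>(x, \<omega>). skel x \<omega> k) \<in> N \<Otimes>\<^sub>M noise \<rightarrow>\<^sub>M borel \<Otimes>\<^sub>M N"
proof (induction k)
  case (Suc k)
  have [measurable]: "(\<lambda>z. fst (skel (fst z) (snd z) k)) \<in> borel_measurable (N \<Otimes>\<^sub>M noise)"
    "(\<lambda>z. snd (skel (fst z) (snd z) k)) \<in> N \<Otimes>\<^sub>M noise \<rightarrow>\<^sub>M N"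
    using measurable_compose[OF Suc measurable_fst] measurable_compose[OF Suc measurable_snd]
    by (auto simp: case_prod_beta)
  have [measurable]: "(\<lambda>z. snd z k) \<in> N \<Otimes>\<^sub>M noise \<rightarrow>\<^sub>M borel \<Otimes>\<^sub>M uniform01"
    by measurable
  show ?case unfolding skel.simps step_def case_prod_beta by measurable
qed (simp add: case_prod_beta)

lemma skel_measurable' [measurable (raw)]:
  assumes [measurable]: "g \<in> K \<rightarrow>\<^sub>M N" "h \<in> K \<rightarrow>\<^sub>M noise"
  shows "(\<lambda>z. skel (g z) (h z) k) \<in> K \<rightarrow>\<^sub>M borel \<Otimes>\<^sub>M N"
proof -
  have "(\<lambda>z. (g z, h z)) \<in> K \<rightarrow>\<^sub>M N \<Otimes>\<^sub>M noise" by measurable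
  from measurable_compose[OF this skel_measurable] show ?thesis by simp
qed

text \<open>A version of \<open>pdmp\<close> without cemetery point, so that it is measurable into
  \<open>N\<close>. The default \<open>x\<close> is taken only when no (possibly infinite) jump time
  exceeds \<open>t\<close>, which for \<open>0 \<le> t\<close> has probability zero by
  non-explosion.\<close>

definition state :: "real \<Rightarrow> 'a \<Rightarrow> (nat \<Rightarrow> real \<times> real) \<Rightarrow> 'a" where
  "state t x \<omega> = (let k = LEAST k. ereal t < fst (skel x \<omega> (Suc k)) in
     if ereal t < fst (skel x \<omega> (Suc k))
     then \<phi> (max 0 (t - real_of_ereal (fst (skel x \<omega> k)))) (snd (skel x \<omega> k)) else x)"

lemma state_measurable [measurable (raw)]:
  assumes [measurable]: "f \<in> borel_measurable K" "g \<in> K \<rightarrow>\<^sub>M N" "h \<in> K \<rightarrow>\<^sub>M noise"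
  shows "(\<lambda>z. state (f z) (g z) (h z)) \<in> K \<rightarrow>\<^sub>M N"
proof -
  have "(\<lambda>z. (\<lambda>k z. if ereal (f z) < fst (skel (g z) (h z) (Suc k))
     then \<phi> (max 0 (f z - real_of_ereal (fst (skel (g z) (h z) k)))) (snd (skel (g z) (h z) k)) else g z)
     (LEAST k. ereal (f z) < fst (skel (g z) (h z) (Suc k))) z) \<in> K \<rightarrow>\<^sub>M N"
    by (rule measurable_compose_countable) measurable
  then show ?thesis unfolding state_def Let_def .
qed

lemma least_jump_index:
  assumes "0 \<le> t" "ereal t < fst (skel x \<omega> (Suc j))"
  defines "k \<equiv> LEAST k. ereal t < fst (skel x \<omega> (Suc k))"
  shows "ereal t < fst (skel x \<omega> (Suc k))" "fst (skel x \<omega> k) \<le> ereal t"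
    "\<And>i. fst (skel x \<omega> i) \<le> ereal t \<Longrightarrow> ereal t < fst (skel x \<omega> (Suc i)) \<Longrightarrow> i = k"
proof -
  show less: "ereal t < fst (skel x \<omega> (Suc k))"
    unfolding k_def by (rule LeastI) fact
  show le: "fst (skel x \<omega> k) \<le> ereal t"
  proof (cases k)
    case (Suc i)
    then have "\<not> ereal t < fst (skel x \<omega> (Suc i))"
      unfolding k_def by (intro not_less_Least) auto
    with Suc show ?thesis by simp
  qed (use assms in simp)
  fix i assume i: "fst (skel x \<omega> i) \<le> ereal t" "ereal t < fst (skel x \<omega> (Suc i))"
  have "k \<le> i" unfolding k_def by (rule Least_le) fact
  moreover have "\<not> Suc k \<le> i"
    using incseqD[OF incseq_skel, of "Suc k" i x \<omega>] less i by auto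
  ultimately show "i = k" by simp
qed

lemma pdmp_eq_state:
  assumes "0 \<le> t" "pdmp \<phi> r G t (x, \<omega>) \<noteq> None"
  shows "\<exists>k. ereal t < fst (skel x \<omega> (Suc k))" "pdmp \<phi> r G t (x, \<omega>) = Some (state t x \<omega>)"
proof -
  have *: "ereal t < (SUP k. fst (skel x \<omega> k))"
    using assms(2) by (auto simp: pdmp_def pdmp_skeleton_eq Let_def split: if_splits)
  then obtain k where "ereal t < fst (skel x \<omega> k)" unfolding less_SUP_iff by auto
  with fst_skel_mono[of x \<omega> k] show ex: "\<exists>k. ereal t < fst (skel x \<omega> (Suc k))"
    by (meson less_le_trans)
  then obtain j where j: "ereal t < fst (skel x \<omega> (Suc j))" ..
  define k where "k = (LEAST k. ereal t < fst (skel x \<omega> (Suc k)))"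
  note k = least_jump_index[OF assms(1) j, folded k_def]
  have "real_of_ereal (fst (skel x \<omega> k)) \<le> t"
    using k(2) fst_skel_nonneg[of x \<omega> k] by (cases "fst (skel x \<omega> k)") auto
  then show "pdmp \<phi> r G t (x, \<omega>) = Some (state t x \<omega>)"
    using * k(1) unfolding pdmp_def state_def pdmp_skeleton_eq Let_def k_def[symmetric]
    by simp
qed

text \<open>The value of \<open>f\<close> at time \<open>t\<close> on the event of exactly
  \<open>k\<close> jumps so far. Splitting by this number makes the restart at the first jump an
  index shift.\<close>

definition contrib :: "('a \<Rightarrow> ennreal) \<Rightarrow> nat \<Rightarrow> real \<Rightarrow> 'a \<Rightarrow> (nat \<Rightarrow> real \<times> real) \<Rightarrow> ennreal" where
  "contrib f k t x \<omega> = (if fst (skel x \<omega> k) \<le> ereal t \<and> ereal t < fst (skel x \<omega> (Suc k))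
     then f (\<phi> (max 0 (t - real_of_ereal (fst (skel x \<omega> k)))) (snd (skel x \<omega> k))) else 0)"

lemma contrib_measurable [measurable (raw)]:
  assumes [measurable]: "f \<in> borel_measurable N" "a \<in> borel_measurable K" "g \<in> K \<rightarrow>\<^sub>M N" "h \<in> K \<rightarrow>\<^sub>M noise"
  shows "(\<lambda>z. contrib f k (a z) (g z) (h z)) \<in> borel_measurable K"
  unfolding contrib_def by measurable

lemma suminf_contrib:
  assumes "0 \<le> t" "ereal t < fst (skel x \<omega> (Suc j))"
  shows "(\<Sum>k. contrib f k t x \<omega>) = f (state t x \<omega>)"
proof -
  define k where "k = (LEAST k. ereal t < fst (skel x \<omega> (Suc k)))"
  note k = least_jump_index[OF assms, folded k_def]
  have "(\<Sum>k. contrib f k t x \<omega>) = (\<Sum>k\<in>{k}. contrib f k t x \<omega>)"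
    using k(3) by (intro suminf_finite) (auto simp: contrib_def)
  also have "\<dots> = f (state t x \<omega>)"
    using k(1,2) by (simp add: contrib_def state_def k_def[symmetric] Let_def del: skel.simps)
  finally show ?thesis .
qed

lemma contrib_0_case_nat:
  "contrib f 0 t x (case_nat d \<omega>) = (if 0 \<le> t \<and> ereal t < wait x (fst d) then f (\<phi> (max 0 t) x) else 0)"
  by (auto simp: contrib_def step_def)

text \<open>Having made \<open>Suc k\<close> jumps at time \<open>t\<close> means that the restarted
  process has made \<open>k\<close> of them at the remaining time. That time may be negative, and
  then both sides vanish because jump times are nonnegative.\<close>

lemma contrib_Suc_case_nat:
  "contrib f (Suc k) t x (case_nat d \<omega>) = (if wait x (fst d) < \<infinity> then
     contrib f k (t - real_of_ereal (wait x (fst d)))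
       (G (\<phi> (max 0 (real_of_ereal (wait x (fst d)))) x) (snd d)) \<omega> else 0)"
proof (cases "wait x (fst d)")
  case (real w)
  have le: "ereal w + a \<le> ereal t \<longleftrightarrow> a \<le> ereal (t - w)" "ereal t < ereal w + a \<longleftrightarrow> ereal (t - w) < a" for a
    by (cases a; auto)+
  let ?y = "G (\<phi> (max 0 w) x) (snd d)"
  show ?thesis
  proof (cases "fst (skel ?y \<omega> k)")
    case (real a)
    then show ?thesis
      unfolding contrib_def skel_case_nat using \<open>wait x (fst d) = ereal w\<close>
      by (auto simp: le diff_diff_eq simp del: skel.simps)
  qed (use fst_skel_nonneg[of ?y \<omega> k] \<open>wait x (fst d) = ereal w\<close> in
      \<open>auto simp: contrib_def skel_case_nat simp del: skel.simps\<close>)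
qed (use wait_nonneg[of x "fst d"] in \<open>auto simp: contrib_def skel_case_nat simp del: skel.simps\<close>)

definition jump_term :: "('a \<Rightarrow> ennreal) \<Rightarrow> nat \<Rightarrow> real \<Rightarrow> 'a \<Rightarrow> ennreal" where
  "jump_term f k t x = (\<integral>\<^sup>+\<omega>. contrib f k t x \<omega> \<partial>noise)"

lemma jump_term_measurable [measurable (raw)]:
  assumes [measurable]: "f \<in> borel_measurable N" "a \<in> borel_measurable K" "g \<in> K \<rightarrow>\<^sub>M N"
  shows "(\<lambda>z. jump_term f k (a z) (g z)) \<in> borel_measurable K"
  unfolding jump_term_def by measurable

text \<open>Conditioning on the first jump: at time \<open>s\<close> with density
  \<open>jump_density\<close>, then a move by \<open>Q\<close>, then \<open>u\<close> for the
  remaining time. The event of no jump up to \<open>t\<close> is left out; it enters equations as a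
  separate term.\<close>

definition renewal :: "(real \<Rightarrow> 'a \<Rightarrow> ennreal) \<Rightarrow> real \<Rightarrow> 'a \<Rightarrow> ennreal" where
  "renewal u t x = (\<integral>\<^sup>+s. indicator {0..t} s * ennreal (jump_density (max 0 s) x) *
     (\<integral>\<^sup>+y. u (t - s) y \<partial>Q (\<phi> (max 0 s) x)) \<partial>lborel)"

lemma kernel_integral_measurable [measurable (raw)]:
  assumes u: "(\<lambda>(z, y). u z y) \<in> borel_measurable (K \<Otimes>\<^sub>M N)" and [measurable]: "g \<in> K \<rightarrow>\<^sub>M N"
  shows "(\<lambda>z. \<integral>\<^sup>+y. u z y \<partial>Q (g z)) \<in> borel_measurable K"
  by (rule nn_integral_measurable_subprob_algebra2[OF u]) measurable

lemma jump_term_0: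
  assumes x: "x \<in> space N" and [measurable]: "f \<in> borel_measurable N"
  shows "jump_term f 0 t x = indicator {0..} t * ennreal (exp (- cumrate t x)) * f (\<phi> (max 0 t) x)"
proof (cases "0 \<le> t")
  case False
  then show ?thesis
    using fst_skel_nonneg by (simp add: jump_term_def contrib_def)
next
  case True
  let ?X = "density lborel (exponential_density 1)"
  interpret E: prob_space ?X by (rule prob_space_exponential_density) simp
  interpret U: prob_space uniform01 by (rule prob_space_uniform01)
  have [measurable]: "(\<lambda>e. wait x e) \<in> borel_measurable borel" using x by measurable
  have [measurable]: "(\<lambda>\<omega>. contrib f 0 t x \<omega>) \<in> borel_measurable noise" using x by measurable
  \<comment> \<open>The survival probability is obtained as a complement:
    \<open>nn_integral_wait\<close> sees only finite waiting times, whereas the event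
    \<open>ereal t < wait x e\<close> includes an infinite one.\<close>
  have "(if wait x e < \<infinity> then indicator {..t} (real_of_ereal (wait x e)) else 0) =
      (indicator {e. wait x e \<le> ereal t} e :: ennreal)" for e
    using wait_nonneg[of x e] by (cases "wait x e") (auto simp: indicator_def)
  then have "emeasure ?X {e. wait x e \<le> ereal t} =
      (\<integral>\<^sup>+e. (if wait x e < \<infinity> then indicator {..t} (real_of_ereal (wait x e)) else 0) \<partial>?X)"
    by simp
  also have "\<dots> = (\<integral>\<^sup>+s. indicator {0..} s * ennreal (jump_density (max 0 s) x) * indicator {..t} s \<partial>lborel)"
    by (rule nn_integral_wait[OF x]) simp
  also have "\<dots> = (\<integral>\<^sup>+s. indicator {0..t} s * ennreal (jump_density (max 0 s) x) \<partial>lborel)"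
    by (intro nn_integral_cong) (auto simp: indicator_def)
  also have "\<dots> = ennreal (1 - exp (- cumrate t x))"
    by (rule nn_integral_jump_density[OF x True])
  finally have le: "emeasure ?X {e. wait x e \<le> ereal t} = ennreal (1 - exp (- cumrate t x))" .
  have "{e. ereal t < wait x e} = space ?X - {e. wait x e \<le> ereal t}" by auto
  then have "emeasure ?X {e. ereal t < wait x e} = emeasure ?X (space ?X) - emeasure ?X {e. wait x e \<le> ereal t}"
    by (simp only:) (rule emeasure_compl, auto simp: le)
  also have "\<dots> = ennreal (exp (- cumrate t x))"
    using cumrate_nonneg[OF x, of t] unfolding le E.emeasure_space_1 ennreal_1[symmetric]
    by (subst ennreal_minus) auto
  finally have gt: "emeasure ?X {e. ereal t < wait x e} = ennreal (exp (- cumrate t x))" .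
  have "jump_term f 0 t x = (\<integral>\<^sup>+e. \<integral>\<^sup>+u. \<integral>\<^sup>+\<omega>. (if 0 \<le> t \<and> ereal t < wait x e then f (\<phi> (max 0 t) x) else 0) \<partial>noise \<partial>uniform01 \<partial>?X)"
    unfolding jump_term_def by (subst nn_integral_noise_split) (auto simp: contrib_0_case_nat)
  also have "\<dots> = (\<integral>\<^sup>+e. f (\<phi> (max 0 t) x) * indicator {e. ereal t < wait x e} e \<partial>?X)"
    using True by (auto intro!: nn_integral_cong simp: noise.emeasure_space_1 U.emeasure_space_1)
  also have "\<dots> = f (\<phi> (max 0 t) x) * emeasure ?X {e. ereal t < wait x e}"
    by (subst nn_integral_cmult_indicator) auto
  finally show ?thesis using True gt by (simp add: mult.commute)
qed

lemma jump_term_Suc: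
  assumes x: "x \<in> space N" and [measurable]: "f \<in> borel_measurable N"
  shows "jump_term f (Suc k) t x = renewal (jump_term f k) t x"
proof -
  let ?X = "density lborel (exponential_density 1)"
  interpret U: prob_space uniform01 by (rule prob_space_uniform01)
  have [measurable]: "(\<lambda>\<omega>. contrib f (Suc k) t x \<omega>) \<in> borel_measurable noise" using x by measurable
  \<comment> \<open>At negative remaining time nothing contributes, so the integral over all jump
    times \<open>s\<close> may be cut off at \<open>t\<close>, as in \<open>renewal\<close>.\<close>
  have neg: "jump_term f k s y = 0" if "s < 0" for s y
  proof -
    have "\<not> fst (skel y \<omega> k) \<le> ereal s" for \<omega>
      using fst_skel_nonneg[of y \<omega> k] that by (cases "fst (skel y \<omega> k)") auto
    then show ?thesis by (simp add: jump_term_def contrib_def)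
  qed
  have inner: "(\<integral>\<^sup>+u. \<integral>\<^sup>+\<omega>. contrib f (Suc k) t x (case_nat (e, u) \<omega>) \<partial>noise \<partial>uniform01) =
      (if wait x e < \<infinity> then (\<lambda>s. \<integral>\<^sup>+y. jump_term f k (t - s) y \<partial>Q (\<phi> (max 0 s) x)) (real_of_ereal (wait x e)) else 0)" for e
  proof -
    let ?y = "\<phi> (max 0 (real_of_ereal (wait x e))) x"
    have y: "?y \<in> space N" using x by (intro flow_in_space) auto
    have [measurable]: "G ?y \<in> uniform01 \<rightarrow>\<^sub>M N" using y by measurable
    have "(\<integral>\<^sup>+u. \<integral>\<^sup>+\<omega>. contrib f (Suc k) t x (case_nat (e, u) \<omega>) \<partial>noise \<partial>uniform01) =
      (if wait x e < \<infinity> then (\<integral>\<^sup>+u. jump_term f k (t - real_of_ereal (wait x e)) (G ?y u) \<partial>uniform01) else 0)"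
      by (simp add: contrib_Suc_case_nat jump_term_def)
    also have "(\<integral>\<^sup>+u. jump_term f k (t - real_of_ereal (wait x e)) (G ?y u) \<partial>uniform01) =
        (\<integral>\<^sup>+y. jump_term f k (t - real_of_ereal (wait x e)) y \<partial>Q ?y)"
      unfolding kernel_eq[OF y] by (subst nn_integral_distr) auto
    finally show ?thesis by simp
  qed
  have [measurable]: "(\<lambda>s. \<integral>\<^sup>+y. jump_term f k (t - s) y \<partial>Q (\<phi> (max 0 s) x)) \<in> borel_measurable borel"
    using x by measurable
  have "jump_term f (Suc k) t x = (\<integral>\<^sup>+e. (if wait x e < \<infinity> then
      (\<lambda>s. \<integral>\<^sup>+y. jump_term f k (t - s) y \<partial>Q (\<phi> (max 0 s) x)) (real_of_ereal (wait x e)) else 0) \<partial>?X)"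
    unfolding jump_term_def[of f "Suc k"] by (subst nn_integral_noise_split) (auto simp only: inner, measurable)
  also have "\<dots> = (\<integral>\<^sup>+s. indicator {0..} s * ennreal (jump_density (max 0 s) x) *
      (\<integral>\<^sup>+y. jump_term f k (t - s) y \<partial>Q (\<phi> (max 0 s) x)) \<partial>lborel)"
    by (rule nn_integral_wait[OF x]) simp
  also have "\<dots> = renewal (jump_term f k) t x"
  proof -
    have "jump_term f k (t - s) = (\<lambda>_. 0)" if "t < s" for s
      using neg[of "t - s"] that by auto
    then show ?thesis
      unfolding renewal_def by (intro nn_integral_cong) (auto simp: indicator_def not_le)
  qed
  finally show ?thesis .
qed

end

section \<open>The renewal equation\<close>

lemma (in prob_space) integrable_bounded:
  fixes f :: "'a \<Rightarrow> real"
  assumes "f \<in> borel_measurable M" "\<And>x. x \<in> space M \<Longrightarrow> \<bar>f x\<bar> \<le> B"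
  shows "integrable M f"
  using assms by (intro integrable_const_bound[where B=B]) auto

lemma prob_algebra_kernelD:
  assumes "K \<in> L \<rightarrow>\<^sub>M prob_algebra N" "x \<in> space L"
  shows "prob_space (K x)" "sets (K x) = sets N" "space (K x) = space N"
proof -
  have "K x \<in> space (prob_algebra N)" using measurable_space[OF assms] .
  then show "prob_space (K x)" "sets (K x) = sets N" by (auto simp: space_prob_algebra)
  then show "space (K x) = space N" by (intro sets_eq_imp_space_eq)
qed

lemma kernel_measurable_function:
  assumes "K \<in> L \<rightarrow>\<^sub>M prob_algebra N" "x \<in> space L" "f \<in> N \<rightarrow>\<^sub>M B"
  shows "f \<in> K x \<rightarrow>\<^sub>M B"
  using assms(3) measurable_cong_sets[OF prob_algebra_kernelD(2)[OF assms(1,2)] refl] by blast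

lemma kernel_integrable_bounded:
  fixes f :: "'a \<Rightarrow> real"
  assumes K: "K \<in> L \<rightarrow>\<^sub>M prob_algebra N" "x \<in> space L"
    and f: "f \<in> borel_measurable N" "\<And>y. y \<in> space N \<Longrightarrow> \<bar>f y\<bar> \<le> B"
  shows "integrable (K x) f"
proof -
  interpret prob_space "K x" by (rule prob_algebra_kernelD[OF K])
  show ?thesis
    using kernel_measurable_function[OF K f(1)] f(2) prob_algebra_kernelD(3)[OF K]
    by (intro integrable_bounded[where B=B]) auto
qed

lemma act_abs_le:
  fixes f :: "'a \<Rightarrow> real"
  assumes K: "K \<in> L \<rightarrow>\<^sub>M prob_algebra N" "x \<in> space L"
    and f: "f \<in> borel_measurable N" "\<And>y. y \<in> space N \<Longrightarrow> \<bar>f y\<bar> \<le> B"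
  shows "\<bar>act K f x\<bar> \<le> B"
proof -
  interpret prob_space "K x" by (rule prob_algebra_kernelD[OF K])
  note i = kernel_integrable_bounded[OF K f]
  have "\<bar>act K f x\<bar> \<le> (\<integral>y. \<bar>f y\<bar> \<partial>K x)" unfolding act_def by (rule integral_abs_bound)
  also have "\<dots> \<le> (\<integral>y. B \<partial>K x)"
    using i f(2) prob_algebra_kernelD[OF K] by (intro integral_mono) auto
  finally show ?thesis by (simp add: prob_space)
qed

lemma act_diff:
  fixes f g :: "'a \<Rightarrow> real"
  assumes K: "K \<in> L \<rightarrow>\<^sub>M prob_algebra N" "x \<in> space L"
    and f: "f \<in> borel_measurable N" "\<And>y. y \<in> space N \<Longrightarrow> \<bar>f y\<bar> \<le> B"
    and g: "g \<in> borel_measurable N" "\<And>y. y \<in> space N \<Longrightarrow> \<bar>g y\<bar> \<le> C"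
  shows "act K (\<lambda>y. f y - g y) x = act K f x - act K g x"
  unfolding act_def
  by (rule Bochner_Integration.integral_diff[OF kernel_integrable_bounded[OF K f] kernel_integrable_bounded[OF K g]])

lemma act_const:
  assumes K: "K \<in> L \<rightarrow>\<^sub>M prob_algebra N" "x \<in> space L"
  shows "act K (\<lambda>_. c) x = c"
proof -
  interpret prob_space "K x" by (rule prob_algebra_kernelD[OF K])
  show ?thesis by (simp add: act_def prob_space)
qed

lemma act_cong:
  assumes K: "K \<in> L \<rightarrow>\<^sub>M prob_algebra N" "x \<in> space L" "\<And>y. y \<in> space N \<Longrightarrow> f y = g y"
  shows "act K f x = act K g x"
  unfolding act_def using assms(3) prob_algebra_kernelD(3)[OF K(1,2)]
  by (intro Bochner_Integration.integral_cong) auto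

lemma act_add_const:
  fixes f :: "'a \<Rightarrow> real"
  assumes K: "K \<in> L \<rightarrow>\<^sub>M prob_algebra N" "x \<in> space L"
    and f: "f \<in> borel_measurable N" "\<And>y. y \<in> space N \<Longrightarrow> \<bar>f y\<bar> \<le> B"
  shows "act K (\<lambda>y. f y + c) x = act K f x + c"
  using act_diff[OF K f, of "\<lambda>_. - c" "\<bar>c\<bar>"] act_const[OF K, of "- c"] by simp

lemma nn_integral_eq_act:
  fixes f :: "'a \<Rightarrow> real"
  assumes K: "K \<in> L \<rightarrow>\<^sub>M prob_algebra N" "x \<in> space L"
    and f: "f \<in> borel_measurable N" "\<And>y. y \<in> space N \<Longrightarrow> 0 \<le> f y" "\<And>y. y \<in> space N \<Longrightarrow> f y \<le> B"
  shows "(\<integral>\<^sup>+y. ennreal (f y) \<partial>K x) = ennreal (act K f x)" "0 \<le> act K f x"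
proof -
  have "integrable (K x) f"
    by (rule kernel_integrable_bounded[OF K f(1), of B]) (use f in force)
  then show "(\<integral>\<^sup>+y. ennreal (f y) \<partial>K x) = ennreal (act K f x)"
    unfolding act_def using f(2) prob_algebra_kernelD(3)[OF K] by (intro nn_integral_eq_integral) auto
  show "0 \<le> act K f x"
    unfolding act_def using f(2) prob_algebra_kernelD(3)[OF K] by (intro integral_nonneg_AE AE_I2) auto
qed

text \<open>Here the integrand varies with the parameter too. Pushing \<open>K x\<close> forward to
  pairs \<open>(x, y)\<close> fixes the integrand and moves the dependence into the measure, which
  is measurable in \<open>x\<close>.\<close>

lemma kernel_lebesgue_integral_measurable:
  fixes f :: "'b \<Rightarrow> 'a \<Rightarrow> real"
  assumes K: "K \<in> L \<rightarrow>\<^sub>M prob_algebra N"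
    and f: "(\<lambda>(x, y). f x y) \<in> borel_measurable (L \<Otimes>\<^sub>M N)"
  shows "(\<lambda>x. \<integral>y. f x y \<partial>K x) \<in> borel_measurable L"
proof -
  note measurable_distr2 [measurable]
  note [measurable] = f measurable_prob_algebraD[OF K]
  have "(\<lambda>x. integral\<^sup>L (distr (K x) (L \<Otimes>\<^sub>M N) (\<lambda>y. (x, y))) (\<lambda>(x, y). f x y)) \<in> borel_measurable L"
    by measurable
  then show ?thesis
  proof (rule measurable_cong[THEN iffD1, rotated])
    fix x assume x: "x \<in> space L"
    have "(\<lambda>y. (x, y)) \<in> N \<rightarrow>\<^sub>M L \<Otimes>\<^sub>M N" using x by measurable
    from kernel_measurable_function[OF K x this] show "integral\<^sup>L (distr (K x) (L \<Otimes>\<^sub>M N) (\<lambda>y. (x, y))) (\<lambda>(x, y). f x y) = (\<integral>y. f x y \<partial>K x)"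
      by (subst integral_distr) (auto simp: f)
  qed
qed

lemma nn_integral_kernel_le:
  assumes K: "K \<in> L \<rightarrow>\<^sub>M prob_algebra N" "x \<in> space L" and f: "\<And>y. y \<in> space N \<Longrightarrow> f y \<le> B"
  shows "(\<integral>\<^sup>+y. f y \<partial>K x) \<le> B"
proof -
  interpret prob_space "K x" by (rule prob_algebra_kernelD[OF K])
  have "(\<integral>\<^sup>+y. f y \<partial>K x) \<le> (\<integral>\<^sup>+y. B \<partial>K x)"
    using f prob_algebra_kernelD(3)[OF K] by (intro nn_integral_mono) auto
  then show ?thesis by (simp add: emeasure_space_1)
qed

section \<open>The transition kernel and uniqueness for renewal equations\<close>

context pdmp_construction
begin

definition trans :: "real \<Rightarrow> 'a \<Rightarrow> 'a measure" where
  "trans t x = distr noise N (state t x)"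

lemma trans_measurable [measurable (raw)]:
  assumes [measurable]: "f \<in> borel_measurable K" "g \<in> K \<rightarrow>\<^sub>M N"
  shows "(\<lambda>z. trans (f z) (g z)) \<in> K \<rightarrow>\<^sub>M prob_algebra N"
proof (rule measurable_prob_algebraI)
  fix z assume "z \<in> space K"
  then have [measurable]: "g z \<in> space N" using measurable_space[OF assms(2)] by blast
  show "prob_space (trans (f z) (g z))"
    unfolding trans_def by (rule noise.prob_space_distr) measurable
next
  show "(\<lambda>z. trans (f z) (g z)) \<in> K \<rightarrow>\<^sub>M subprob_algebra N"
    unfolding trans_def
  proof (rule measurable_distr2)
    show "(\<lambda>(z, \<omega>). state (f z) (g z) \<omega>) \<in> K \<Otimes>\<^sub>M noise \<rightarrow>\<^sub>M N" by measurable
    show "(\<lambda>z. noise) \<in> K \<rightarrow>\<^sub>M subprob_algebra noise"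
      using noise.M_in_subprob by measurable
  qed
qed

lemma trans_kernel: "trans t \<in> N \<rightarrow>\<^sub>M prob_algebra N"
  by measurable

lemma trans_integral_measurable [measurable (raw)]:
  assumes u: "(\<lambda>(z, y). u z y) \<in> borel_measurable (K \<Otimes>\<^sub>M N)"
    and [measurable]: "f \<in> borel_measurable K" "g \<in> K \<rightarrow>\<^sub>M N"
  shows "(\<lambda>z. \<integral>\<^sup>+y. u z y \<partial>trans (f z) (g z)) \<in> borel_measurable K"
  by (rule nn_integral_measurable_subprob_algebra2[OF u]) (rule measurable_prob_algebraD, measurable)

lemma AE_jump_index:
  assumes "x \<in> space N" "0 \<le> t"
  shows "AE \<omega> in noise. \<exists>k. ereal t < fst (skel x \<omega> (Suc k))"
  using non_explosive[OF assms(1)]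
proof (rule eventually_mono)
  fix \<omega> assume "\<forall>t\<ge>0. pdmp \<phi> r G t (x, \<omega>) \<noteq> None"
  with assms(2) have "pdmp \<phi> r G t (x, \<omega>) \<noteq> None" by blast
  then show "\<exists>k. ereal t < fst (skel x \<omega> (Suc k))" by (rule pdmp_eq_state(1)[OF assms(2)])
qed

lemma nn_integral_trans:
  assumes x: "x \<in> space N" and t: "0 \<le> t" and [measurable]: "f \<in> borel_measurable N"
  shows "(\<integral>\<^sup>+y. f y \<partial>trans t x) = (\<Sum>k. jump_term f k t x)"
proof -
  have [measurable]: "state t x \<in> noise \<rightarrow>\<^sub>M N" "\<And>k. contrib f k t x \<in> borel_measurable noise"
    using x by measurable
  have "(\<integral>\<^sup>+y. f y \<partial>trans t x) = (\<integral>\<^sup>+\<omega>. f (state t x \<omega>) \<partial>noise)"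
    unfolding trans_def by (subst nn_integral_distr) auto
  also have "\<dots> = (\<integral>\<^sup>+\<omega>. (\<Sum>k. contrib f k t x \<omega>) \<partial>noise)"
    using AE_jump_index[OF x t] by (intro nn_integral_cong_AE) (auto simp: suminf_contrib[OF t])
  also have "\<dots> = (\<Sum>k. jump_term f k t x)"
    unfolding jump_term_def by (rule nn_integral_suminf) measurable
  finally show ?thesis .
qed

lemma renewal_suminf:
  assumes x: "x \<in> space N" and [measurable]: "\<And>k. (\<lambda>(t, x). u k t x) \<in> borel_measurable (borel \<Otimes>\<^sub>M N)"
  shows "renewal (\<lambda>t x. \<Sum>k. u k t x) t x = (\<Sum>k. renewal (u k) t x)"
proof -
  have "(\<integral>\<^sup>+y. (\<Sum>k. u k (t - s) y) \<partial>Q (\<phi> (max 0 s) x)) = (\<Sum>k. \<integral>\<^sup>+y. u k (t - s) y \<partial>Q (\<phi> (max 0 s) x))" for s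
  proof (rule nn_integral_suminf)
    fix k
    have "(\<lambda>y. u k (t - s) y) \<in> borel_measurable N" by measurable
    then show "(\<lambda>y. u k (t - s) y) \<in> borel_measurable (Q (\<phi> (max 0 s) x))"
      by (rule kernel_measurable_function[OF kernel_measurable flow_in_space[OF _ x], rotated]) simp
  qed
  then have "renewal (\<lambda>t x. \<Sum>k. u k t x) t x = (\<integral>\<^sup>+s. (\<Sum>k. indicator {0..t} s * ennreal (jump_density (max 0 s) x) *
     (\<integral>\<^sup>+y. u k (t - s) y \<partial>Q (\<phi> (max 0 s) x))) \<partial>lborel)"
    unfolding renewal_def by simp
  also have "\<dots> = (\<Sum>k. renewal (u k) t x)"
    unfolding renewal_def by (rule nn_integral_suminf) (use x in measurable)
  finally show ?thesis .
qed

lemma renewal_mono: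
  assumes "x \<in> space N" "\<And>s y. \<lbrakk>0 \<le> s; s \<le> t; y \<in> space N\<rbrakk> \<Longrightarrow> u s y \<le> v s y"
  shows "renewal u t x \<le> renewal v t x"
  unfolding renewal_def
proof (intro nn_integral_mono)
  fix s :: real
  show "indicator {0..t} s * ennreal (jump_density (max 0 s) x) * (\<integral>\<^sup>+y. u (t - s) y \<partial>Q (\<phi> (max 0 s) x)) \<le>
    indicator {0..t} s * ennreal (jump_density (max 0 s) x) * (\<integral>\<^sup>+y. v (t - s) y \<partial>Q (\<phi> (max 0 s) x))"
    using assms(2) prob_algebra_kernelD(3)[OF kernel_measurable flow_in_space[OF _ assms(1)]]
    by (cases "s \<in> {0..t}") (auto intro!: mult_left_mono nn_integral_mono)
qed

lemma renewal_cong: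
  assumes "x \<in> space N" "\<And>s y. \<lbrakk>0 \<le> s; s \<le> t; y \<in> space N\<rbrakk> \<Longrightarrow> u s y = v s y"
  shows "renewal u t x = renewal v t x"
  using assms by (intro antisym renewal_mono) auto

lemma kernel_nn_integral_cmult:
  assumes "y \<in> space N" "f \<in> borel_measurable N"
  shows "(\<integral>\<^sup>+z. c * f z \<partial>Q y) = c * (\<integral>\<^sup>+z. f z \<partial>Q y)"
  by (rule nn_integral_cmult[OF kernel_measurable_function[OF kernel_measurable assms]])

lemma renewal_cmult:
  assumes x: "x \<in> space N" and [measurable]: "(\<lambda>(t, x). u t x) \<in> borel_measurable (borel \<Otimes>\<^sub>M N)"
  shows "renewal (\<lambda>t x. c * u t x) t x = c * renewal u t x"
proof -
  have "(\<integral>\<^sup>+y. c * u (t - s) y \<partial>Q (\<phi> (max 0 s) x)) = c * (\<integral>\<^sup>+y. u (t - s) y \<partial>Q (\<phi> (max 0 s) x))" for s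
    by (rule kernel_nn_integral_cmult) (use x in \<open>auto intro: flow_in_space\<close>)
  then have "renewal (\<lambda>t x. c * u t x) t x = (\<integral>\<^sup>+s. c * (indicator {0..t} s * ennreal (jump_density (max 0 s) x) *
     (\<integral>\<^sup>+y. u (t - s) y \<partial>Q (\<phi> (max 0 s) x))) \<partial>lborel)"
    unfolding renewal_def by (simp add: ac_simps)
  also have "\<dots> = c * renewal u t x"
    unfolding renewal_def by (rule nn_integral_cmult) (use x in measurable)
  finally show ?thesis .
qed

text \<open>Summation over the number of jumps: the term without jump is the survival probability
  times the value transported by the flow, and the remaining terms add up to \<open>renewal\<close>
  of the whole series.\<close>

lemma renewal_trans:
  assumes x: "x \<in> space N" and t: "0 \<le> t" and [measurable]: "f \<in> borel_measurable N"
  shows "(\<integral>\<^sup>+y. f y \<partial>trans t x) =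
    ennreal (exp (- cumrate t x)) * f (\<phi> t x) + renewal (\<lambda>t x. \<integral>\<^sup>+y. f y \<partial>trans t x) t x"
proof -
  have "(\<integral>\<^sup>+y. f y \<partial>trans t x) = jump_term f 0 t x + (\<Sum>k. jump_term f (Suc k) t x)"
    unfolding nn_integral_trans[OF x t assms(3)]
    by (subst suminf_offset[of _ 1]) (simp_all add: add.commute)
  also have "(\<Sum>k. jump_term f (Suc k) t x) = renewal (\<lambda>t x. \<Sum>k. jump_term f k t x) t x"
    unfolding jump_term_Suc[OF x assms(3)] by (rule renewal_suminf[OF x, symmetric]) measurable
  also have "\<dots> = renewal (\<lambda>t x. \<integral>\<^sup>+y. f y \<partial>trans t x) t x"
    by (intro renewal_cong x) (simp add: nn_integral_trans)
  also have "jump_term f 0 t x = ennreal (exp (- cumrate t x)) * f (\<phi> t x)"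
    using t by (simp add: jump_term_0[OF x])
  finally show ?thesis .
qed

text \<open>For \<open>0 \<le> t\<close>, the probability of at least \<open>n\<close> jumps up to
  time \<open>t\<close>; equivalently, \<open>n\<close> applications of \<open>renewal\<close> to
  the constant one.\<close>

definition tail :: "nat \<Rightarrow> real \<Rightarrow> 'a \<Rightarrow> ennreal" where
  "tail n t x = (\<Sum>k. jump_term (\<lambda>_. 1) (k + n) t x)"

lemma tail_0:
  assumes "x \<in> space N" "0 \<le> t"
  shows "tail 0 t x = 1"
proof -
  interpret prob_space "trans t x" by (rule prob_algebra_kernelD[OF trans_kernel assms(1)])
  show ?thesis
    using nn_integral_trans[OF assms, of "\<lambda>_. 1"] by (simp add: tail_def emeasure_space_1)
qed

lemma tail_Suc: "x \<in> space N \<Longrightarrow> tail (Suc n) t x = renewal (tail n) t x"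
  unfolding tail_def by (subst renewal_suminf) (auto simp: jump_term_Suc)

text \<open>Non-explosion is what \<open>tail_0\<close> expresses: the probabilities of exactly
  \<open>k\<close> jumps sum to one, so the remainders of the series tend to zero.\<close>

lemma tail_tendsto:
  assumes "x \<in> space N" "0 \<le> t"
  shows "(\<lambda>n. tail n t x) \<longlonglongrightarrow> 0"
proof -
  let ?a = "\<lambda>n. \<Sum>k<n. jump_term (\<lambda>_. 1) k t x"
  have "tail 0 t x = tail n t x + ?a n" for n
    unfolding tail_def by (subst suminf_offset[of _ n]) simp_all
  then have split: "tail n t x + ?a n = 1" for n
    using tail_0[OF assms] by metis
  \<comment> \<open>Finiteness is what permits cancelling the partial sum in
    \<open>ennreal\<close>.\<close>
  have fin: "?a n \<noteq> \<top>" for n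
  proof -
    have "?a n \<le> tail n t x + ?a n" by simp
    also have "\<dots> = 1" by (rule split)
    finally show ?thesis using neq_top_trans[OF ennreal_one_neq_top] by blast
  qed
  have "tail n t x = 1 - ?a n" for n
    using ennreal_add_diff_cancel_right[OF fin[of n], of "tail n t x"] unfolding split by simp
  moreover have "?a \<longlonglongrightarrow> 1"
    using summable_LIMSEQ[of "\<lambda>k. jump_term (\<lambda>_. 1) k t x"] tail_0[OF assms] by (simp add: tail_def)
  then have "(\<lambda>n. 1 - ?a n) \<longlonglongrightarrow> 1 - 1" by (intro tendsto_diff_ennreal) auto
  ultimately show ?thesis by simp
qed

text \<open>The rate is not bounded over all points, so \<open>renewal\<close> need not be a
  contraction even for short times. Iterating the inequality instead bounds \<open>u\<close> by
  \<open>B * tail n t x\<close>, and non-explosion sends this to zero.\<close>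

lemma renewal_unique:
  assumes meas [measurable]: "(\<lambda>(t, x). u t x) \<in> borel_measurable (borel \<Otimes>\<^sub>M N)"
    and bdd: "\<And>t x. \<lbrakk>0 \<le> t; t \<le> T; x \<in> space N\<rbrakk> \<Longrightarrow> u t x \<le> B" and B: "B < \<top>"
    and le: "\<And>t x. \<lbrakk>0 \<le> t; t \<le> T; x \<in> space N\<rbrakk> \<Longrightarrow> u t x \<le> renewal u t x"
    and t: "0 \<le> t" "t \<le> T" and x: "x \<in> space N"
  shows "u t x = 0"
proof -
  have [measurable]: "(\<lambda>(t, x). tail n t x) \<in> borel_measurable (borel \<Otimes>\<^sub>M N)" for n
    unfolding tail_def by measurable
  have "u t x \<le> B * tail n t x" if "0 \<le> t" "t \<le> T" "x \<in> space N" for n t x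
    using that
  proof (induction n arbitrary: t x)
    case 0
    then show ?case using bdd tail_0 by simp
  next
    case (Suc n)
    have "u t x \<le> renewal u t x" using le Suc by simp
    also have "\<dots> \<le> renewal (\<lambda>t x. B * tail n t x) t x"
      using Suc by (intro renewal_mono) auto
    also have "\<dots> = B * tail (Suc n) t x"
      using Suc by (simp add: renewal_cmult tail_Suc)
    finally show ?case .
  qed
  moreover have "(\<lambda>n. B * tail n t x) \<longlonglongrightarrow> B * 0"
    using tail_tendsto[OF x t(1)] B by (intro ennreal_tendsto_cmult) auto
  ultimately have "u t x \<le> B * 0"
    using t x by (intro LIMSEQ_le_const) auto
  then show ?thesis by simp
qed

end

section \<open>The semigroup property and occupation times\<close>

context pdmp_construction
begin

lemma exp_cumrate_add:
  assumes "0 \<le> t" "0 \<le> s" "x \<in> space N"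
  shows "exp (- cumrate (t + s) x) = exp (- cumrate t x) * exp (- cumrate s (\<phi> t x))"
  using exp_add[of "- cumrate t x" "- cumrate s (\<phi> t x)"] cumrate_add[OF assms] by simp

lemma jump_density_add:
  assumes "0 \<le> t" "0 \<le> s" "x \<in> space N"
  shows "jump_density (t + s) x = exp (- cumrate t x) * jump_density s (\<phi> t x)"
  using assms by (simp add: jump_density_def flow_add exp_cumrate_add)

lemma kernel_nn_integral_add:
  assumes "y \<in> space N" "f \<in> borel_measurable N" "g \<in> borel_measurable N"
  shows "(\<integral>\<^sup>+z. f z + g z \<partial>Q y) = (\<integral>\<^sup>+z. f z \<partial>Q y) + (\<integral>\<^sup>+z. g z \<partial>Q y)"
  using kernel_measurable_function[OF kernel_measurable assms(1)] assms(2,3)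
  by (intro nn_integral_add) auto

lemma renewal_add:
  assumes x: "x \<in> space N" and [measurable]: "(\<lambda>(t, x). u t x) \<in> borel_measurable (borel \<Otimes>\<^sub>M N)"
    "(\<lambda>(t, x). v t x) \<in> borel_measurable (borel \<Otimes>\<^sub>M N)"
  shows "renewal (\<lambda>t x. u t x + v t x) t x = renewal u t x + renewal v t x"
proof -
  have "(\<integral>\<^sup>+y. u (t - s) y + v (t - s) y \<partial>Q (\<phi> (max 0 s) x)) =
      (\<integral>\<^sup>+y. u (t - s) y \<partial>Q (\<phi> (max 0 s) x)) + (\<integral>\<^sup>+y. v (t - s) y \<partial>Q (\<phi> (max 0 s) x))" for s
    by (rule kernel_nn_integral_add) (use x in \<open>auto intro: flow_in_space\<close>)
  then have "renewal (\<lambda>t x. u t x + v t x) t x =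
     (\<integral>\<^sup>+s. indicator {0..t} s * ennreal (jump_density (max 0 s) x) * (\<integral>\<^sup>+y. u (t - s) y \<partial>Q (\<phi> (max 0 s) x)) +
       indicator {0..t} s * ennreal (jump_density (max 0 s) x) * (\<integral>\<^sup>+y. v (t - s) y \<partial>Q (\<phi> (max 0 s) x)) \<partial>lborel)"
    unfolding renewal_def by (simp add: distrib_left)
  also have "\<dots> = renewal u t x + renewal v t x"
    unfolding renewal_def by (rule nn_integral_add) (use x in measurable)
  finally show ?thesis .
qed

text \<open>Two bounded solutions with a common inhomogeneity \<open>c\<close> are compared.
  Subtraction in \<open>ennreal\<close> is truncated at zero, so each order is treated separately:
  the truncated difference satisfies the inequality of \<open>renewal_unique\<close>.\<close>

lemma renewal_solution_le:
  assumes [measurable]: "(\<lambda>(t, x). a t x) \<in> borel_measurable (borel \<Otimes>\<^sub>M N)"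
      "(\<lambda>(t, x). b t x) \<in> borel_measurable (borel \<Otimes>\<^sub>M N)"
    and B: "B < \<top>" "\<And>t x. \<lbrakk>0 \<le> t; t \<le> T; x \<in> space N\<rbrakk> \<Longrightarrow> a t x \<le> B"
      "\<And>t x. \<lbrakk>0 \<le> t; t \<le> T; x \<in> space N\<rbrakk> \<Longrightarrow> b t x \<le> B"
    and a: "\<And>t x. \<lbrakk>0 \<le> t; t \<le> T; x \<in> space N\<rbrakk> \<Longrightarrow> a t x = c t x + renewal a t x"
    and b: "\<And>t x. \<lbrakk>0 \<le> t; t \<le> T; x \<in> space N\<rbrakk> \<Longrightarrow> b t x = c t x + renewal b t x"
    and t: "0 \<le> t" "t \<le> T" and x: "x \<in> space N"
  shows "a t x \<le> b t x"
proof -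
  have "a t x - b t x = 0"
  proof (rule renewal_unique[OF _ _ B(1) _ t x])
    show "(\<lambda>(t, x). a t x - b t x) \<in> borel_measurable (borel \<Otimes>\<^sub>M N)" by measurable
  next
    fix t x assume "0 \<le> t" "t \<le> T" "x \<in> space N"
    then show "a t x - b t x \<le> B"
      using B(2) diff_le_self_ennreal order_trans by blast
  next
    fix t x assume tx: "0 \<le> t" "t \<le> T" "x \<in> space N"
    have "b t x < \<top>" using B(3)[OF tx] B(1) by (rule le_less_trans)
    have le: "p \<le> q + (p - q)" for p q :: ennreal
      by (cases "q \<le> p") (auto simp: add_diff_inverse_ennreal intro: add_increasing2)
    have "renewal a t x \<le> renewal (\<lambda>t x. b t x + (a t x - b t x)) t x"
      using tx le by (intro renewal_mono) auto
    also have "\<dots> = renewal b t x + renewal (\<lambda>t x. a t x - b t x) t x"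
      using tx by (intro renewal_add) measurable
    finally have "a t x - b t x \<le> b t x + renewal (\<lambda>t x. a t x - b t x) t x - b t x"
      by (intro ennreal_minus_mono) (auto simp: a[OF tx] b[OF tx] add.assoc add_left_mono)
    also have "\<dots> = renewal (\<lambda>t x. a t x - b t x) t x"
      using \<open>b t x < \<top>\<close> by simp
    finally show "a t x - b t x \<le> renewal (\<lambda>t x. a t x - b t x) t x" .
  qed
  then show ?thesis by (simp add: diff_eq_0_iff_ennreal)
qed

text \<open>The semigroup law without any conditioning on the past: as functions of
  \<open>t\<close>, both sides solve the renewal equation whose inhomogeneity \<open>c\<close> is
  survival up to \<open>t\<close>, then the flow, then the process for time \<open>s\<close>.
  Uniqueness identifies them.\<close>

lemma nn_integral_trans_add:
  assumes x: "x \<in> space N" and ts: "0 \<le> t" "0 \<le> s"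
    and f [measurable]: "f \<in> borel_measurable N" and B: "B < \<top>" "\<And>y. y \<in> space N \<Longrightarrow> f y \<le> B"
  shows "(\<integral>\<^sup>+z. f z \<partial>trans (t + s) x) = (\<integral>\<^sup>+y. \<integral>\<^sup>+z. f z \<partial>trans s y \<partial>trans t x)"
proof -
  define F where "F t x = (\<integral>\<^sup>+z. f z \<partial>trans t x)" for t x
  define c where "c t x = ennreal (exp (- cumrate t x)) * F s (\<phi> t x)" for t x
  define a where "a t x = F (t + s) x" for t x
  define b where "b t x = (\<integral>\<^sup>+y. F s y \<partial>trans t x)" for t x
  have F_meas [measurable]: "(\<lambda>(t, x). F t x) \<in> borel_measurable (borel \<Otimes>\<^sub>M N)"
    unfolding F_def by measurable
  have F_meas' [measurable]: "F s \<in> borel_measurable N" for s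
    by measurable
  have a_meas [measurable]: "(\<lambda>(t, x). a t x) \<in> borel_measurable (borel \<Otimes>\<^sub>M N)"
    unfolding a_def by measurable
  have b_meas [measurable]: "(\<lambda>(t, x). b t x) \<in> borel_measurable (borel \<Otimes>\<^sub>M N)"
    unfolding b_def by measurable
  have F_le: "F t x \<le> B" if "x \<in> space N" for t x
    unfolding F_def using B(2) that by (intro nn_integral_kernel_le[OF trans_kernel]) auto
  have b_eq: "b t x = c t x + renewal b t x" if "0 \<le> t" "x \<in> space N" for t x
    using renewal_trans[OF that(2,1) F_meas'] unfolding b_def c_def .
  \<comment> \<open>The first jump of the process run for \<open>t + s\<close> falls before or after
    \<open>t\<close>. The early part is \<open>renewal a t x\<close>; in the late part the survival
    function factors at \<open>t\<close>, which leaves the renewal term for time \<open>s\<close>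
    started at \<open>\<phi> t x\<close>. Together with the no-jump term, the late part makes up
    \<open>c\<close>.\<close>
  have a_eq: "a t x = c t x + renewal a t x" if tx: "0 \<le> t" "x \<in> space N" for t x
  proof -
    let ?h = "\<lambda>r. ennreal (jump_density (max 0 r) x) * (\<integral>\<^sup>+y. F (t + s - r) y \<partial>Q (\<phi> (max 0 r) x))"
    have [measurable]: "?h \<in> borel_measurable borel" using tx by measurable
    have y: "\<phi> t x \<in> space N" using tx by (rule flow_in_space)
    have "renewal F (t + s) x = (\<integral>\<^sup>+r. indicator {0..t} r * ?h r + indicator {t<..t + s} r * ?h r \<partial>lborel)"
      unfolding renewal_def using ts tx by (intro nn_integral_cong) (auto simp: indicator_def)
    also have "\<dots> = (\<integral>\<^sup>+r. indicator {0..t} r * ?h r \<partial>lborel) + (\<integral>\<^sup>+r. indicator {t<..t + s} r * ?h r \<partial>lborel)"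
      by (rule nn_integral_add) measurable
    also have "(\<integral>\<^sup>+r. indicator {0..t} r * ?h r \<partial>lborel) = renewal a t x"
      unfolding renewal_def a_def by (intro nn_integral_cong) (simp add: algebra_simps)
    also have "(\<integral>\<^sup>+r. indicator {t<..t + s} r * ?h r \<partial>lborel) = (\<integral>\<^sup>+r. indicator {t<..t + s} (t + r) * ?h (t + r) \<partial>lborel)"
      by (subst nn_integral_real_affine[where c=1 and t=t]) auto
    also have "\<dots> = (\<integral>\<^sup>+r. ennreal (exp (- cumrate t x)) * (indicator {0..s} r * ennreal (jump_density (max 0 r) (\<phi> t x)) *
        (\<integral>\<^sup>+y. F (s - r) y \<partial>Q (\<phi> (max 0 r) (\<phi> t x)))) \<partial>lborel)"
    \<comment> \<open>The shifted interval is open at its left end while \<open>renewal\<close>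
      integrates over a closed one; the single time \<open>0\<close> is discarded.\<close>
    proof (intro nn_integral_cong_AE eventually_mono[OF AE_lborel_singleton[of 0]])
      fix r :: real assume "r \<noteq> 0"
      then show "indicator {t<..t + s} (t + r) * ?h (t + r) =
        ennreal (exp (- cumrate t x)) * (indicator {0..s} r * ennreal (jump_density (max 0 r) (\<phi> t x)) *
        (\<integral>\<^sup>+y. F (s - r) y \<partial>Q (\<phi> (max 0 r) (\<phi> t x))))"
        using tx jump_density_add[of t r x] jump_density_nonneg[OF _ y, of r]
        by (cases "0 < r") (auto simp: indicator_def flow_add max_def ennreal_mult mult_ac)
    qed
    also have "\<dots> = ennreal (exp (- cumrate t x)) * renewal F s (\<phi> t x)"
      unfolding renewal_def by (rule nn_integral_cmult) (use y in measurable)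
    finally have "a t x = ennreal (exp (- cumrate (t + s) x)) * f (\<phi> (t + s) x) +
        (renewal a t x + ennreal (exp (- cumrate t x)) * renewal F s (\<phi> t x))"
      using renewal_trans[OF tx(2) _ f, of "t + s", folded F_def] tx ts unfolding a_def by simp
    also have "ennreal (exp (- cumrate (t + s) x)) * f (\<phi> (t + s) x) =
        ennreal (exp (- cumrate t x)) * (ennreal (exp (- cumrate s (\<phi> t x))) * f (\<phi> s (\<phi> t x)))"
      using tx ts by (simp add: exp_cumrate_add flow_add ennreal_mult mult.assoc)
    finally show ?thesis
      unfolding c_def renewal_trans[OF y ts(2) f, folded F_def] by (simp add: distrib_left ac_simps)
  qed
  have ab_le: "a t x \<le> B" "b t x \<le> B" if "x \<in> space N" for t x
    using F_le that by (auto simp: a_def b_def intro!: nn_integral_kernel_le[OF trans_kernel])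
  have "a t x \<le> b t x"
    by (rule renewal_solution_le[where a=a and b=b and c=c and T=t, OF a_meas b_meas B(1)])
      (assumption | rule a_eq b_eq ab_le ts x order_refl)+
  moreover have "b t x \<le> a t x"
    by (rule renewal_solution_le[where a=b and b=a and c=c and T=t, OF b_meas a_meas B(1)])
      (assumption | rule a_eq b_eq ab_le ts x order_refl)+
  ultimately show ?thesis by (simp add: a_def b_def F_def)
qed

text \<open>Until its first jump the process follows an orbit, and orbits spend no time in
  \<open>A\<close>. The expected time \<open>W\<close> spent in \<open>A\<close> therefore comes
  entirely from after the first jump, that is \<open>W = renewal W\<close>, and uniqueness leaves
  only zero.\<close>

lemma occupation_null:
  assumes A [measurable]: "A \<in> sets N"
    and null: "\<And>x. x \<in> space N \<Longrightarrow> AE s in lborel. 0 \<le> s \<longrightarrow> \<phi> s x \<notin> A"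
    and x: "x \<in> space N" and T: "0 \<le> T"
  shows "(\<integral>\<^sup>+s. indicator {0..T} s * emeasure (trans s x) A \<partial>lborel) = 0"
proof -
  define E where "E s x = (\<integral>\<^sup>+y. indicator A y \<partial>trans s x)" for s x
  define W where "W t x = (\<integral>\<^sup>+s. indicator {0..t} s * E s x \<partial>lborel)" for t x
  have E_meas [measurable]: "(\<lambda>(t, x). E t x) \<in> borel_measurable (borel \<Otimes>\<^sub>M N)"
    unfolding E_def by measurable
  have W_meas [measurable]: "(\<lambda>(t, x). W t x) \<in> borel_measurable (borel \<Otimes>\<^sub>M N)"
  proof -
    have "(\<lambda>(t, x). \<integral>\<^sup>+s. (if 0 \<le> s \<and> s \<le> t then 1 else 0) * E s x \<partial>lborel) \<in> borel_measurable (borel \<Otimes>\<^sub>M N)"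
      by measurable
    also have "(\<lambda>(t, x). \<integral>\<^sup>+s. (if 0 \<le> s \<and> s \<le> t then 1 else 0) * E s x \<partial>lborel) = (\<lambda>(t, x). W t x)"
      unfolding W_def by (auto simp: fun_eq_iff indicator_def intro!: nn_integral_cong)
    finally show ?thesis .
  qed
  have E_le: "E s x \<le> 1" if "x \<in> space N" for s x
    unfolding E_def by (rule nn_integral_kernel_le[OF trans_kernel that]) (simp add: indicator_def)
  have W_le: "W t x \<le> ennreal T" if "0 \<le> t" "t \<le> T" "x \<in> space N" for t x
  proof -
    have "W t x \<le> (\<integral>\<^sup>+s. indicator {0..t} s \<partial>lborel)"
      unfolding W_def using E_le[OF that(3)] by (intro nn_integral_mono) (auto simp: indicator_def)
    then show ?thesis using that by (simp add: ennreal_leI order_trans)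
  qed
  have W_renewal: "W t x = renewal W t x" if tx: "0 \<le> t" "x \<in> space N" for t x
  proof -
    define H where "H s r = ennreal (jump_density (max 0 r) x) * (\<integral>\<^sup>+y. E (s - r) y \<partial>Q (\<phi> (max 0 r) x))" for s r
    have H [measurable]: "(\<lambda>(s, r). H s r) \<in> borel_measurable (borel \<Otimes>\<^sub>M borel)"
      unfolding H_def using tx by measurable
    have renewal_H: "renewal E s x = (\<integral>\<^sup>+r. indicator {0..s} r * H s r \<partial>lborel)" for s
      unfolding renewal_def H_def by (simp add: mult.assoc)
    \<comment> \<open>By \<open>null\<close>, the no-jump term in the first-jump decomposition of
      \<open>E s x\<close> vanishes at almost every time \<open>s\<close>.\<close>
    have "W t x = (\<integral>\<^sup>+s. indicator {0..t} s * renewal E s x \<partial>lborel)"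
      unfolding W_def
    proof (rule nn_integral_cong_AE, use null[OF tx(2)] in eventually_elim)
      fix s assume s: "0 \<le> s \<longrightarrow> \<phi> s x \<notin> A"
      show "indicator {0..t} s * E s x = indicator {0..t} s * renewal E s x"
      proof (cases "0 \<le> s")
        case True
        have "E s x = ennreal (exp (- cumrate s x)) * indicator A (\<phi> s x) + renewal E s x"
          unfolding E_def by (rule renewal_trans[OF tx(2) True]) measurable
        with s True show ?thesis by simp
      qed simp
    qed
    also have "\<dots> = (\<integral>\<^sup>+s. \<integral>\<^sup>+r. (if 0 \<le> r \<and> r \<le> s \<and> s \<le> t then 1 else 0) * H s r \<partial>lborel \<partial>lborel)"
    proof (intro nn_integral_cong)
      fix s :: real
      have "indicator {0..t} s * renewal E s x = (\<integral>\<^sup>+r. indicator {0..t} s * (indicator {0..s} r * H s r) \<partial>lborel)"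
        unfolding renewal_H by (rule nn_integral_cmult[symmetric]) measurable
      also have "\<dots> = (\<integral>\<^sup>+r. (if 0 \<le> r \<and> r \<le> s \<and> s \<le> t then 1 else 0) * H s r \<partial>lborel)"
        by (intro nn_integral_cong) (auto simp: indicator_def)
      finally show "indicator {0..t} s * renewal E s x =
          (\<integral>\<^sup>+r. (if 0 \<le> r \<and> r \<le> s \<and> s \<le> t then 1 else 0) * H s r \<partial>lborel)" .
    qed
    also have "\<dots> = (\<integral>\<^sup>+r. \<integral>\<^sup>+s. (if 0 \<le> r \<and> r \<le> s \<and> s \<le> t then 1 else 0) * H s r \<partial>lborel \<partial>lborel)"
      by (rule lborel_pair.Fubini') measurable
    also have "\<dots> = renewal W t x"
      unfolding renewal_def
    proof (rule nn_integral_cong)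
      fix r :: real
      let ?Q = "Q (\<phi> (max 0 r) x)"
      have y: "\<phi> (max 0 r) x \<in> space N" using tx by (intro flow_in_space) auto
      interpret Q: prob_space ?Q by (rule prob_space_kernel[OF y])
      interpret QL: pair_sigma_finite ?Q "lborel :: real measure" ..
      define K where "K s = (\<integral>\<^sup>+y. E s y \<partial>?Q)" for s
      have K [measurable]: "K \<in> borel_measurable borel"
        unfolding K_def by (rule kernel_integral_measurable[OF E_meas]) (use y in simp)
      have "(\<integral>\<^sup>+s. (if 0 \<le> r \<and> r \<le> s \<and> s \<le> t then 1 else 0) * H s r \<partial>lborel) =
        (\<integral>\<^sup>+s. (if 0 \<le> r \<and> r \<le> s \<and> s \<le> t then 1 else 0) * (ennreal (jump_density (max 0 r) x) * K (s - r)) \<partial>lborel)"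
        by (simp add: H_def K_def)
      also have "\<dots> = (\<integral>\<^sup>+s. (if 0 \<le> r \<and> r \<le> r + s \<and> r + s \<le> t then 1 else 0) *
          (ennreal (jump_density (max 0 r) x) * K (r + s - r)) \<partial>lborel)"
        by (subst nn_integral_real_affine[where c=1 and t=r]) auto
      also have "\<dots> = (\<integral>\<^sup>+s. (indicator {0..t} r * ennreal (jump_density (max 0 r) x)) *
          (indicator {0..t - r} s * K s) \<partial>lborel)"
        by (intro nn_integral_cong) (auto simp: indicator_def)
      also have "\<dots> = (indicator {0..t} r * ennreal (jump_density (max 0 r) x)) *
          (\<integral>\<^sup>+s. indicator {0..t - r} s * K s \<partial>lborel)"
        by (rule nn_integral_cmult) measurable
      also have "(\<integral>\<^sup>+s. indicator {0..t - r} s * K s \<partial>lborel) = (\<integral>\<^sup>+s. \<integral>\<^sup>+y. indicator {0..t - r} s * E s y \<partial>?Q \<partial>lborel)"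
        unfolding K_def by (intro nn_integral_cong) (auto simp: indicator_def)
      also have "\<dots> = (\<integral>\<^sup>+y. W (t - r) y \<partial>?Q)"
        unfolding W_def
      proof (rule QL.Fubini')
        have "(\<lambda>(y, s). indicator {0..t - r} s * E s y) \<in> borel_measurable (N \<Otimes>\<^sub>M borel)"
          by measurable
        also have "borel_measurable (N \<Otimes>\<^sub>M borel) = borel_measurable (?Q \<Otimes>\<^sub>M lborel)"
          by (intro measurable_cong_sets sets_pair_measure_cong) (simp_all add: sets_kernel_N[OF y])
        finally show "(\<lambda>(y, s). indicator {0..t - r} s * E s y) \<in> borel_measurable (?Q \<Otimes>\<^sub>M lborel)" .
      qed
      finally show "(\<integral>\<^sup>+s. (if 0 \<le> r \<and> r \<le> s \<and> s \<le> t then 1 else 0) * H s r \<partial>lborel) =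
        indicator {0..t} r * ennreal (jump_density (max 0 r) x) * (\<integral>\<^sup>+y. W (t - r) y \<partial>?Q)" .
    qed
    finally show ?thesis .
  qed
  have "W T x = 0"
    by (rule renewal_unique[OF W_meas W_le, where T=T]) (use W_renewal T x in auto)
  moreover have "emeasure (trans s x) A = E s x" for s
    using prob_algebra_kernelD(2)[OF trans_kernel x] unfolding E_def by simp
  ultimately show ?thesis by (simp add: W_def)
qed

end

section \<open>The expansion of the semigroup along the flow\<close>

lemma uniform_norm_ge: "x \<in> M \<Longrightarrow> ennreal \<bar>f x\<bar> \<le> uniform_norm M f"
  unfolding uniform_norm_def by (rule SUP_upper)

lemma uniform_norm_tendsto_0D:
  assumes "((\<lambda>t. uniform_norm M (F t)) \<longlongrightarrow> 0) A" "0 < e"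
  shows "\<forall>\<^sub>F t in A. \<forall>x\<in>M. \<bar>F t x\<bar> \<le> e"
proof -
  have "\<forall>\<^sub>F t in A. uniform_norm M (F t) < ennreal e"
    using assms by (intro order_tendstoD(2)) auto
  then show ?thesis
  proof eventually_elim
    case (elim t)
    show ?case
    proof
      fix x assume "x \<in> M"
      from uniform_norm_ge[OF this, of "F t"] elim have "ennreal \<bar>F t x\<bar> < ennreal e" by (rule le_less_trans)
      then show "\<bar>F t x\<bar> \<le> e" using assms(2) by (simp add: ennreal_less_iff)
    qed
  qed
qed

context pdmp_construction
begin

lemma act_trans_measurable [measurable (raw)]:
  assumes [measurable]: "f \<in> borel_measurable N" "h \<in> borel_measurable K" "g \<in> K \<rightarrow>\<^sub>M N"
  shows "(\<lambda>z. act (trans (h z)) f (g z)) \<in> borel_measurable K"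
  unfolding act_def by (rule kernel_lebesgue_integral_measurable[where N=N]) measurable

lemma act_kernel_measurable [measurable (raw)]:
  assumes u: "(\<lambda>(z, y). u z y) \<in> borel_measurable (K \<Otimes>\<^sub>M N)" and g [measurable]: "g \<in> K \<rightarrow>\<^sub>M N"
  shows "(\<lambda>z. act Q (u z) (g z)) \<in> borel_measurable K"
  unfolding act_def
  by (rule kernel_lebesgue_integral_measurable[OF measurable_compose[OF g kernel_measurable] u])

lemma act_trans_renewal_nonneg:
  assumes x: "x \<in> space N" and t: "0 \<le> t" and f [measurable]: "f \<in> borel_measurable N"
    and B: "\<And>y. y \<in> space N \<Longrightarrow> 0 \<le> f y" "\<And>y. y \<in> space N \<Longrightarrow> f y \<le> B"
  shows "act (trans t) f x = exp (- cumrate t x) * f (\<phi> t x) +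
    (LBINT s:{0..t}. jump_density s x * act Q (act (trans (t - s)) f) (\<phi> s x))"
proof -
  let ?j = "\<lambda>s. jump_density s x * act Q (act (trans (t - s)) f) (\<phi> s x)"
  have tr: "0 \<le> act (trans s) f y" "act (trans s) f y \<le> B" if "y \<in> space N" for s y
    using act_abs_le[OF trans_kernel that f, of B s] nn_integral_eq_act(2)[OF trans_kernel that f B] B that
    by fastforce+
  have tr_meas [measurable]: "act (trans s) f \<in> borel_measurable N" for s
    by measurable
  have Qtr: "0 \<le> act Q (act (trans s) f) y" "act Q (act (trans s) f) y \<le> B" if "y \<in> space N" for s y
    using act_abs_le[OF kernel_measurable that tr_meas, of s B] nn_integral_eq_act(2)[OF kernel_measurable that tr_meas tr]
      tr by fastforce+
  have B0: "0 \<le> B" using B(1)[OF x] B(2)[OF x] by simp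
  have j_int: "set_integrable lborel {0..t} ?j"
  proof -
    obtain L where L: "0 \<le> L" "\<And>s. s \<in> {0..t} \<Longrightarrow> r (\<phi> s x) \<le> L"
      using rate_bound[OF x] by metis
    show ?thesis
    proof (rule set_integrable_Icc_bounded[where B="L * B"])
      show "(\<lambda>s. ?j (max 0 s)) \<in> borel_measurable borel" using x by measurable
      fix s assume s: "s \<in> {0..t}"
      show "\<bar>?j s\<bar> \<le> L * B"
        unfolding abs_mult
        using jump_density_nonneg[of s x] jump_density_le[of s x] L(2)[OF s] L(1) s x
          Qtr[OF flow_in_space[of s x], of "t - s"]
        by (intro mult_mono) auto
    qed simp
  qed
  have "renewal (\<lambda>t x. \<integral>\<^sup>+y. ennreal (f y) \<partial>trans t x) t x = (\<integral>\<^sup>+s. ennreal (indicator {0..t} s * ?j s) \<partial>lborel)"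
    unfolding renewal_def
  proof (rule nn_integral_cong)
    fix s :: real
    show "indicator {0..t} s * ennreal (jump_density (max 0 s) x) *
        (\<integral>\<^sup>+y. (\<integral>\<^sup>+y. ennreal (f y) \<partial>trans (t - s) y) \<partial>Q (\<phi> (max 0 s) x)) = ennreal (indicator {0..t} s * ?j s)"
    proof (cases "s \<in> {0..t}")
      case True
      then have y: "\<phi> s x \<in> space N" using x by (intro flow_in_space) auto
      have "(\<integral>\<^sup>+y. (\<integral>\<^sup>+y. ennreal (f y) \<partial>trans (t - s) y) \<partial>Q (\<phi> s x)) =
          (\<integral>\<^sup>+y. ennreal (act (trans (t - s)) f y) \<partial>Q (\<phi> s x))"
        using prob_algebra_kernelD(3)[OF kernel_measurable y]
        by (intro nn_integral_cong) (simp add: nn_integral_eq_act(1)[OF trans_kernel _ f B])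
      also have "\<dots> = ennreal (act Q (act (trans (t - s)) f) (\<phi> s x))"
        by (rule nn_integral_eq_act(1)[OF kernel_measurable y tr_meas tr])
      finally show ?thesis
        using True jump_density_nonneg[of s x] x by (simp add: ennreal_mult' mult.commute)
    qed simp
  qed
  also have "\<dots> = ennreal (LBINT s:{0..t}. ?j s)"
    unfolding set_lebesgue_integral_def real_scaleR_def
  proof (rule nn_integral_eq_integral)
    show "integrable lborel (\<lambda>s. indicator {0..t} s * ?j s)"
      using j_int by (simp add: set_integrable_def)
    show "AE s in lborel. 0 \<le> indicator {0..t} s * ?j s"
      using x by (intro AE_I2) (auto simp: indicator_def intro!: mult_nonneg_nonneg jump_density_nonneg Qtr flow_in_space)
  qed
  finally have R: "renewal (\<lambda>t x. \<integral>\<^sup>+y. ennreal (f y) \<partial>trans t x) t x = ennreal (LBINT s:{0..t}. ?j s)" .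
  have j0: "0 \<le> (LBINT s:{0..t}. ?j s)"
    unfolding set_lebesgue_integral_def
    using x by (intro integral_nonneg_AE AE_I2) (auto simp: indicator_def intro!: mult_nonneg_nonneg jump_density_nonneg Qtr flow_in_space)
  have "ennreal (act (trans t) f x) = (\<integral>\<^sup>+y. ennreal (f y) \<partial>trans t x)"
    by (rule nn_integral_eq_act(1)[OF trans_kernel x f B, symmetric])
  also have "\<dots> = ennreal (exp (- cumrate t x)) * ennreal (f (\<phi> t x)) + ennreal (LBINT s:{0..t}. ?j s)"
    using renewal_trans[OF x t, of "\<lambda>y. ennreal (f y)"] R by simp
  also have "\<dots> = ennreal (exp (- cumrate t x) * f (\<phi> t x) + (LBINT s:{0..t}. ?j s))"
    using j0 B(1)[OF flow_in_space[OF t x]] by (simp add: ennreal_mult')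
  finally show ?thesis
    using tr(1)[OF x] j0 B(1)[OF flow_in_space[OF t x]] by (subst (asm) ennreal_inj) auto
qed

context
  fixes f :: "'a \<Rightarrow> real" and B :: real
  assumes f [measurable]: "f \<in> borel_measurable N" and fB: "\<And>y. y \<in> space N \<Longrightarrow> \<bar>f y\<bar> \<le> B"
begin

lemma act_trans_le: "x \<in> space N \<Longrightarrow> \<bar>act (trans t) f x\<bar> \<le> B"
  by (rule act_abs_le[OF trans_kernel _ f fB])

lemma act_trans_measurable_N [measurable]: "act (trans t) f \<in> borel_measurable N"
  by measurable

lemma act_kernel_trans_le: "x \<in> space N \<Longrightarrow> \<bar>act Q (act (trans t) f) x\<bar> \<le> B"
  by (rule act_abs_le[OF kernel_measurable _ act_trans_measurable_N act_trans_le])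

lemma set_integrable_renewal:
  assumes x: "x \<in> space N"
  shows "set_integrable lborel {0..b} (\<lambda>s. jump_density s x * act Q (act (trans (t - s)) f) (\<phi> s x))"
proof -
  obtain L where L: "0 \<le> L" "\<And>s. s \<in> {0..b} \<Longrightarrow> r (\<phi> s x) \<le> L"
    using rate_bound[OF x] by metis
  show ?thesis
  proof (rule set_integrable_Icc_bounded[where B="L * B"])
    show "(\<lambda>s. jump_density (max 0 s) x * act Q (act (trans (t - max 0 s)) f) (\<phi> (max 0 s) x)) \<in> borel_measurable borel"
      using x by measurable
    fix s assume s: "s \<in> {0..b}"
    show "\<bar>jump_density s x * act Q (act (trans (t - s)) f) (\<phi> s x)\<bar> \<le> L * B"
      unfolding abs_mult
      using jump_density_nonneg[of s x] jump_density_le[of s x] L(2)[OF s] L(1) s x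
        act_kernel_trans_le[OF flow_in_space[of s x], of "t - s"]
      by (intro mult_mono) auto
  qed simp
qed

lemma act_trans_renewal:
  assumes x: "x \<in> space N" and t: "0 \<le> t"
  shows "act (trans t) f x = exp (- cumrate t x) * f (\<phi> t x) +
    (LBINT s:{0..t}. jump_density s x * act Q (act (trans (t - s)) f) (\<phi> s x))"
proof -
  \<comment> \<open>Shifting by \<open>B\<close> makes the function nonnegative. The constant passes
    through the kernels unchanged, and its contributions \<open>exp (- cumrate t x) * B\<close> and
    \<open>(1 - exp (- cumrate t x)) * B\<close> add up to \<open>B\<close>, so it cancels.\<close>
  let ?g = "\<lambda>y. f y + B"
  have g: "?g \<in> borel_measurable N" "\<And>y. y \<in> space N \<Longrightarrow> 0 \<le> ?g y" "\<And>y. y \<in> space N \<Longrightarrow> ?g y \<le> 2 * B"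
    using fB by (auto simp: abs_le_iff) (smt (verit) fB)+
  have tr: "act (trans s) ?g y = act (trans s) f y + B" if "y \<in> space N" for s y
    by (rule act_add_const[OF trans_kernel that f fB])
  have Qtr: "act Q (act (trans s) ?g) y = act Q (act (trans s) f) y + B" if y: "y \<in> space N" for s y
  proof -
    have "act Q (act (trans s) ?g) y = act Q (\<lambda>y. act (trans s) f y + B) y"
      by (rule act_cong[OF kernel_measurable y tr])
    also have "\<dots> = act Q (act (trans s) f) y + B"
      by (rule act_add_const[OF kernel_measurable y act_trans_measurable_N act_trans_le])
    finally show ?thesis .
  qed
  have "(LBINT s:{0..t}. jump_density s x * act Q (act (trans (t - s)) ?g) (\<phi> s x)) =
      (LBINT s:{0..t}. jump_density s x * act Q (act (trans (t - s)) f) (\<phi> s x) + jump_density s x * B)"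
    using x by (intro set_lebesgue_integral_cong) (auto simp: Qtr flow_in_space distrib_left)
  also have "\<dots> = (LBINT s:{0..t}. jump_density s x * act Q (act (trans (t - s)) f) (\<phi> s x)) +
      (LBINT s:{0..t}. jump_density s x * B)"
    by (intro set_integral_add set_integrable_renewal set_integrable_mult_left set_integrable_jump_density x order_refl)
  also have "(LBINT s:{0..t}. jump_density s x * B) = (1 - exp (- cumrate t x)) * B"
    using integral_jump_density[OF x t] by simp
  finally show ?thesis
    using act_trans_renewal_nonneg[OF x t g] tr[OF x, of t] by (simp add: algebra_simps)
qed

lemma act_trans_0:
  assumes x: "x \<in> space N"
  shows "act (trans 0) f x = f x"
proof -
  have "\<bar>LBINT s:{0..0}. jump_density s x * act Q (act (trans (0 - s)) f) (\<phi> s x)\<bar> \<le>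
      \<bar>jump_density 0 x * act Q (act (trans (0 - 0)) f) (\<phi> 0 x)\<bar> * (0 - 0)"
    by (intro set_integral_Icc_abs_le set_integrable_renewal x) auto
  then show ?thesis using act_trans_renewal[OF x order_refl] by (simp add: flow_0 x)
qed

text \<open>Without a jump the process sits at \<open>\<phi> t x\<close>; a jump has probability
  \<open>1 - exp (- cumrate t x)\<close> and changes the value by at most
  \<open>2 * B\<close>.\<close>

lemma act_trans_flow_diff_le:
  assumes x: "x \<in> space N" and t: "0 \<le> t"
  shows "\<bar>act (trans t) f x - f (\<phi> t x)\<bar> \<le> 2 * B * (1 - exp (- cumrate t x))"
proof -
  let ?j = "\<lambda>s. jump_density s x * act Q (act (trans (t - s)) f) (\<phi> s x)"
  have e: "0 \<le> 1 - exp (- cumrate t x)" using cumrate_nonneg[OF x] by simp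
  have bnd: "\<bar>?j s\<bar> \<le> B * jump_density s x" if "s \<in> {0..t}" for s
    unfolding abs_mult
    using that x jump_density_nonneg[of s x] act_kernel_trans_le[OF flow_in_space[of s x], of "t - s"]
    by (simp add: mult.commute[of B] mult_left_mono)
  have Bj: "set_integrable lborel {0..t} (\<lambda>s. B * jump_density s x)"
    by (intro set_integrable_mult_right set_integrable_jump_density x) simp
  have "(LBINT s:{0..t}. ?j s) \<le> (LBINT s:{0..t}. B * jump_density s x)"
    by (intro set_integral_mono set_integrable_renewal x Bj) (use bnd in \<open>auto simp: abs_le_iff\<close>)
  moreover have "(LBINT s:{0..t}. (- B) * jump_density s x) \<le> (LBINT s:{0..t}. ?j s)"
    by (intro set_integral_mono set_integrable_renewal set_integrable_mult_right set_integrable_jump_density x)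
      (use bnd in \<open>auto simp: abs_le_iff minus_le_iff\<close>)
  ultimately have "(LBINT s:{0..t}. ?j s) \<le> B * (1 - exp (- cumrate t x))"
    "- B * (1 - exp (- cumrate t x)) \<le> (LBINT s:{0..t}. ?j s)"
    unfolding set_integral_mult_right integral_jump_density[OF x t] by auto
  then have 1: "\<bar>LBINT s:{0..t}. ?j s\<bar> \<le> B * (1 - exp (- cumrate t x))"
    by (simp add: abs_le_iff)
  have "act (trans t) f x - f (\<phi> t x) = (LBINT s:{0..t}. ?j s) - (1 - exp (- cumrate t x)) * f (\<phi> t x)"
    using act_trans_renewal[OF x t] by (simp add: algebra_simps)
  also have "\<bar>\<dots>\<bar> \<le> B * (1 - exp (- cumrate t x)) + \<bar>(1 - exp (- cumrate t x)) * f (\<phi> t x)\<bar>"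
    using 1 by linarith
  also have "\<bar>(1 - exp (- cumrate t x)) * f (\<phi> t x)\<bar> \<le> (1 - exp (- cumrate t x)) * B"
    unfolding abs_mult using fB[OF flow_in_space[OF t x]] e by (simp add: mult_left_mono)
  finally show ?thesis by (simp add: algebra_simps)
qed

lemma act_trans_add:
  assumes x: "x \<in> space N" and ts: "0 \<le> t" "0 \<le> s"
  shows "act (trans (t + s)) f x = act (trans t) (act (trans s) f) x"
proof -
  let ?g = "\<lambda>y. f y + B"
  have g: "?g \<in> borel_measurable N" "\<And>y. y \<in> space N \<Longrightarrow> 0 \<le> ?g y" "\<And>y. y \<in> space N \<Longrightarrow> ?g y \<le> 2 * B"
    using fB by (auto simp: abs_le_iff) (smt (verit) fB)+
  have tr: "act (trans s) ?g y = act (trans s) f y + B" if "y \<in> space N" for s y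
    by (rule act_add_const[OF trans_kernel that f fB])
  have tr': "act (trans s) ?g \<in> borel_measurable N" "\<And>y. y \<in> space N \<Longrightarrow> 0 \<le> act (trans s) ?g y"
      "\<And>y. y \<in> space N \<Longrightarrow> act (trans s) ?g y \<le> 2 * B"
    using nn_integral_eq_act(2)[OF trans_kernel _ g] tr act_trans_le by (auto simp: abs_le_iff)
  have "ennreal (act (trans (t + s)) ?g x) = (\<integral>\<^sup>+z. ennreal (?g z) \<partial>trans (t + s) x)"
    by (rule nn_integral_eq_act(1)[OF trans_kernel x g, symmetric])
  also have "\<dots> = (\<integral>\<^sup>+y. \<integral>\<^sup>+z. ennreal (?g z) \<partial>trans s y \<partial>trans t x)"
    by (rule nn_integral_trans_add[OF x ts, where B="ennreal (2 * B)"]) (use g in \<open>auto intro: ennreal_leI\<close>)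
  also have "\<dots> = (\<integral>\<^sup>+y. ennreal (act (trans s) ?g y) \<partial>trans t x)"
    using prob_algebra_kernelD(3)[OF trans_kernel x]
    by (intro nn_integral_cong nn_integral_eq_act(1)[OF trans_kernel _ g]) auto
  also have "\<dots> = ennreal (act (trans t) (act (trans s) ?g) x)"
    by (rule nn_integral_eq_act(1)[OF trans_kernel x tr'])
  finally have "act (trans (t + s)) ?g x = act (trans t) (act (trans s) ?g) x"
    using nn_integral_eq_act(2)[OF trans_kernel x g] nn_integral_eq_act(2)[OF trans_kernel x tr']
    by (subst (asm) ennreal_inj) auto
  also have "act (trans t) (act (trans s) ?g) x = act (trans t) (\<lambda>y. act (trans s) f y + B) x"
    by (rule act_cong[OF trans_kernel x tr])
  also have "\<dots> = act (trans t) (act (trans s) f) x + B"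
    by (rule act_add_const[OF trans_kernel x act_trans_measurable_N act_trans_le])
  finally show ?thesis by (simp add: act_add_const[OF trans_kernel x f fB])
qed

text \<open>Strong continuity of the semigroup at \<open>f\<close> forces right continuity of
  \<open>f\<close> along orbits, because semigroup and flow differ by at most a multiple of the jump
  probability, which vanishes as \<open>t\<close> tends to zero.\<close>

lemma tendsto_flow_at_right:
  assumes x: "x \<in> space N" and lim: "((\<lambda>t. uniform_norm (space N) (\<lambda>x. act (trans t) f x - f x)) \<longlongrightarrow> 0) (at_right 0)"
  shows "((\<lambda>t. f (\<phi> t x)) \<longlongrightarrow> f x) (at_right 0)"
proof -
  have "((\<lambda>t. act (trans t) f x) \<longlongrightarrow> f x) (at_right 0)"
  proof (rule tendstoI)
    fix e :: real assume "0 < e"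
    then have "\<forall>\<^sub>F t in at_right 0. \<forall>x\<in>space N. \<bar>act (trans t) f x - f x\<bar> \<le> e / 2"
      by (intro uniform_norm_tendsto_0D[OF lim]) auto
    then show "\<forall>\<^sub>F t in at_right 0. dist (act (trans t) f x) (f x) < e"
      by eventually_elim (use x \<open>0 < e\<close> in \<open>force simp: dist_real_def\<close>)
  qed
  moreover have "((\<lambda>t. act (trans t) f x - f (\<phi> t x)) \<longlongrightarrow> 0) (at_right 0)"
  proof (rule Lim_null_comparison)
    show "\<forall>\<^sub>F t in at_right 0. norm (act (trans t) f x - f (\<phi> t x)) \<le> 2 * B * (1 - exp (- cumrate t x))"
      using act_trans_flow_diff_le[OF x] by (auto simp: eventually_at_filter)
    have "((\<lambda>t. cumrate t x) \<longlongrightarrow> cumrate 0 x) (at 0 within {0..1})"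
      using continuous_on_cumrate[OF x, of 1] unfolding continuous_on_def by (rule bspec) simp
    then have "((\<lambda>t. cumrate t x) \<longlongrightarrow> 0) (at_right 0)"
      by (simp add: at_within_Icc_at_right)
    then have "((\<lambda>t. 2 * B * (1 - exp (- cumrate t x))) \<longlongrightarrow> 2 * B * (1 - exp (- 0))) (at_right 0)"
      by (intro tendsto_intros)
    then show "((\<lambda>t. 2 * B * (1 - exp (- cumrate t x))) \<longlongrightarrow> 0) (at_right 0)" by simp
  qed
  ultimately have "((\<lambda>t. act (trans t) f x - (act (trans t) f x - f (\<phi> t x))) \<longlongrightarrow> f x - 0) (at_right 0)"
    by (rule tendsto_diff)
  then show ?thesis by simp
qed

end

lemma set_integrable_jump_part:
  assumes f [measurable]: "f \<in> borel_measurable N" and fB: "\<And>y. y \<in> space N \<Longrightarrow> \<bar>f y\<bar> \<le> B"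
    and x: "x \<in> space N"
  shows "set_integrable lborel {0..b} (\<lambda>s. r (\<phi> s x) * (act Q f (\<phi> s x) - f (\<phi> s x)))" (is "set_integrable _ _ ?k")
proof -
  obtain L where L: "0 \<le> L" "\<And>s. s \<in> {0..b} \<Longrightarrow> r (\<phi> s x) \<le> L"
    using rate_bound[OF x] by metis
  show ?thesis
  proof (rule set_integrable_Icc_bounded[where B="L * (2 * B)"])
    show "(\<lambda>s. ?k (max 0 s)) \<in> borel_measurable borel" using x by measurable
    fix s assume s: "s \<in> {0..b}"
    then have y: "\<phi> s x \<in> space N" using x by (intro flow_in_space) auto
    have "\<bar>act Q f (\<phi> s x)\<bar> \<le> B"
      by (rule act_abs_le[OF kernel_measurable y f fB])
    then show "\<bar>?k s\<bar> \<le> L * (2 * B)"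
      unfolding abs_mult using L(1) L(2)[OF s] rate_nonneg[OF y] fB[OF y]
      by (intro mult_mono) auto
  qed simp
qed

text \<open>The transport part \<open>f (\<phi> h x)\<close> is left unexpanded, so no derivative
  along the flow enters. The jump part is kept as an integral, since its integrand has no continuity
  at \<open>0\<close> and its averages are not known to converge.\<close>

lemma generator_expansion:
  assumes f [measurable]: "f \<in> borel_measurable N" and fB: "\<And>y. y \<in> space N \<Longrightarrow> \<bar>f y\<bar> \<le> B"
    and x: "x \<in> space N"
    and lim: "((\<lambda>t. uniform_norm (space N) (\<lambda>x. act (trans t) f x - f x)) \<longlongrightarrow> 0) (at_right 0)"
  shows "((\<lambda>h. (act (trans h) f x - f (\<phi> h x) -
    (LBINT s:{0..h}. r (\<phi> s x) * (act Q f (\<phi> s x) - f (\<phi> s x)))) / h) \<longlongrightarrow> 0) (at_right 0)"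
proof -
  let ?k = "\<lambda>s. r (\<phi> s x) * (act Q f (\<phi> s x) - f (\<phi> s x))"
  let ?A = "\<lambda>h s. act Q (act (trans (h - s)) f) (\<phi> s x)"
  obtain L where L: "0 \<le> L"
    "\<And>s t. \<lbrakk>0 \<le> s; s \<le> t; t \<le> 1\<rbrakk> \<Longrightarrow> cumrate t x - cumrate s x \<le> L * (t - s)"
    "\<And>s. s \<in> {0..1} \<Longrightarrow> r (\<phi> s x) \<le> L"
    using cumrate_Lipschitz[OF x, of 1] by metis
  have B0: "0 \<le> B" using fB[OF x] by simp
  \<comment> \<open>Three replacements are made under the integral: \<open>jump_density s x\<close>
    by the rate, with relative error \<open>L * h\<close> on values of size \<open>2 * B\<close>;
    \<open>act (trans (h - s)) f\<close> by \<open>f\<close> inside the kernel, at cost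
    \<open>d\<close>; and \<open>f (\<phi> h x)\<close> by \<open>f (\<phi> s x)\<close>, at cost
    \<open>2 * d\<close> by way of \<open>f x\<close>. Each error is multiplied by the rate bound
    \<open>L\<close>.\<close>
  have main: "\<bar>act (trans h) f x - f (\<phi> h x) - (LBINT s:{0..h}. ?k s)\<bar> \<le> (L * (L * h) * (2 * B) + 3 * L * d) * h"
    if h: "0 < h" "h \<le> 1" and d: "0 \<le> d"
      and u: "\<And>t y. \<lbrakk>0 < t; t \<le> h; y \<in> space N\<rbrakk> \<Longrightarrow> \<bar>act (trans t) f y - f y\<bar> \<le> d"
      and fl: "\<And>t. \<lbrakk>0 < t; t \<le> h\<rbrakk> \<Longrightarrow> \<bar>f (\<phi> t x) - f x\<bar> \<le> d" for h d
  proof -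
    let ?F = "\<lambda>s. (jump_density s x * ?A h s - jump_density s x * f (\<phi> h x)) - ?k s"
    have i1: "set_integrable lborel {0..h} (\<lambda>s. jump_density s x * ?A h s)"
      by (rule set_integrable_renewal[OF f fB x])
    have i2: "set_integrable lborel {0..h} (\<lambda>s. jump_density s x * f (\<phi> h x))"
      by (intro set_integrable_mult_left set_integrable_jump_density x) simp
    have i3: "set_integrable lborel {0..h} ?k" by (rule set_integrable_jump_part[OF f fB x])
    have "act (trans h) f x - f (\<phi> h x) - (LBINT s:{0..h}. ?k s) = (LBINT s:{0..h}. ?F s)"
    proof -
      have "(LBINT s:{0..h}. jump_density s x * f (\<phi> h x)) = (1 - exp (- cumrate h x)) * f (\<phi> h x)"
        using integral_jump_density[OF x, of h] h(1) by simp
      then have "(LBINT s:{0..h}. jump_density s x * f (\<phi> h x)) = f (\<phi> h x) - exp (- cumrate h x) * f (\<phi> h x)"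
        by (simp only: left_diff_distrib mult_1)
      moreover have "(LBINT s:{0..h}. ?F s) = (LBINT s:{0..h}. jump_density s x * ?A h s) -
          (LBINT s:{0..h}. jump_density s x * f (\<phi> h x)) - (LBINT s:{0..h}. ?k s)"
        unfolding set_integral_diff(2)[OF set_integral_diff(1)[OF i1 i2] i3] set_integral_diff(2)[OF i1 i2] ..
      ultimately show ?thesis
        using act_trans_renewal[OF f fB x, of h] h(1) by linarith
    qed
    also have "\<bar>\<dots>\<bar> \<le> (L * (L * h) * (2 * B) + 3 * L * d) * (h - 0)"
    proof (intro set_integral_Icc_abs_le set_integral_diff(1) i1 i2 i3)
      fix s assume s: "s \<in> {0..h}"
      then have y: "\<phi> s x \<in> space N" using x by (intro flow_in_space) auto
      let ?r = "r (\<phi> s x)" and ?e = "exp (- cumrate s x)"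
      have r: "0 \<le> ?r" "?r \<le> L" using rate_nonneg[OF y] L(3)[of s] s h by auto
      have e: "0 \<le> 1 - ?e" "1 - ?e \<le> L * h"
      proof -
        have "1 - ?e \<le> cumrate s x" using exp_ge_add_one_self[of "- cumrate s x"] by simp
        also have "\<dots> \<le> L * s" using L(2)[of 0 s] s h by simp
        also have "\<dots> \<le> L * h" using L(1) s by (intro mult_left_mono) auto
        finally show "1 - ?e \<le> L * h" .
      qed (use cumrate_nonneg[OF x] in simp)
      have A_f: "\<bar>?A h s - f (\<phi> h x)\<bar> \<le> 2 * B"
        using act_kernel_trans_le[OF f fB y, of "h - s"] fB[OF flow_in_space[OF _ x, of h]] h by auto
      have A_Q: "\<bar>?A h s - act Q f (\<phi> s x)\<bar> \<le> d"
      proof -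
        have "act Q (\<lambda>y. act (trans (h - s)) f y - f y) (\<phi> s x) = ?A h s - act Q f (\<phi> s x)"
          by (rule act_diff[OF kernel_measurable y act_trans_measurable_N[OF f fB] act_trans_le[OF f fB] f fB])
        moreover have "\<bar>act Q (\<lambda>y. act (trans (h - s)) f y - f y) (\<phi> s x)\<bar> \<le> d"
        proof (rule act_abs_le[OF kernel_measurable y])
          fix z assume z: "z \<in> space N"
          show "\<bar>act (trans (h - s)) f z - f z\<bar> \<le> d"
            using u[of "h - s" z] s z d act_trans_0[OF f fB z] by (cases "s = h") auto
        qed measurable
        ultimately show ?thesis by simp
      qed
      have f_f: "\<bar>f (\<phi> s x) - f (\<phi> h x)\<bar> \<le> 2 * d"
      proof -
        have "\<bar>f (\<phi> s x) - f x\<bar> \<le> d"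
          using fl[of s] s d flow_0[OF x] by (cases "s = 0") auto
        with fl[of h] h show ?thesis by linarith
      qed
      have tri: "\<bar>- a + b + c\<bar> \<le> A + B' + C" if "\<bar>a\<bar> \<le> A" "\<bar>b\<bar> \<le> B'" "\<bar>c\<bar> \<le> C" for a b c A B' C :: real
        using that by linarith
      have "?F s = - (?r * (1 - ?e) * (?A h s - f (\<phi> h x))) + ?r * (?A h s - act Q f (\<phi> s x)) +
          ?r * (f (\<phi> s x) - f (\<phi> h x))"
        unfolding jump_density_def by algebra
      also have "\<bar>\<dots>\<bar> \<le> L * (L * h) * (2 * B) + L * d + L * (2 * d)"
      proof (rule tri)
        show "\<bar>?r * (1 - ?e) * (?A h s - f (\<phi> h x))\<bar> \<le> L * (L * h) * (2 * B)"
          unfolding abs_mult using r e A_f L(1) h by (intro mult_mono) simp_all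
        show "\<bar>?r * (?A h s - act Q f (\<phi> s x))\<bar> \<le> L * d"
          unfolding abs_mult using r A_Q L(1) by (intro mult_mono) simp_all
        show "\<bar>?r * (f (\<phi> s x) - f (\<phi> h x))\<bar> \<le> L * (2 * d)"
          unfolding abs_mult using r f_f L(1) by (intro mult_mono) simp_all
      qed
      also have "\<dots> = L * (L * h) * (2 * B) + 3 * L * d" by simp
      finally show "\<bar>?F s\<bar> \<le> L * (L * h) * (2 * B) + 3 * L * d" .
    qed (use h in auto)
    finally show ?thesis by simp
  qed
  show ?thesis
  proof (rule tendstoI)
    fix e :: real assume e: "0 < e"
    \<comment> \<open>Makes \<open>3 * L * d\<close> less than \<open>e / 2\<close>, with
      \<open>L + 1\<close> guarding against \<open>L = 0\<close>; the other half of \<open>e\<close>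
      is left for the term linear in \<open>h\<close>.\<close>
    define d where "d = e / (12 * (L + 1))"
    have "12 * (L + 1) * d = e" using L(1) by (simp add: d_def)
    then have "12 * (L * d) + 12 * d = e" by (simp add: algebra_simps)
    moreover have "0 < d" using e L(1) by (simp add: d_def)
    moreover have "0 \<le> L * d" using L(1) \<open>0 < d\<close> by simp
    ultimately have d: "0 < d" "3 * L * d < e / 2" by (auto simp: mult.assoc)
    have "\<forall>\<^sub>F t in at_right 0. \<forall>x\<in>space N. \<bar>act (trans t) f x - f x\<bar> \<le> d"
      by (rule uniform_norm_tendsto_0D[OF lim d(1)])
    then obtain b1 where b1: "0 < b1" "\<And>t. 0 < t \<Longrightarrow> t < b1 \<Longrightarrow> \<forall>x\<in>space N. \<bar>act (trans t) f x - f x\<bar> \<le> d"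
      unfolding eventually_at_right_field by blast
    have "\<forall>\<^sub>F t in at_right 0. dist (f (\<phi> t x)) (f x) < d"
      by (rule tendstoD[OF tendsto_flow_at_right[OF f fB x lim] d(1)])
    then obtain b2 where b2: "0 < b2" "\<And>t. 0 < t \<Longrightarrow> t < b2 \<Longrightarrow> dist (f (\<phi> t x)) (f x) < d"
      unfolding eventually_at_right_field by blast
    have "((\<lambda>h. L * (L * h) * (2 * B)) \<longlongrightarrow> L * (L * 0) * (2 * B)) (at_right 0)"
      by (intro tendsto_intros)
    then have "\<forall>\<^sub>F h in at_right 0. L * (L * h) * (2 * B) < e / 2"
      using e by (intro order_tendstoD(2)) auto
    moreover have "\<forall>\<^sub>F h in at_right 0. h \<in> {0<..<min 1 (min b1 b2)}"
      using b1 b2 by (intro eventually_at_right_real) auto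
    ultimately show "\<forall>\<^sub>F h in at_right 0. dist ((act (trans h) f x - f (\<phi> h x) - (LBINT s:{0..h}. ?k s)) / h) 0 < e"
    proof eventually_elim
      case (elim h)
      then have h: "0 < h" "h \<le> 1" "h < b1" "h < b2" by auto
      have "\<bar>act (trans h) f x - f (\<phi> h x) - (LBINT s:{0..h}. ?k s)\<bar> \<le> (L * (L * h) * (2 * B) + 3 * L * d) * h"
      proof (rule main[OF h(1,2)])
        show "\<bar>act (trans t) f y - f y\<bar> \<le> d" if "0 < t" "t \<le> h" "y \<in> space N" for t y
          using b1(2)[of t] that h(3) by simp
        show "\<bar>f (\<phi> t x) - f x\<bar> \<le> d" if "0 < t" "t \<le> h" for t
          using b2(2)[of t] that h(4) by (simp add: dist_real_def)
      qed (use d in simp)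
      also have "\<dots> < e * h" using elim d h by (intro mult_strict_right_mono) auto
      finally show ?case using h(1) by (simp only: dist_real_def diff_0_right abs_divide abs_of_pos pos_divide_less_eq)
    qed
  qed
qed

section \<open>Potentials over a finite time interval and their generator\<close>

definition potential :: "real \<Rightarrow> ('a \<Rightarrow> real) \<Rightarrow> 'a \<Rightarrow> real" where
  "potential t f x = (LBINT s:{0..t}. act (trans s) f x)"

context
  fixes f :: "'a \<Rightarrow> real" and B :: real
  assumes f [measurable]: "f \<in> borel_measurable N" and fB: "\<And>y. y \<in> space N \<Longrightarrow> \<bar>f y\<bar> \<le> B"
begin

lemma set_integrable_act_trans:
  assumes x: "x \<in> space N" and "0 \<le> a"
  shows "set_integrable lborel {a..b} (\<lambda>s. act (trans (c + s)) f x)"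
  by (rule set_integrable_Icc_bounded[where B=B]) (use assms act_trans_le[OF f fB x] in measurable)

lemma potential_measurable [measurable]: "potential t f \<in> borel_measurable N"
  unfolding potential_def set_lebesgue_integral_def by measurable

lemma potential_le:
  assumes "x \<in> space N" "0 \<le> t"
  shows "\<bar>potential t f x\<bar> \<le> B * t"
  using set_integral_Icc_abs_le[OF assms(2) set_integrable_act_trans[OF assms(1), of 0 t 0], of B]
    act_trans_le[OF f fB assms(1)]
  by (simp add: potential_def)

lemma act_trans_potential:
  assumes x: "x \<in> space N" and h: "0 \<le> h" and t: "0 \<le> t"
  shows "act (trans h) (potential t f) x = (LBINT s:{0..t}. act (trans (h + s)) f x)"
proof -
  let ?T = "trans h x"
  have y: "prob_space ?T" "sets ?T = sets N" "space ?T = space N"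
    by (rule prob_algebra_kernelD[OF trans_kernel x])+
  interpret T: prob_space ?T by fact
  interpret TL: pair_sigma_finite ?T "lborel :: real measure" ..
  have meas: "(\<lambda>(y, s). indicator {0..t} s * act (trans s) f y) \<in> borel_measurable (?T \<Otimes>\<^sub>M lborel)"
  proof -
    have "(\<lambda>(y, s). indicator {0..t} s * act (trans s) f y) \<in> borel_measurable (N \<Otimes>\<^sub>M borel)"
      by measurable
    also have "borel_measurable (N \<Otimes>\<^sub>M borel) = borel_measurable (?T \<Otimes>\<^sub>M lborel)"
      by (intro measurable_cong_sets sets_pair_measure_cong) (simp_all add: y)
    finally show ?thesis .
  qed
  have int: "integrable (?T \<Otimes>\<^sub>M lborel) (\<lambda>(y, s). indicator {0..t} s * act (trans s) f y)"
  proof (rule integrableI_bounded_set[where A="space ?T \<times> {0..t}" and B=B])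
    show "emeasure (?T \<Otimes>\<^sub>M lborel) (space ?T \<times> {0..t}) < \<infinity>"
      using t by (subst lborel.emeasure_pair_measure_Times) (auto simp: T.emeasure_space_1)
    show "AE z in ?T \<Otimes>\<^sub>M lborel. z \<in> space ?T \<times> {0..t} \<longrightarrow> norm (case z of (y, s) \<Rightarrow> indicator {0..t} s * act (trans s) f y) \<le> B"
      using act_trans_le[OF f fB] y by (intro AE_I2) auto
    show "AE z in ?T \<Otimes>\<^sub>M lborel. z \<notin> space ?T \<times> {0..t} \<longrightarrow> (case z of (y, s) \<Rightarrow> indicator {0..t} s * act (trans s) f y) = 0"
      by (intro AE_I2) (auto simp: space_pair_measure indicator_def)
  qed (use meas in auto)
  have "act (trans h) (potential t f) x = (\<integral>y. (\<integral>s. indicator {0..t} s * act (trans s) f y \<partial>lborel) \<partial>?T)"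
    by (simp add: act_def potential_def set_lebesgue_integral_def)
  also have "\<dots> = (\<integral>s. (\<integral>y. indicator {0..t} s * act (trans s) f y \<partial>?T) \<partial>lborel)"
    by (rule TL.Fubini_integral[OF int, symmetric])
  also have "\<dots> = (\<integral>s. indicator {0..t} s * act (trans (h + s)) f x \<partial>lborel)"
  proof (rule Bochner_Integration.integral_cong[OF refl])
    fix s :: real
    show "(\<integral>y. indicator {0..t} s * act (trans s) f y \<partial>?T) = indicator {0..t} s * act (trans (h + s)) f x"
      using act_trans_add[OF f fB x h, of s] by (cases "s \<in> {0..t}") (auto simp: act_def)
  qed
  finally show ?thesis by (simp add: set_lebesgue_integral_def)
qed

text \<open>By Fubini and the semigroup law, the kernel for time \<open>h\<close> shifts the time
  window by \<open>h\<close>. Old and new window differ in two pieces of length \<open>h\<close> at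
  the ends, and dividing by \<open>h\<close> turns these into averages.\<close>

lemma potential_increment:
  assumes x: "x \<in> space N" and h: "0 \<le> h" and t: "0 \<le> t"
  shows "act (trans h) (potential t f) x - potential t f x =
    (LBINT s:{t..t + h}. act (trans s) f x) - (LBINT s:{0..h}. act (trans s) f x)"
proof -
  have "act (trans h) (potential t f) x = (LBINT s:{h..t + h}. act (trans s) f x)"
    using act_trans_potential[OF x h t] set_integral_shift[of 0 h t "\<lambda>s. act (trans (h + s)) f x"] by simp
  moreover have "(LBINT s:{0..t + h}. act (trans s) f x) =
      (LBINT s:{0..h}. act (trans s) f x) + (LBINT s:{h..t + h}. act (trans s) f x)"
    using set_integrable_act_trans[OF x, of 0 "t + h" 0] h t by (intro set_integral_Icc_split) auto
  moreover have "(LBINT s:{0..t + h}. act (trans s) f x) =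
      (LBINT s:{0..t}. act (trans s) f x) + (LBINT s:{t..t + h}. act (trans s) f x)"
    using set_integrable_act_trans[OF x, of 0 "t + h" 0] h t by (intro set_integral_Icc_split) auto
  ultimately show ?thesis by (simp add: potential_def)
qed

lemma potential_in_B0:
  assumes t: "0 \<le> t"
  shows "((\<lambda>h. uniform_norm (space N) (\<lambda>x. act (trans h) (potential t f) x - potential t f x)) \<longlongrightarrow> 0) (at_right 0)"
proof (rule tendsto_sandwich[where f="\<lambda>_. 0" and h="\<lambda>h. ennreal (2 * B * h)"])
  have "\<bar>act (trans h) (potential t f) x - potential t f x\<bar> \<le> 2 * B * h" if "0 < h" "x \<in> space N" for h x
  proof -
    have "\<bar>LBINT s:{t..t + h}. act (trans s) f x\<bar> \<le> B * (t + h - t)" "\<bar>LBINT s:{0..h}. act (trans s) f x\<bar> \<le> B * (h - 0)"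
      using that(1) t act_trans_le[OF f fB that(2)] set_integrable_act_trans[OF that(2), of t "t + h" 0]
        set_integrable_act_trans[OF that(2), of 0 h 0]
      by (intro set_integral_Icc_abs_le; simp)+
    then show ?thesis using potential_increment[OF that(2) _ t, of h] that by simp
  qed
  then show "\<forall>\<^sub>F h in at_right 0. uniform_norm (space N) (\<lambda>x. act (trans h) (potential t f) x - potential t f x) \<le> ennreal (2 * B * h)"
    by (intro eventually_mono[OF eventually_at_right_less[of 0]])
      (auto simp: uniform_norm_def intro!: SUP_least ennreal_leI)
  have "((\<lambda>h. ennreal (2 * B * h)) \<longlongrightarrow> ennreal (2 * B * 0)) (at_right 0)"
    by (intro tendsto_intros)
  then show "((\<lambda>h. ennreal (2 * B * h)) \<longlongrightarrow> 0) (at_right 0)" by simp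
qed auto

context
  assumes lim: "((\<lambda>t. uniform_norm (space N) (\<lambda>x. act (trans t) f x - f x)) \<longlongrightarrow> 0) (at_right 0)"
begin

text \<open>\<open>act (trans s) f - act (trans t) f\<close> is the kernel for time \<open>t\<close>
  applied to \<open>act (trans (s - t)) f - f\<close>, which is uniformly small by
  \<open>lim\<close>; so right continuity at time \<open>0\<close> gives it at every time.\<close>

lemma act_trans_right_average:
  assumes x: "x \<in> space N" and t: "0 \<le> t"
  shows "((\<lambda>h. (LBINT s:{t..t + h}. act (trans s) f x) / h) \<longlongrightarrow> act (trans t) f x) (at_right 0)"
proof (rule tendstoI)
  fix e :: real assume e: "0 < e"
  then have "\<forall>\<^sub>F u in at_right 0. \<forall>x\<in>space N. \<bar>act (trans u) f x - f x\<bar> \<le> e / 2"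
    by (intro uniform_norm_tendsto_0D[OF lim]) auto
  then obtain b where b: "0 < b" "\<And>u. 0 < u \<Longrightarrow> u < b \<Longrightarrow> \<forall>x\<in>space N. \<bar>act (trans u) f x - f x\<bar> \<le> e / 2"
    unfolding eventually_at_right_field by blast
  have "\<forall>\<^sub>F h in at_right 0. h \<in> {0<..<b}"
    using b by (intro eventually_at_right_real) auto
  then show "\<forall>\<^sub>F h in at_right 0. dist ((LBINT s:{t..t + h}. act (trans s) f x) / h) (act (trans t) f x) < e"
  proof eventually_elim
    case (elim h)
    then have h: "0 < h" "h < b" by auto
    have c: "set_integrable lborel {t..t + h} (\<lambda>_. act (trans t) f x)"
      by (rule borel_integrable_atLeastAtMost'[OF continuous_on_const])
    have i: "set_integrable lborel {t..t + h} (\<lambda>s. act (trans s) f x)"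
      using set_integrable_act_trans[OF x t, of "t + h" 0] by simp
    have "\<bar>LBINT s:{t..t + h}. act (trans s) f x - act (trans t) f x\<bar> \<le> e / 2 * (t + h - t)"
    proof (intro set_integral_Icc_abs_le set_integral_diff(1) c i)
      fix s assume s: "s \<in> {t..t + h}"
      show "\<bar>act (trans s) f x - act (trans t) f x\<bar> \<le> e / 2"
      proof (cases "s = t")
        case False
        have "act (trans s) f x = act (trans t) (act (trans (s - t)) f) x"
          using act_trans_add[OF f fB x t, of "s - t"] s by simp
        then have "act (trans s) f x - act (trans t) f x = act (trans t) (\<lambda>y. act (trans (s - t)) f y - f y) x"
          using act_diff[OF trans_kernel x act_trans_measurable_N[OF f fB] act_trans_le[OF f fB] f fB] by simp
        also have "\<bar>\<dots>\<bar> \<le> e / 2"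
          by (rule act_abs_le[OF trans_kernel x]) (use b(2)[of "s - t"] s False h in \<open>auto\<close>)
        finally show ?thesis .
      qed (use e in simp)
    qed (use h in simp)
    also have "(LBINT s:{t..t + h}. act (trans s) f x - act (trans t) f x) = (LBINT s:{t..t + h}. act (trans s) f x) - h * act (trans t) f x"
      using h by (simp add: set_integral_diff(2)[OF i c] set_integral_const)
    finally have "\<bar>(LBINT s:{t..t + h}. act (trans s) f x) / h - act (trans t) f x\<bar> \<le> e / 2"
      using h by (simp add: abs_le_iff field_simps)
    then show ?case using e by (simp add: dist_real_def)
  qed
qed

lemma potential_generator:
  assumes x: "x \<in> space N" and t: "0 \<le> t"
  shows "((\<lambda>h. (act (trans h) (potential t f) x - potential t f x) / h) \<longlongrightarrow> act (trans t) f x - f x) (at_right 0)"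
proof -
  have "((\<lambda>h. (LBINT s:{t..t + h}. act (trans s) f x) / h - (LBINT s:{0..0 + h}. act (trans s) f x) / h) \<longlongrightarrow>
      act (trans t) f x - act (trans 0) f x) (at_right 0)"
    by (intro tendsto_diff act_trans_right_average x t order_refl)
  then have "((\<lambda>h. (LBINT s:{t..t + h}. act (trans s) f x) / h - (LBINT s:{0..0 + h}. act (trans s) f x) / h) \<longlongrightarrow>
      act (trans t) f x - f x) (at_right 0)"
    by (simp add: act_trans_0[OF f fB x])
  then show ?thesis
  proof (rule Lim_transform_eventually)
    show "\<forall>\<^sub>F h in at_right 0. (LBINT s:{t..t + h}. act (trans s) f x) / h - (LBINT s:{0..0 + h}. act (trans s) f x) / h =
        (act (trans h) (potential t f) x - potential t f x) / h"
      by (rule eventually_mono[OF eventually_at_right_less[of 0]])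
        (simp add: potential_increment[OF x _ t] flip: diff_divide_distrib)
  qed
qed

end

end

end

section \<open>Order continuity and monotone classes\<close>

text \<open>The integrable case of the Brezis-Lieb lemma: a sequence tending to zero almost
  everywhere becomes asymptotically disjoint from \<open>v\<close>. The difference of the absolute
  values is dominated by that of \<open>v\<close>.\<close>

lemma integral_abs_add_vanishing:
  fixes u :: "nat \<Rightarrow> 'b \<Rightarrow> real"
  assumes [measurable]: "integrable M v" "\<And>n. integrable M (u n)"
    and u: "AE x in M. (\<lambda>n. u n x) \<longlonglongrightarrow> 0"
  shows "(\<lambda>n. (\<integral>x. \<bar>v x + u n x\<bar> \<partial>M) - (\<integral>x. \<bar>u n x\<bar> \<partial>M)) \<longlonglongrightarrow> (\<integral>x. \<bar>v x\<bar> \<partial>M)"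
proof -
  have "(\<lambda>n. \<integral>x. \<bar>v x + u n x\<bar> - \<bar>u n x\<bar> \<partial>M) \<longlonglongrightarrow> (\<integral>x. \<bar>v x\<bar> \<partial>M)"
  proof (rule integral_dominated_convergence[where w="\<lambda>x. \<bar>v x\<bar>"])
    show "AE x in M. (\<lambda>n. \<bar>v x + u n x\<bar> - \<bar>u n x\<bar>) \<longlonglongrightarrow> \<bar>v x\<bar>"
      using u
    proof eventually_elim
      case (elim x)
      have "(\<lambda>n. \<bar>v x + u n x\<bar> - \<bar>u n x\<bar>) \<longlonglongrightarrow> \<bar>v x + 0\<bar> - \<bar>0\<bar>"
        by (intro tendsto_intros elim)
      then show ?case by simp
    qed
  qed (use assms in \<open>auto intro!: AE_I2\<close>)
  then show ?thesis using assms by simp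
qed

text \<open>A gliding hump: were the norms bounded away from zero, sums of widely spaced differences
  \<open>d m - d k\<close>, which telescope and so stay in \<open>[0, B]\<close>, would have images of
  arbitrarily large norm, because almost everywhere vanishing functions are asymptotically
  disjoint from a fixed integrable one.\<close>

lemma bounded_operator_order_continuous:
  fixes T :: "('a \<Rightarrow> real) \<Rightarrow> 'b \<Rightarrow> real" and d :: "nat \<Rightarrow> 'a \<Rightarrow> real"
  assumes d [measurable]: "\<And>n. d n \<in> borel_measurable N"
    and decr: "\<And>m n x. \<lbrakk>m \<le> n; x \<in> space N\<rbrakk> \<Longrightarrow> d n x \<le> d m x"
    and d_bounds: "\<And>n x. x \<in> space N \<Longrightarrow> 0 \<le> d n x" "\<And>n x. x \<in> space N \<Longrightarrow> d n x \<le> B"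
    and T_bound: "\<And>w. \<lbrakk>w \<in> borel_measurable N; \<And>x. x \<in> space N \<Longrightarrow> 0 \<le> w x \<and> w x \<le> B\<rbrakk> \<Longrightarrow>
      integrable M (T w) \<and> (\<integral>x. \<bar>T w x\<bar> \<partial>M) \<le> S"
    and T_add: "\<And>w m k x. \<lbrakk>w \<in> borel_measurable N; \<And>x. x \<in> space N \<Longrightarrow> 0 \<le> w x \<and> w x \<le> B; x \<in> space M\<rbrakk> \<Longrightarrow>
      T (\<lambda>y. w y + (d m y - d k y)) x = T w x + (T (d m) x - T (d k) x)"
    and lim: "AE x in M. (\<lambda>n. T (d n) x) \<longlonglongrightarrow> 0"
  shows "(\<lambda>n. \<integral>x. \<bar>T (d n) x\<bar> \<partial>M) \<longlonglongrightarrow> 0"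
proof (rule ccontr)
  let ?n = "\<lambda>f. \<integral>x. \<bar>f x\<bar> \<partial>M"
  assume "\<not> ?thesis"
  then obtain e where e: "0 < e" "\<And>n. \<exists>m\<ge>n. e \<le> ?n (T (d m))"
    unfolding LIMSEQ_iff by (auto simp: not_less)
  have Td: "integrable M (T (d n))" for n
    using T_bound[OF d] d_bounds by blast
  \<comment> \<open>Bounding \<open>w\<close> by \<open>B - d n\<close> rather than \<open>B\<close>
    leaves room to add a later difference \<open>d m - d k\<close> with
    \<open>n \<le> m \<le> k\<close>, after which the bound is \<open>B - d k\<close>. Each round
    gains \<open>e\<close> from \<open>d m\<close> and loses at most \<open>e / 4\<close> when
    adding \<open>d m\<close> and again when subtracting \<open>d k\<close>, hence the net gain
    \<open>e / 2\<close>.\<close>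
  have "\<exists>w n. w \<in> borel_measurable N \<and> (\<forall>x\<in>space N. 0 \<le> w x \<and> w x \<le> B - d n x) \<and> real J * (e / 2) \<le> ?n (T w)" for J
  proof (induction J)
    case 0
    show ?case
      using d_bounds by (intro exI[of _ "\<lambda>_. 0"] exI[of _ 0]) auto
  next
    case (Suc J)
    then obtain w n where w [measurable]: "w \<in> borel_measurable N"
      and w_bounds: "\<And>x. x \<in> space N \<Longrightarrow> 0 \<le> w x \<and> w x \<le> B - d n x" and J: "real J * (e / 2) \<le> ?n (T w)"
      by blast
    have w_le: "0 \<le> w x \<and> w x \<le> B" if "x \<in> space N" for x
      using w_bounds[OF that] d_bounds(1)[OF that, of n] by auto
    have Tw: "integrable M (T w)" using T_bound[OF w w_le] by blast
    have "\<forall>\<^sub>F m in sequentially. ?n (T w) - e / 4 < ?n (\<lambda>x. T w x + T (d m) x) - ?n (T (d m))"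
      using e(1) by (intro order_tendstoD(1)[OF integral_abs_add_vanishing[OF Tw Td lim]]) auto
    then obtain m0 where m0: "\<And>m. m0 \<le> m \<Longrightarrow> ?n (T w) - e / 4 < ?n (\<lambda>x. T w x + T (d m) x) - ?n (T (d m))"
      unfolding eventually_sequentially by blast
    obtain m where m: "max n m0 \<le> m" "e \<le> ?n (T (d m))" using e(2) by blast
    let ?v = "\<lambda>x. T w x + T (d m) x"
    have v: "integrable M ?v" using Tw Td by simp
    have Td': "integrable M (\<lambda>x. - T (d k) x)" for k using Td by simp
    have lim': "AE x in M. (\<lambda>k. - T (d k) x) \<longlonglongrightarrow> 0"
      using lim by eventually_elim (auto dest: tendsto_minus)
    have "\<forall>\<^sub>F k in sequentially. ?n ?v - e / 4 < ?n (\<lambda>x. ?v x + - T (d k) x) - ?n (\<lambda>x. - T (d k) x)"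
      using e(1) by (intro order_tendstoD(1)[OF integral_abs_add_vanishing[OF v Td' lim']]) auto
    then obtain k0 where k0: "\<And>k. k0 \<le> k \<Longrightarrow> ?n ?v - e / 4 < ?n (\<lambda>x. ?v x + - T (d k) x) - ?n (\<lambda>x. - T (d k) x)"
      unfolding eventually_sequentially by blast
    define k where "k = max k0 m"
    have k: "k0 \<le> k" "m \<le> k" by (auto simp: k_def)
    let ?w = "\<lambda>y. w y + (d m y - d k y)"
    have "?n (T ?w) = ?n (\<lambda>x. ?v x + - T (d k) x)"
      by (rule Bochner_Integration.integral_cong[OF refl]) (simp add: T_add[OF w w_le])
    moreover have "0 \<le> ?n (\<lambda>x. - T (d k) x)" by (rule integral_nonneg_AE) simp
    moreover have "real (Suc J) * (e / 2) = real J * (e / 2) + e / 2" by (simp add: algebra_simps)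
    moreover have "m0 \<le> m" using m by simp
    ultimately have "real (Suc J) * (e / 2) \<le> ?n (T ?w)"
      using k0[OF k(1)] m0[of m] m(2) J by linarith
    moreover have "0 \<le> ?w x \<and> ?w x \<le> B - d k x" if "x \<in> space N" for x
      using w_bounds[OF that] decr[OF k(2) that] decr[of n m x] that m by auto
    ultimately show ?case by (intro exI[of _ ?w] exI[of _ k]) auto
  qed
  moreover obtain J where "S < real J * (e / 2)"
    using ex_less_of_nat_mult[of "e / 2" S] e(1) by auto
  ultimately obtain w n where w: "w \<in> borel_measurable N" "\<forall>x\<in>space N. 0 \<le> w x \<and> w x \<le> B - d n x"
      and J: "real J * (e / 2) \<le> ?n (T w)" and S: "S < real J * (e / 2)"
    by blast
  have "0 \<le> w x \<and> w x \<le> B" if "x \<in> space N" for x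
    using w(2)[rule_format, OF that] d_bounds(1)[OF that, of n] by linarith
  from T_bound[OF w(1) this] J S show False by linarith
qed

section \<open>C1 bump functions increasing to indicators of boxes\<close>

definition continuously_differentiable :: "('a::euclidean_space \<Rightarrow> real) \<Rightarrow> bool" where
  "continuously_differentiable f \<longleftrightarrow>
     (\<exists>f'. (\<forall>x. (f has_derivative f' x) (at x)) \<and> (\<forall>v. continuous_on UNIV (\<lambda>x. f' x v)))"

text \<open>Derivatives given by a witness pass through products and compositions by the usual
  rules; here they are matched with \<open>frechet_derivative\<close>.\<close>

lemma continuously_differentiable_imp_Ck_on:
  assumes "continuously_differentiable f"
  shows "Ck_on 1 UNIV f"
proof -
  obtain f' where f': "\<And>x. (f has_derivative f' x) (at x)" "\<And>v. continuous_on UNIV (\<lambda>x. f' x v)"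
    using assms unfolding continuously_differentiable_def by blast
  have "frechet_derivative f (at x) = f' x" for x
    using frechet_derivative_at[OF f'(1)] by simp
  with f' show ?thesis
    unfolding One_nat_def by (auto simp: differentiable_def)
qed

lemma continuously_differentiable_const: "continuously_differentiable (\<lambda>_. c)"
  unfolding continuously_differentiable_def by (intro exI[of _ "\<lambda>_ _. 0"]) auto

lemma continuously_differentiable_mult:
  assumes "continuously_differentiable f" "continuously_differentiable g"
  shows "continuously_differentiable (\<lambda>x. f x * g x)"
proof -
  obtain f' where f': "\<And>x. (f has_derivative f' x) (at x)" "\<And>v. continuous_on UNIV (\<lambda>x. f' x v)"
    using assms unfolding continuously_differentiable_def by blast
  obtain g' where g': "\<And>x. (g has_derivative g' x) (at x)" "\<And>v. continuous_on UNIV (\<lambda>x. g' x v)"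
    using assms unfolding continuously_differentiable_def by blast
  have "continuous_on UNIV f" "continuous_on UNIV g"
    by (auto intro!: continuous_at_imp_continuous_on has_derivative_continuous f'(1) g'(1))
  then have "continuous_on UNIV (\<lambda>x. f x * g' x v + f' x v * g x)" for v
    by (intro continuous_intros f'(2) g'(2))
  with has_derivative_mult[OF f'(1) g'(1)] show ?thesis
    unfolding continuously_differentiable_def
    by (intro exI[of _ "\<lambda>x v. f x * g' x v + f' x v * g x"]) simp
qed

lemma continuously_differentiable_prod:
  assumes "finite I" "\<And>i. i \<in> I \<Longrightarrow> continuously_differentiable (f i)"
  shows "continuously_differentiable (\<lambda>x. \<Prod>i\<in>I. f i x)"
  using assms
  by (induction I) (simp_all add: continuously_differentiable_const continuously_differentiable_mult)

lemma continuously_differentiable_compose: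
  assumes "continuously_differentiable f" "\<And>s. (h has_real_derivative h' s) (at s)" "continuous_on UNIV h'"
  shows "continuously_differentiable (\<lambda>x. h (f x))"
proof -
  obtain f' where f': "\<And>x. (f has_derivative f' x) (at x)" "\<And>v. continuous_on UNIV (\<lambda>x. f' x v)"
    using assms unfolding continuously_differentiable_def by blast
  have "continuous_on UNIV f"
    by (auto intro!: continuous_at_imp_continuous_on has_derivative_continuous f'(1))
  then have "continuous_on UNIV (\<lambda>x. h' (f x))"
    using continuous_on_compose2[OF assms(3)] by blast
  moreover have "((\<lambda>x. h (f x)) has_derivative (\<lambda>v. h' (f x) * f' x v)) (at x)" for x
    using has_derivative_compose[OF f'(1) assms(2)[unfolded has_field_derivative_def]] .
  ultimately show ?thesis
    unfolding continuously_differentiable_def using f'(2)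
    by (intro exI[of _ "\<lambda>x v. h' (f x) * f' x v"]) (auto intro!: continuous_intros)
qed

text \<open>Squaring removes the kink of the positive part: both one-sided derivatives at
  \<open>0\<close> vanish.\<close>

lemma has_real_derivative_positive_part_square:
  "((\<lambda>s. (max 0 s)\<^sup>2) has_real_derivative 2 * max 0 s) (at (s :: real))"
proof (cases s "0 :: real" rule: linorder_cases)
  case less
  have "((\<lambda>_. 0) has_real_derivative 2 * max 0 s) (at s)" using less by (auto intro!: derivative_eq_intros)
  then show ?thesis
  proof (rule has_field_derivative_transform_within_open)
    show "open {..<0 :: real}" "s \<in> {..<0}" using less by auto
  qed auto
next
  case equal
  have "((\<lambda>h. (max 0 h)\<^sup>2 / h) \<longlongrightarrow> 0) (at (0::real))"
  proof (rule Lim_null_comparison)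
    show "\<forall>\<^sub>F h in at 0. norm ((max 0 h)\<^sup>2 / h) \<le> \<bar>h :: real\<bar>"
      by (intro always_eventually allI) (auto simp: max_def power2_eq_square)
    show "((\<lambda>h :: real. \<bar>h\<bar>) \<longlongrightarrow> 0) (at 0)"
      by (rule tendsto_eq_intros refl | simp)+
  qed
  then show ?thesis using equal by (simp add: has_field_derivative_iff)
next
  case greater
  have "((\<lambda>s. s\<^sup>2) has_real_derivative 2 * max 0 s) (at s)" using greater by (auto intro!: derivative_eq_intros)
  then show ?thesis
  proof (rule has_field_derivative_transform_within_open)
    show "open {0 :: real<..}" "s \<in> {0<..}" using greater by auto
  qed auto
qed

text \<open>A C1 function that is positive exactly on the open box \<open>box a b\<close>: the
  squared positive parts vanish to second order at the faces.\<close>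

definition box_weight :: "'a::euclidean_space \<Rightarrow> 'a \<Rightarrow> 'a \<Rightarrow> real" where
  "box_weight a b x = (\<Prod>i\<in>Basis. (max 0 (x \<bullet> i - a \<bullet> i))\<^sup>2 * (max 0 (b \<bullet> i - x \<bullet> i))\<^sup>2)"

text \<open>Saturation of \<open>box_weight\<close>: increasing in \<open>n\<close> to the indicator
  of the box, with values in the unit interval, C1 for each \<open>n\<close> and zero outside the
  box.\<close>

definition box_bump :: "'a::euclidean_space \<Rightarrow> 'a \<Rightarrow> nat \<Rightarrow> 'a \<Rightarrow> real" where
  "box_bump a b n x = 1 - exp (- (real n * box_weight a b x))"

lemma continuously_differentiable_box_bump: "continuously_differentiable (box_bump a b n)"
proof -
  have lin: "continuously_differentiable (\<lambda>x. x \<bullet> i - a \<bullet> i)" "continuously_differentiable (\<lambda>x. b \<bullet> i - x \<bullet> i)" for i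
    unfolding continuously_differentiable_def
    by (intro exI[of _ "\<lambda>x v. v \<bullet> i"] exI[of _ "\<lambda>x v. - (v \<bullet> i)"]; auto intro!: derivative_eq_intros)+
  note sq = continuously_differentiable_compose[OF _ has_real_derivative_positive_part_square]
  have "continuously_differentiable (box_weight a b)"
    unfolding box_weight_def
    by (intro continuously_differentiable_prod continuously_differentiable_mult sq lin finite_Basis continuous_intros)
  moreover have "((\<lambda>s. 1 - exp (- (real n * s))) has_real_derivative real n * exp (- (real n * s))) (at s)" for s
    by (auto intro!: derivative_eq_intros)
  ultimately show ?thesis
    unfolding box_bump_def
    by (rule continuously_differentiable_compose) (intro continuous_intros)
qed

lemma box_weight_nonneg: "0 \<le> box_weight a b x"
  unfolding box_weight_def by (intro prod_nonneg) auto

lemma box_weight_pos: "x \<in> box a b \<Longrightarrow> 0 < box_weight a b x"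
  unfolding box_weight_def by (intro prod_pos) (auto simp: mem_box)

lemma box_weight_eq_0:
  assumes "x \<notin> box a b"
  shows "box_weight a b x = 0"
proof -
  obtain i where "i \<in> Basis" "x \<bullet> i \<le> a \<bullet> i \<or> b \<bullet> i \<le> x \<bullet> i"
    using assms by (force simp: mem_box)
  then show ?thesis
    unfolding box_weight_def by (intro prod_zero bexI[of _ i]) auto
qed

lemma box_bump_bounds: "0 \<le> box_bump a b n x" "box_bump a b n x \<le> 1"
  using box_weight_nonneg[of a b x] by (auto simp: box_bump_def)

lemma box_bump_mono: "m \<le> n \<Longrightarrow> box_bump a b m x \<le> box_bump a b n x"
  using box_weight_nonneg[of a b x] by (auto simp: box_bump_def intro: mult_right_mono)

lemma box_bump_tendsto: "(\<lambda>n. box_bump a b n x) \<longlonglongrightarrow> indicator (box a b) x"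
proof (cases "x \<in> box a b")
  case True
  have "filterlim (\<lambda>n. box_weight a b x * real n) at_top sequentially"
    by (intro filterlim_tendsto_pos_mult_at_top[OF tendsto_const] box_weight_pos True filterlim_real_sequentially)
  then have "(\<lambda>n. exp (- (box_weight a b x * real n))) \<longlonglongrightarrow> 0"
    by (intro filterlim_compose[OF exp_at_bot] filterlim_compose[OF filterlim_uminus_at_bot_at_top])
  then have "(\<lambda>n. 1 - exp (- (box_weight a b x * real n))) \<longlonglongrightarrow> 1 - 0"
    by (intro tendsto_intros)
  with True show ?thesis by (simp add: box_bump_def mult.commute)
qed (simp add: box_bump_def box_weight_eq_0)

lemma box_bump_in_C1c: "box_bump a b n \<in> C1c M"
proof -
  have "C1_on M (box_bump a b n)"
    using continuously_differentiable_imp_Ck_on[OF continuously_differentiable_box_bump, of a b n]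
    unfolding C1_on_def by blast
  moreover have "{x \<in> M. box_bump a b n x \<noteq> 0} \<subseteq> box a b"
    using box_weight_eq_0[of _ a b] by (auto simp: box_bump_def)
  then have "compact (closure {x \<in> M. box_bump a b n x \<noteq> 0})"
    using bounded_subset[OF bounded_box] by (simp add: compact_closure)
  ultimately show ?thesis by (simp add: C1c_def)
qed

section \<open>Bounded measurable functions and functionals on them\<close>

lemma bounded_measurableE:
  assumes "f \<in> bounded_measurable M"
  obtains B where "f \<in> borel_measurable (borel_on M)" "0 \<le> B" "\<And>x. x \<in> M \<Longrightarrow> \<bar>f x\<bar> \<le> B"
  using assms unfolding bounded_measurable_def bounded_iff
  by (auto intro: that[of "max 0 _"]) (metis abs_ge_zero norm_conv_dist order_trans real_norm_def that)

lemma bounded_measurableI: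
  assumes "f \<in> borel_measurable (borel_on M)" "\<And>x. x \<in> M \<Longrightarrow> \<bar>f x\<bar> \<le> B"
  shows "f \<in> bounded_measurable M"
  using assms unfolding bounded_measurable_def bounded_iff by auto

lemma box_bump_bounded_measurable: "box_bump a b n \<in> bounded_measurable M"
proof (rule bounded_measurableI[where B=1])
  have "box_bump a b n \<in> borel_measurable borel"
    unfolding box_bump_def box_weight_def by measurable
  then show "box_bump a b n \<in> borel_measurable (borel_on M)"
    by (rule measurable_restrict_space1)
qed (use box_bump_bounds[of a b n] in auto)

lemma indicator_bounded_measurable:
  "A \<in> sets borel \<Longrightarrow> (indicator A :: 'a::euclidean_space \<Rightarrow> real) \<in> bounded_measurable M"
  by (intro bounded_measurableI[where B=1] measurable_restrict_space1) (auto simp: indicator_def)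

lemma bounded_measurable_add:
  assumes "f \<in> bounded_measurable M" "g \<in> bounded_measurable M"
  shows "(\<lambda>x. f x + g x) \<in> bounded_measurable M"
proof -
  from bounded_measurableE[OF assms(1)] obtain B where f: "f \<in> borel_measurable (borel_on M)" "\<And>x. x \<in> M \<Longrightarrow> \<bar>f x\<bar> \<le> B" by metis
  from bounded_measurableE[OF assms(2)] obtain C where g: "g \<in> borel_measurable (borel_on M)" "\<And>x. x \<in> M \<Longrightarrow> \<bar>g x\<bar> \<le> C" by metis
  show ?thesis
    using f g by (intro bounded_measurableI[where B="B + C"]) (auto intro: order_trans[OF abs_triangle_ineq] add_mono)
qed

lemma bounded_measurable_scale:
  assumes "f \<in> bounded_measurable M"
  shows "(\<lambda>x. c * f x) \<in> bounded_measurable M"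
proof -
  from bounded_measurableE[OF assms(1)] obtain B where f: "f \<in> borel_measurable (borel_on M)" "\<And>x. x \<in> M \<Longrightarrow> \<bar>f x\<bar> \<le> B" by metis
  show ?thesis
    using f by (intro bounded_measurableI[where B="\<bar>c\<bar> * B"]) (auto simp: abs_mult intro: mult_left_mono)
qed

lemma bounded_measurable_diff:
  assumes "f \<in> bounded_measurable M" "g \<in> bounded_measurable M"
  shows "(\<lambda>x. f x - g x) \<in> bounded_measurable M"
  using bounded_measurable_add[OF assms(1) bounded_measurable_scale[OF assms(2), of "-1"]] by simp

text \<open>A finite signed measure in Daniell form: a linear functional that is continuous along
  bounded sequences decreasing to zero. \<open>cong\<close> records that values outside
  \<open>M\<close> do not matter.\<close>

locale order_continuous_functional =
  fixes M :: "'a::euclidean_space set" and \<Phi> :: "('a \<Rightarrow> real) \<Rightarrow> real"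
  assumes add: "\<lbrakk>f \<in> bounded_measurable M; g \<in> bounded_measurable M\<rbrakk> \<Longrightarrow> \<Phi> (\<lambda>x. f x + g x) = \<Phi> f + \<Phi> g"
    and scale: "f \<in> bounded_measurable M \<Longrightarrow> \<Phi> (\<lambda>x. c * f x) = c * \<Phi> f"
    and cong: "(\<And>x. x \<in> M \<Longrightarrow> f x = g x) \<Longrightarrow> \<Phi> f = \<Phi> g"
    and order_continuous: "\<lbrakk>\<And>n. d n \<in> borel_measurable (borel_on M); \<And>m n x. \<lbrakk>m \<le> n; x \<in> M\<rbrakk> \<Longrightarrow> d n x \<le> d m x;
      \<And>n x. x \<in> M \<Longrightarrow> 0 \<le> d n x; \<And>n x. x \<in> M \<Longrightarrow> d n x \<le> B; \<And>x. x \<in> M \<Longrightarrow> (\<lambda>n. d n x) \<longlonglongrightarrow> 0\<rbrakk> \<Longrightarrow>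
      (\<lambda>n. \<Phi> (d n)) \<longlonglongrightarrow> 0"
begin

lemma diff: "\<lbrakk>f \<in> bounded_measurable M; g \<in> bounded_measurable M\<rbrakk> \<Longrightarrow> \<Phi> (\<lambda>x. f x - g x) = \<Phi> f - \<Phi> g"
  using add[of f "\<lambda>x. (-1) * g x"] scale[of g "-1"] bounded_measurable_scale[of g M "-1"] by simp

lemma zero_fun: "\<Phi> (\<lambda>_. 0) = 0"
  using scale[of "\<lambda>_. 0" 0] bounded_measurableI[of "\<lambda>_. 0" M 0] by simp

text \<open>The differences \<open>u - U n\<close> decrease to zero, and linearity gives each of
  them the value \<open>\<Phi> u\<close>, which order continuity sends to zero.\<close>

lemma increasing_limit:
  assumes U: "\<And>n. U n \<in> bounded_measurable M" "\<And>n. \<Phi> (U n) = 0"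
    and u: "u \<in> bounded_measurable M" and mono: "\<And>m n x. \<lbrakk>m \<le> n; x \<in> M\<rbrakk> \<Longrightarrow> U m x \<le> U n x"
    and lim: "\<And>x. x \<in> M \<Longrightarrow> (\<lambda>n. U n x) \<longlonglongrightarrow> u x"
  shows "\<Phi> u = 0"
proof -
  have U_le: "U n x \<le> u x" if "x \<in> M" for n x
    by (rule incseq_le[OF _ lim[OF that]]) (use mono that in \<open>auto simp: incseq_def\<close>)
  have d: "(\<lambda>x. u x - U n x) \<in> bounded_measurable M" for n
    by (rule bounded_measurable_diff[OF u U(1)])
  from bounded_measurableE[OF d] obtain B where B: "\<And>x. x \<in> M \<Longrightarrow> \<bar>u x - U 0 x\<bar> \<le> B" by metis
  have "(\<lambda>n. \<Phi> (\<lambda>x. u x - U n x)) \<longlonglongrightarrow> 0"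
  proof (rule order_continuous[where B=B])
    show "(\<lambda>x. u x - U n x) \<in> borel_measurable (borel_on M)" for n
      using d by (simp add: bounded_measurable_def)
    show "u x - U n x \<le> B" if "x \<in> M" for n x
      using B[OF that] mono[of 0 n x] that by auto
    show "(\<lambda>n. u x - U n x) \<longlonglongrightarrow> 0" if "x \<in> M" for x
      using tendsto_diff[OF tendsto_const lim[OF that], of "u x"] by simp
  qed (use mono U_le in auto)
  moreover have "\<Phi> (\<lambda>x. u x - U n x) = \<Phi> u" for n
    using diff[OF u U(1), of n] U(2)[of n] by simp
  ultimately show ?thesis using LIMSEQ_unique[OF tendsto_const] by simp
qed

context
  assumes zero: "\<And>f. f \<in> C1c M \<Longrightarrow> \<Phi> f = 0"
begin

lemma zero_box: "\<Phi> (indicator (box a b)) = 0"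
  by (rule increasing_limit[where U="box_bump a b"])
    (auto intro: box_bump_bounded_measurable zero box_bump_in_C1c indicator_bounded_measurable box_bump_mono box_bump_tendsto)

text \<open>Constants are in general not compactly supported. Cubes exhausting the space supply the
  whole space, from which complements are formed in the Dynkin argument.\<close>

lemma zero_one: "\<Phi> (indicator UNIV) = 0"
proof (rule increasing_limit[where U="\<lambda>n. indicator (box (- (real n *\<^sub>R One)) (real n *\<^sub>R One))"])
  fix x :: 'a
  obtain n0 :: nat where n0: "norm x < real n0" using reals_Archimedean2 by blast
  have "x \<in> box (- (real n *\<^sub>R One)) (real n *\<^sub>R One)" if "n0 \<le> n" for n
  proof -
    have "\<bar>x \<bullet> i\<bar> < real n" if "i \<in> Basis" for i
      using Basis_le_norm[OF that, of x] n0 \<open>n0 \<le> n\<close> by linarith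
    then show ?thesis by (fastforce simp: mem_box abs_less_iff)
  qed
  then have "\<forall>\<^sub>F n in sequentially. indicator (box (- (real n *\<^sub>R One)) (real n *\<^sub>R One)) x = (indicator UNIV x :: real)"
    by (auto simp: eventually_sequentially intro!: exI[of _ n0])
  then show "(\<lambda>n. indicator (box (- (real n *\<^sub>R One)) (real n *\<^sub>R One)) x :: real) \<longlonglongrightarrow> indicator UNIV x"
    by (rule tendsto_eventually)
next
  fix m n :: nat and x :: 'a
  assume "m \<le> n"
  then have "box (- (real m *\<^sub>R One)) (real m *\<^sub>R One) \<subseteq> box (- (real n *\<^sub>R One)) (real n *\<^sub>R One :: 'a)"
    by (force simp: mem_box)
  then show "indicator (box (- (real m *\<^sub>R One)) (real m *\<^sub>R One)) x \<le>
      (indicator (box (- (real n *\<^sub>R One)) (real n *\<^sub>R One)) x :: real)"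
    by (auto simp: indicator_def)
qed (rule zero_box indicator_bounded_measurable borel_open open_box open_UNIV)+

text \<open>Boxes form an intersection-stable generator; disjoint countable unions are reached by
  additivity on finite unions and a further increasing limit.\<close>

lemma zero_indicator:
  assumes "A \<in> sets borel"
  shows "\<Phi> (indicator A) = 0"
proof -
  let ?G = "range (\<lambda>(a, b). box a b :: 'a set)"
  have borel_G: "sets borel = sigma_sets UNIV ?G"
    by (simp add: borel_eq_box)
  have "Int_stable ?G"
    unfolding Int_stable_def by (auto simp: box_Int_box)
  moreover have "?G \<subseteq> Pow UNIV" by simp
  moreover have "A \<in> sigma_sets UNIV ?G" using assms borel_G by simp
  ultimately show ?thesis
  proof (induction rule: sigma_sets_induct_disjoint)
    case (basic A)
    then show ?case using zero_box by auto
  next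
    case empty
    show ?case using zero_fun by simp
  next
    case (compl A)
    then have A: "A \<in> sets borel" using borel_G by simp
    have "\<Phi> (indicator (UNIV - A)) = \<Phi> (\<lambda>x. indicator UNIV x - indicator A x)"
      by (rule cong) (auto simp: indicator_def)
    also have "\<dots> = 0"
      by (subst diff[OF indicator_bounded_measurable indicator_bounded_measurable[OF A]])
        (use compl zero_one in simp_all)
    finally show ?case .
  next
    case (union A)
    then have A: "A i \<in> sets borel" for i using borel_G by auto
    have partial: "\<Phi> (indicator (\<Union>i<n. A i)) = 0" for n
    proof (induction n)
      case 0
      show ?case using zero_fun by simp
    next
      case (Suc n)
      have "\<Phi> (indicator (\<Union>i<Suc n. A i)) = \<Phi> (\<lambda>x. indicator (\<Union>i<n. A i) x + indicator (A n) x)"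
      proof (rule cong)
        fix x
        have "\<not> (x \<in> A i \<and> x \<in> A n)" if "i < n" for i
          using union(1) that unfolding disjoint_family_on_def by (metis UNIV_I disjoint_iff less_irrefl)
        then show "indicator (\<Union>i<Suc n. A i) x = (indicator (\<Union>i<n. A i) x + indicator (A n) x :: real)"
          by (auto simp: indicator_def less_Suc_eq)
      qed
      also have "\<dots> = 0"
        using Suc union(3)[of n] A by (subst add) (auto intro!: indicator_bounded_measurable)
      finally show ?case .
    qed
    show ?case
    proof (rule increasing_limit[where U="\<lambda>n. indicator (\<Union>i<n. A i)"])
      fix x :: 'a
      show "(\<lambda>n. indicator (\<Union>i<n. A i) x :: real) \<longlonglongrightarrow> indicator (\<Union>i. A i) x"
        by (rule LIMSEQ_indicator_UN)
      show "(indicator (\<Union>i. A i) :: 'a \<Rightarrow> real) \<in> bounded_measurable M"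
        "(indicator (\<Union>i<n. A i) :: 'a \<Rightarrow> real) \<in> bounded_measurable M" for n
        using A by (intro indicator_bounded_measurable sets.countable_UN sets.finite_UN; auto)+
    qed (use partial in \<open>auto simp: indicator_def\<close>)
  qed
qed

theorem zero_bounded_measurable:
  assumes f: "f \<in> bounded_measurable M"
  shows "\<Phi> f = 0"
proof -
  \<comment> \<open>Boundedness is a premise inside the induction because it descends: nonnegative
    summands and increasing approximants are bounded on \<open>M\<close> by whatever bounds their
    sum or limit.\<close>
  have nonneg: "u \<in> bounded_measurable M \<longrightarrow> \<Phi> u = 0"
    if "u \<in> borel_measurable (borel_on M)" "\<And>x. 0 \<le> u x" for u
    using that
  proof (induction rule: borel_measurable_induct_real)
    case (set A)
    then obtain A' where A': "A' \<in> sets borel" "A = A' \<inter> M"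
      by (auto simp: sets_restrict_space)
    then have "\<Phi> (indicator A) = \<Phi> (indicator A')"
      by (intro cong) (auto simp: indicator_def)
    then show ?case using zero_indicator[OF A'(1)] by simp
  next
    case (mult u c)
    show ?case
    proof (cases "c = 0")
      case True
      then show ?thesis using zero_fun by simp
    next
      case False
      have "u \<in> bounded_measurable M" if "(\<lambda>x. c * u x) \<in> bounded_measurable M"
        using bounded_measurable_scale[OF that, of "1 / c"] False by simp
      with mult show ?thesis by (auto simp: scale)
    qed
  next
    case (add u v)
    show ?case
    proof
      assume uv: "(\<lambda>x. v x + u x) \<in> bounded_measurable M"
      from bounded_measurableE[OF uv] obtain B where B: "\<And>x. x \<in> M \<Longrightarrow> \<bar>v x + u x\<bar> \<le> B" by metis
      have "\<bar>u x\<bar> \<le> B" "\<bar>v x\<bar> \<le> B" if "x \<in> M" for x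
        using B[OF that] add(2)[of x] add(4)[of x] by linarith+
      then have "u \<in> bounded_measurable M" "v \<in> bounded_measurable M"
        using add(1,3) by (auto intro: bounded_measurableI)
      with add show "\<Phi> (\<lambda>x. v x + u x) = 0"
        using order_continuous_functional.add[OF order_continuous_functional_axioms] by simp
    qed
  next
    case (seq U)
    show ?case
    proof
      assume u: "u \<in> bounded_measurable M"
      from bounded_measurableE[OF u] obtain B where B: "\<And>x. x \<in> M \<Longrightarrow> \<bar>u x\<bar> \<le> B" by metis
      have lim: "(\<lambda>n. U n x) \<longlonglongrightarrow> u x" if "x \<in> M" for x
        using seq that by (simp add: space_restrict_space)
      have mono: "U m x \<le> U n x" if "m \<le> n" for m n x
        using seq(3) that by (auto simp: incseq_def le_fun_def)
      have "U n x \<le> u x" if "x \<in> M" for n x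
        by (rule incseq_le[OF _ lim[OF that]]) (use mono in \<open>auto simp: incseq_def\<close>)
      then have "\<bar>U n x\<bar> \<le> B" if "x \<in> M" for n x
        using B[OF that] seq(2)[of n x] that by (smt (verit))
      then have U: "U n \<in> bounded_measurable M" for n
        using seq(1) by (auto intro: bounded_measurableI)
      show "\<Phi> u = 0"
        by (rule increasing_limit[OF U _ u mono lim]) (use seq U in auto)
    qed
  qed
  obtain B where B: "f \<in> borel_measurable (borel_on M)" "\<And>x. x \<in> M \<Longrightarrow> \<bar>f x\<bar> \<le> B"
    using bounded_measurableE[OF f] by metis
  have "\<Phi> (\<lambda>x. max 0 (f x)) = 0" "\<Phi> (\<lambda>x. max 0 (- f x)) = 0"
    and pm: "(\<lambda>x. max 0 (f x)) \<in> bounded_measurable M" "(\<lambda>x. max 0 (- f x)) \<in> bounded_measurable M"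
  proof -
    show pm: "(\<lambda>x. max 0 (f x)) \<in> bounded_measurable M" "(\<lambda>x. max 0 (- f x)) \<in> bounded_measurable M"
      by (rule bounded_measurableI[where B=B]; use B in \<open>force simp: max_def\<close>)+
    show "\<Phi> (\<lambda>x. max 0 (f x)) = 0" "\<Phi> (\<lambda>x. max 0 (- f x)) = 0"
      using nonneg pm by (auto simp: bounded_measurable_def)
  qed
  moreover have "\<Phi> f = \<Phi> (\<lambda>x. max 0 (f x) - max 0 (- f x))"
    by (rule cong) (auto simp: max_def)
  ultimately show ?thesis by (simp add: diff)
qed

end

end

section \<open>Two processes with the same flow\<close>

lemma measurable_kernel_subprob:
  assumes "K \<in> N \<rightarrow>\<^sub>M prob_algebra N" "sets \<mu> = sets N"
  shows "K \<in> \<mu> \<rightarrow>\<^sub>M subprob_algebra N"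
  using measurable_prob_algebraD[OF assms(1)] measurable_cong_sets[OF assms(2) refl] by blast

lemma integral_bind_kernel:
  fixes f :: "'a \<Rightarrow> real"
  assumes K: "K \<in> N \<rightarrow>\<^sub>M prob_algebra N" and \<mu>: "prob_space \<mu>" "sets \<mu> = sets N"
    and f: "f \<in> borel_measurable N" "\<And>y. y \<in> space N \<Longrightarrow> \<bar>f y\<bar> \<le> B"
  shows "(\<integral>y. f y \<partial>(\<mu> \<bind> K)) = (\<integral>x. act K f x \<partial>\<mu>)"
proof -
  interpret prob_space \<mu> by fact
  have s: "space \<mu> = space N" using \<mu>(2) by (rule sets_eq_imp_space_eq)
  show ?thesis
    unfolding act_def
  proof (rule integral_bind[where K=N and B=B and B'=1])
    show "K \<in> \<mu> \<rightarrow>\<^sub>M subprob_algebra N" by (rule measurable_kernel_subprob[OF K \<mu>(2)])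
    show "AE x in \<mu>. emeasure (K x) (space (K x)) \<le> ennreal 1"
      using prob_space.emeasure_space_1[OF prob_algebra_kernelD(1)[OF K]] s by (intro AE_I2) auto
  qed (use f finite_measure_axioms in auto)
qed

lemma prob_space_integral_abs_le:
  fixes f :: "'a \<Rightarrow> real"
  assumes "prob_space \<mu>" "f \<in> borel_measurable \<mu>" "\<And>x. x \<in> space \<mu> \<Longrightarrow> \<bar>f x\<bar> \<le> B"
  shows "\<bar>\<integral>x. f x \<partial>\<mu>\<bar> \<le> B"
proof -
  interpret prob_space \<mu> by fact
  have i: "integrable \<mu> f" by (rule integrable_bounded[OF assms(2,3)])
  have "\<bar>\<integral>x. f x \<partial>\<mu>\<bar> \<le> (\<integral>x. \<bar>f x\<bar> \<partial>\<mu>)" by (rule integral_abs_bound)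
  also have "\<dots> \<le> (\<integral>x. B \<partial>\<mu>)" using i assms(3) by (intro integral_mono) auto
  finally show ?thesis by (simp add: prob_space)
qed

context pdmp_construction
begin

text \<open>Averaging the invariance identity over times in the unit interval and exchanging the
  integrals turns \<open>emeasure \<mu> A\<close> into the mean occupation time of \<open>A\<close>,
  which is zero from every starting point.\<close>

lemma invariant_null:
  assumes \<mu>: "prob_space \<mu>" "sets \<mu> = sets N" and inv: "\<And>t. 0 \<le> t \<Longrightarrow> \<mu> \<bind> trans t = \<mu>"
    and A [measurable]: "A \<in> sets N"
    and null: "\<And>x. x \<in> space N \<Longrightarrow> AE s in lborel. 0 \<le> s \<longrightarrow> \<phi> s x \<notin> A"
  shows "emeasure \<mu> A = 0"
proof -
  interpret prob_space \<mu> by fact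
  interpret muL: pair_sigma_finite \<mu> "lborel :: real measure" ..
  have s: "space \<mu> = space N" using \<mu>(2) by (rule sets_eq_imp_space_eq)
  have eq: "emeasure \<mu> A = (\<integral>\<^sup>+x. emeasure (trans t x) A \<partial>\<mu>)" if "0 \<le> t" for t
    using emeasure_bind[OF not_empty measurable_kernel_subprob[OF trans_kernel \<mu>(2)] A, of t] inv[OF that] by simp
  have "(\<integral>\<^sup>+t. indicator {0..1 :: real} t * emeasure \<mu> A \<partial>lborel) =
      (\<integral>\<^sup>+t. indicator {0..1} t * (\<integral>\<^sup>+x. emeasure (trans t x) A \<partial>\<mu>) \<partial>lborel)"
  proof (intro nn_integral_cong)
    fix t :: real
    show "indicator {0..1} t * emeasure \<mu> A = indicator {0..1} t * (\<integral>\<^sup>+x. emeasure (trans t x) A \<partial>\<mu>)"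
      using eq[of t] by (cases "t \<in> {0..1}") auto
  qed
  also have "\<dots> = (\<integral>\<^sup>+t. \<integral>\<^sup>+x. indicator {0..1} t * emeasure (trans t x) A \<partial>\<mu> \<partial>lborel)"
    by (intro nn_integral_cong) (auto simp: indicator_def)
  also have "\<dots> = (\<integral>\<^sup>+x. \<integral>\<^sup>+t. indicator {0..1} t * emeasure (trans t x) A \<partial>lborel \<partial>\<mu>)"
  proof (rule muL.Fubini')
    have E: "emeasure (trans t x) A = (\<integral>\<^sup>+y. indicator A y \<partial>trans t x)" if "x \<in> space N" for t x
      using prob_algebra_kernelD(2)[OF trans_kernel that] by simp
    have "(\<lambda>(x, t). indicator {0..1} t * (\<integral>\<^sup>+y. indicator A y \<partial>trans t x)) \<in> borel_measurable (N \<Otimes>\<^sub>M borel)"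
      by measurable
    also have "(\<lambda>(x, t). indicator {0..1} t * (\<integral>\<^sup>+y. indicator A y \<partial>trans t x)) \<in> borel_measurable (N \<Otimes>\<^sub>M borel) \<longleftrightarrow>
        (\<lambda>(x, t). indicator {0..1} t * emeasure (trans t x) A) \<in> borel_measurable (N \<Otimes>\<^sub>M borel)"
      by (intro measurable_cong) (auto simp: space_pair_measure E)
    also have "borel_measurable (N \<Otimes>\<^sub>M borel) = borel_measurable (\<mu> \<Otimes>\<^sub>M lborel)"
      by (intro measurable_cong_sets sets_pair_measure_cong) (simp_all add: \<mu>)
    finally show "(\<lambda>(x, t). indicator {0..1} t * emeasure (trans t x) A) \<in> borel_measurable (\<mu> \<Otimes>\<^sub>M lborel)" .
  qed
  also have "\<dots> = (\<integral>\<^sup>+x. 0 \<partial>\<mu>)"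
    using occupation_null[OF A null, of _ 1] s by (intro nn_integral_cong) auto
  finally show ?thesis
    by (simp add: nn_integral_multc)
qed

end

locale pdmp_pair =
  A: pdmp_construction N \<phi> r1 Q1 G1 + B: pdmp_construction N \<phi> r2 Q2 G2
  for N :: "'a measure" and \<phi> :: "real \<Rightarrow> 'a \<Rightarrow> 'a" and r1 r2 :: "'a \<Rightarrow> real"
    and Q1 Q2 :: "'a \<Rightarrow> 'a measure" and G1 G2 :: "'a \<Rightarrow> real \<Rightarrow> 'a"
begin

definition defect :: "('a \<Rightarrow> real) \<Rightarrow> 'a \<Rightarrow> real" where
  "defect h x = r1 x * act Q1 h x - r2 x * act Q2 h x + (r2 x - r1 x) * h x"

lemma defect_eq: "defect h x = r1 x * (act Q1 h x - h x) - r2 x * (act Q2 h x - h x)"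
  by (simp add: defect_def algebra_simps)

lemma defect_measurable [measurable]:
  assumes [measurable]: "h \<in> borel_measurable N"
  shows "defect h \<in> borel_measurable N"
  unfolding defect_def by measurable

context
  fixes f :: "'a \<Rightarrow> real" and B :: real and a1 a2 :: "'a \<Rightarrow> real"
  assumes f [measurable]: "f \<in> borel_measurable N" and fB: "\<And>y. y \<in> space N \<Longrightarrow> \<bar>f y\<bar> \<le> B"
    and lim1: "((\<lambda>t. uniform_norm (space N) (\<lambda>x. act (A.trans t) f x - f x)) \<longlongrightarrow> 0) (at_right 0)"
    and lim2: "((\<lambda>t. uniform_norm (space N) (\<lambda>x. act (B.trans t) f x - f x)) \<longlongrightarrow> 0) (at_right 0)"
    and a1: "\<And>y. y \<in> space N \<Longrightarrow> ((\<lambda>h. (act (A.trans h) f y - f y) / h) \<longlongrightarrow> a1 y) (at_right 0)"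
    and a2: "\<And>y. y \<in> space N \<Longrightarrow> ((\<lambda>h. (act (B.trans h) f y - f y) / h) \<longlongrightarrow> a2 y) (at_right 0)"
begin

text \<open>The two expansions contain the same transport term because the flow is common;
  subtracting them leaves only the averaged jump parts.\<close>

lemma defect_average:
  assumes y: "y \<in> space N"
  shows "((\<lambda>h. (LBINT s:{0..h}. defect f (\<phi> s y)) / h) \<longlongrightarrow> a1 y - a2 y) (at_right 0)"
proof -
  let ?I1 = "\<lambda>h. LBINT s:{0..h}. r1 (\<phi> s y) * (act Q1 f (\<phi> s y) - f (\<phi> s y))"
  let ?I2 = "\<lambda>h. LBINT s:{0..h}. r2 (\<phi> s y) * (act Q2 f (\<phi> s y) - f (\<phi> s y))"
  have I: "(LBINT s:{0..h}. defect f (\<phi> s y)) = ?I1 h - ?I2 h" for h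
    unfolding defect_eq
    by (rule set_integral_diff(2)[OF A.set_integrable_jump_part[OF f fB y] B.set_integrable_jump_part[OF f fB y]])
  have "((\<lambda>h. ((act (A.trans h) f y - f y) / h - (act (B.trans h) f y - f y) / h) -
      ((act (A.trans h) f y - f (\<phi> h y) - ?I1 h) / h - (act (B.trans h) f y - f (\<phi> h y) - ?I2 h) / h)) \<longlongrightarrow>
      (a1 y - a2 y) - (0 - 0)) (at_right 0)"
    by (intro tendsto_diff a1 a2 y A.generator_expansion[OF f fB y lim1] B.generator_expansion[OF f fB y lim2])
  moreover have "((act (A.trans h) f y - f y) / h - (act (B.trans h) f y - f y) / h) -
      ((act (A.trans h) f y - f (\<phi> h y) - ?I1 h) / h - (act (B.trans h) f y - f (\<phi> h y) - ?I2 h) / h) =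
      (LBINT s:{0..h}. defect f (\<phi> s y)) / h" for h
    unfolding I by (simp add: diff_divide_distrib)
  ultimately show ?thesis by simp
qed

text \<open>At every point the average of \<open>defect f\<close> over a short initial piece of the
  orbit tends to \<open>a1 - a2\<close>; by Lebesgue differentiation such averages also tend to the
  value of \<open>defect f\<close> at almost every time of an orbit.\<close>

lemma defect_orbit_AE:
  assumes x: "x \<in> space N"
  shows "AE s in lborel. 0 \<le> s \<longrightarrow> defect f (\<phi> s x) = a1 (\<phi> s x) - a2 (\<phi> s x)"
proof -
  let ?k = "\<lambda>s. defect f (\<phi> (max 0 s) x)"
  have k_int: "set_integrable lborel {a..b} ?k" for a b
  proof -
    obtain L1 where L1: "0 \<le> L1" "\<And>s. s \<in> {0..max 0 b} \<Longrightarrow> r1 (\<phi> s x) \<le> L1"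
      using A.rate_bound[OF x] by metis
    obtain L2 where L2: "0 \<le> L2" "\<And>s. s \<in> {0..max 0 b} \<Longrightarrow> r2 (\<phi> s x) \<le> L2"
      using B.rate_bound[OF x] by metis
    show ?thesis
      unfolding set_integrable_def
    proof (rule integrableI_bounded_set_indicator[where B="L1 * (2 * B) + L2 * (2 * B)"])
      show "?k \<in> borel_measurable lborel" using x by measurable
      show "emeasure lborel {a..b} < \<infinity>" by (cases "a \<le> b") auto
      show "AE s in lborel. s \<in> {a..b} \<longrightarrow> norm (?k s) \<le> L1 * (2 * B) + L2 * (2 * B)"
      proof (intro AE_I2 impI)
        fix s assume s: "s \<in> {a..b}"
        let ?y = "\<phi> (max 0 s) x"
        have y: "?y \<in> space N" using x by (intro A.flow_in_space) auto
        have "\<bar>r1 ?y * (act Q1 f ?y - f ?y)\<bar> \<le> L1 * (2 * B)"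
          unfolding abs_mult using L1(1) L1(2)[of "max 0 s"] s A.rate_nonneg[OF y]
            act_abs_le[OF A.kernel_measurable y f fB] fB[OF y]
          by (intro mult_mono) auto
        moreover have "\<bar>r2 ?y * (act Q2 f ?y - f ?y)\<bar> \<le> L2 * (2 * B)"
          unfolding abs_mult using L2(1) L2(2)[of "max 0 s"] s B.rate_nonneg[OF y]
            act_abs_le[OF B.kernel_measurable y f fB] fB[OF y]
          by (intro mult_mono) auto
        ultimately show "norm (?k s) \<le> L1 * (2 * B) + L2 * (2 * B)"
          unfolding defect_eq real_norm_def by linarith
      qed
    qed simp
  qed
  have k_HK: "?k integrable_on {a..b}" "integral {a..b} ?k = (LBINT s:{a..b}. ?k s)" for a b
    using set_borel_integral_eq_integral[OF k_int] by auto
  \<comment> \<open>Lebesgue differentiation over intervals to the right of \<open>s\<close>,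
    matching the one-sided averages of the expansion.\<close>
  obtain Z where Z: "negligible Z"
    "\<And>s e. \<lbrakk>s \<notin> Z; 0 < e\<rbrakk> \<Longrightarrow> \<exists>d>0. \<forall>h. 0 < h \<and> h < d \<longrightarrow>
      norm (integral (cbox s (s + h *\<^sub>R One)) ?k /\<^sub>R h ^ DIM(real) - ?k s) < e"
    by (rule integrable_ccontinuous_explicit[of ?k]) (use k_HK(1) in auto)
  have "AE s in lebesgue. s \<notin> Z"
    using Z(1) by (auto simp: negligible_iff_null_sets intro!: AE_not_in)
  then have "AE s in lborel. s \<notin> Z"
    by (simp only: AE_completion_iff)
  then show ?thesis
  proof eventually_elim
    case (elim s)
    show ?case
    proof
      assume s: "0 \<le> s"
      have y: "\<phi> s x \<in> space N" by (rule A.flow_in_space[OF s x])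
      \<comment> \<open>The orbit of \<open>x\<close> after time \<open>s\<close> is the orbit of
        \<open>\<phi> s x\<close>, so this limit and the one from \<open>defect_average\<close> at
        that point concern the same averages.\<close>
      have "((\<lambda>h. (LBINT u:{0..h}. defect f (\<phi> u (\<phi> s x))) / h) \<longlongrightarrow> ?k s) (at_right 0)"
      proof (rule tendstoI)
        fix e :: real assume "0 < e"
        then obtain d where d: "0 < d" "\<And>h. 0 < h \<Longrightarrow> h < d \<Longrightarrow>
            norm (integral (cbox s (s + h *\<^sub>R One)) ?k /\<^sub>R h ^ DIM(real) - ?k s) < e"
          using Z(2)[OF elim] by blast
        have "\<forall>\<^sub>F h in at_right 0. h \<in> {0<..<d}"
          using d by (intro eventually_at_right_real) auto
        then show "\<forall>\<^sub>F h in at_right 0. dist ((LBINT u:{0..h}. defect f (\<phi> u (\<phi> s x))) / h) (?k s) < e"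
        proof eventually_elim
          case (elim h)
          have "(LBINT u:{0..h}. defect f (\<phi> u (\<phi> s x))) = (LBINT u:{s..s + h}. defect f (\<phi> u x))"
            by (rule A.set_integral_orbit_shift[OF s x])
          also have "\<dots> = (LBINT u:{s..s + h}. ?k u)"
            using s by (intro set_lebesgue_integral_cong) auto
          finally have "integral {s..s + h} ?k = (LBINT u:{0..h}. defect f (\<phi> u (\<phi> s x)))"
            using k_HK(2) by simp
          with d(2)[of h] elim show ?case
            by (simp add: dist_real_def divide_inverse mult.commute)
        qed
      qed
      from tendsto_unique[OF _ this defect_average[OF y]]
      show "defect f (\<phi> s x) = a1 (\<phi> s x) - a2 (\<phi> s x)"
        using s by simp
    qed
  qed
qed

lemma defect_AE:
  assumes \<mu>: "prob_space \<mu>" "sets \<mu> = sets N" and inv: "\<And>t. 0 \<le> t \<Longrightarrow> \<mu> \<bind> B.trans t = \<mu>"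
    and [measurable]: "a1 \<in> borel_measurable N" "a2 \<in> borel_measurable N"
  shows "AE x in \<mu>. defect f x = a1 x - a2 x"
proof -
  let ?A = "{x \<in> space N. defect f x \<noteq> a1 x - a2 x}"
  have s: "space \<mu> = space N" using \<mu>(2) by (rule sets_eq_imp_space_eq)
  have A: "?A \<in> sets N" by measurable
  have "emeasure \<mu> ?A = 0"
  proof (rule B.invariant_null[OF \<mu> inv A])
    fix x assume x: "x \<in> space N"
    show "AE s in lborel. 0 \<le> s \<longrightarrow> \<phi> s x \<notin> ?A"
      using defect_orbit_AE[OF x] by eventually_elim auto
  qed
  then show ?thesis
    using A \<mu> s by (intro AE_I[where N="?A"]) auto
qed

end

text \<open>The left-hand side is \<open>\<mu>2 (A1 g - A2 g)\<close> for the potential \<open>g\<close> of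
  \<open>f\<close>; since \<open>\<mu>2\<close> is invariant for the second semigroup, \<open>\<mu>2 (A2 g) = 0\<close>.\<close>

lemma integral_defect_potential:
  assumes f [measurable]: "f \<in> borel_measurable N" and fB: "\<And>y. y \<in> space N \<Longrightarrow> \<bar>f y\<bar> \<le> B"
    and lim: "((\<lambda>t. uniform_norm (space N) (\<lambda>x. act (A.trans t) f x - f x)) \<longlongrightarrow> 0) (at_right 0)"
    and t: "0 \<le> t"
    and dom0: "((\<lambda>h. uniform_norm (space N) (\<lambda>x. act (B.trans h) (A.potential t f) x - A.potential t f x)) \<longlongrightarrow> 0) (at_right 0)"
    and dom: "((\<lambda>h. uniform_norm (space N)
      (\<lambda>x. (act (B.trans h) (A.potential t f) x - A.potential t f x) / h - g x)) \<longlongrightarrow> 0) (at_right 0)"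
    and \<mu>: "prob_space \<mu>" "sets \<mu> = sets N" and inv: "\<And>t. 0 \<le> t \<Longrightarrow> \<mu> \<bind> B.trans t = \<mu>"
  shows "(\<integral>x. defect (A.potential t f) x \<partial>\<mu>) = (\<integral>x. act (A.trans t) f x - f x \<partial>\<mu>)"
proof -
  interpret prob_space \<mu> by fact
  let ?F = "A.potential t f"
  have s: "space \<mu> = space N" using \<mu>(2) by (rule sets_eq_imp_space_eq)
  have mu_meas: "u \<in> borel_measurable \<mu>" if "u \<in> borel_measurable N" for u :: "'a \<Rightarrow> real"
    using that measurable_cong_sets[OF \<mu>(2) refl] by blast
  have F [measurable]: "?F \<in> borel_measurable N" by (rule A.potential_measurable[OF f fB])
  have F_le: "\<bar>?F y\<bar> \<le> B * t" if "y \<in> space N" for y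
    by (rule A.potential_le[OF f fB that t])
  have g_lim: "((\<lambda>h. (act (B.trans h) ?F y - ?F y) / h) \<longlongrightarrow> g y) (at_right 0)" if "y \<in> space N" for y
  proof (rule tendstoI)
    fix e :: real assume "0 < e"
    then have "\<forall>\<^sub>F h in at_right 0. \<forall>x\<in>space N. \<bar>(act (B.trans h) ?F x - ?F x) / h - g x\<bar> \<le> e / 2"
      by (intro uniform_norm_tendsto_0D[OF dom]) auto
    then show "\<forall>\<^sub>F h in at_right 0. dist ((act (B.trans h) ?F y - ?F y) / h) (g y) < e"
      by eventually_elim (use that \<open>0 < e\<close> in \<open>force simp: dist_real_def\<close>)
  qed
  \<comment> \<open>The strong generator provides \<open>g\<close> as a bare function; its
    measurability comes from the pointwise limit of difference quotients along
    \<open>1 / real (Suc n)\<close>.\<close>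
  have g_meas [measurable]: "g \<in> borel_measurable N"
  proof (rule borel_measurable_LIMSEQ_real)
    show "(\<lambda>y. (act (B.trans (1 / real (Suc n))) ?F y - ?F y) / (1 / real (Suc n))) \<in> borel_measurable N" for n
      by measurable
    have "filterlim (\<lambda>n. 1 / real (Suc n)) (at_right 0) sequentially"
      using LIMSEQ_inverse_real_of_nat
      by (auto simp: filterlim_at inverse_eq_divide simp del: of_nat_Suc)
    then show "(\<lambda>n. (act (B.trans (1 / real (Suc n))) ?F y - ?F y) / (1 / real (Suc n))) \<longlonglongrightarrow> g y"
      if "y \<in> space N" for y
      by (rule filterlim_compose[OF g_lim[OF that]])
  qed
  have d_meas: "(\<lambda>y. (act (B.trans h) ?F y - ?F y) / h) \<in> borel_measurable N" for h
    by measurable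
  have trF: "\<bar>act (B.trans h) ?F y\<bar> \<le> B * t" if "y \<in> space N" for h y
    by (rule act_abs_le[OF B.trans_kernel that F F_le])
  have d_int: "integrable \<mu> (\<lambda>y. (act (B.trans h) ?F y - ?F y) / h)" and
    d_zero: "0 \<le> h \<Longrightarrow> (\<integral>y. (act (B.trans h) ?F y - ?F y) / h \<partial>\<mu>) = 0" for h
  proof -
    have i1: "integrable \<mu> ?F"
      by (rule integrable_bounded[OF mu_meas[OF F], of "B * t"]) (use F_le s in auto)
    have i2: "integrable \<mu> (act (B.trans h) ?F)"
      by (rule integrable_bounded[OF mu_meas, of _ "B * t"]) (use trF s in auto)
    show "integrable \<mu> (\<lambda>y. (act (B.trans h) ?F y - ?F y) / h)"
      using i1 i2 by simp
    assume "0 \<le> h"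
    then have "(\<integral>y. act (B.trans h) ?F y \<partial>\<mu>) = (\<integral>y. ?F y \<partial>\<mu>)"
      using integral_bind_kernel[OF B.trans_kernel \<mu> F F_le, of h] inv[of h] by simp
    then show "(\<integral>y. (act (B.trans h) ?F y - ?F y) / h \<partial>\<mu>) = 0"
      using i1 i2 by simp
  qed
  \<comment> \<open>By the uniform limit, \<open>g\<close> lies within distance \<open>1\<close> of
    a single difference quotient, which is integrable.\<close>
  have g_int: "integrable \<mu> g"
  proof -
    have "\<forall>\<^sub>F h in at_right 0. 0 < h \<and> (\<forall>x\<in>space N. \<bar>(act (B.trans h) ?F x - ?F x) / h - g x\<bar> \<le> 1)"
      by (intro eventually_conj eventually_at_right_less uniform_norm_tendsto_0D[OF dom]) auto
    then obtain h where h: "0 < h" "\<And>x. x \<in> space N \<Longrightarrow> \<bar>(act (B.trans h) ?F x - ?F x) / h - g x\<bar> \<le> 1"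
      using eventually_happens'[OF trivial_limit_at_right_real] by (metis (no_types, lifting))
    have "integrable \<mu> (\<lambda>x. (act (B.trans h) ?F x - ?F x) / h - g x)"
      by (rule integrable_bounded[OF mu_meas, of _ 1]) (use h s in auto)
    from Bochner_Integration.integrable_diff[OF d_int[of h] this] show ?thesis by simp
  qed
  \<comment> \<open>Every difference quotient has mean zero by invariance, and those with small
    \<open>h\<close> are uniformly close to \<open>g\<close>.\<close>
  have "\<bar>\<integral>x. g x \<partial>\<mu>\<bar> \<le> e" if "0 < e" for e
  proof -
    have "\<forall>\<^sub>F h in at_right 0. 0 < h \<and> (\<forall>x\<in>space N. \<bar>(act (B.trans h) ?F x - ?F x) / h - g x\<bar> \<le> e)"
      using that by (intro eventually_conj eventually_at_right_less uniform_norm_tendsto_0D[OF dom]) auto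
    then obtain h where h: "0 < h" "\<And>x. x \<in> space N \<Longrightarrow> \<bar>(act (B.trans h) ?F x - ?F x) / h - g x\<bar> \<le> e"
      using eventually_happens'[OF trivial_limit_at_right_real] by (metis (no_types, lifting))
    have "\<bar>\<integral>x. (act (B.trans h) ?F x - ?F x) / h - g x \<partial>\<mu>\<bar> \<le> e"
      by (rule prob_space_integral_abs_le[OF \<mu>(1) mu_meas]) (use h s in auto)
    then show ?thesis
      using d_zero[of h] h(1) Bochner_Integration.integral_diff[OF d_int[of h] g_int] by simp
  qed
  then have g_zero: "(\<integral>x. g x \<partial>\<mu>) = 0"
    by (metis abs_le_zero_iff field_le_epsilon add.left_neutral)
  let ?a1 = "\<lambda>x. act (A.trans t) f x - f x"
  have a1_meas: "?a1 \<in> borel_measurable N" by measurable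
  have a1_int: "integrable \<mu> ?a1"
  proof (rule integrable_bounded[OF mu_meas[OF a1_meas], of "2 * B"])
    fix x assume "x \<in> space \<mu>"
    then show "\<bar>?a1 x\<bar> \<le> 2 * B"
      using A.act_trans_le[OF f fB, of x t] fB[of x] s by auto
  qed
  have "AE x in \<mu>. defect ?F x = ?a1 x - g x"
  proof (rule defect_AE[OF F F_le _ dom0 _ g_lim \<mu> inv a1_meas g_meas])
    show "((\<lambda>h. uniform_norm (space N) (\<lambda>x. act (A.trans h) ?F x - ?F x)) \<longlongrightarrow> 0) (at_right 0)"
      by (rule A.potential_in_B0[OF f fB t])
    show "((\<lambda>h. (act (A.trans h) ?F y - ?F y) / h) \<longlongrightarrow> ?a1 y) (at_right 0)" if "y \<in> space N" for y
      by (rule A.potential_generator[OF f fB lim that t])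
  qed auto
  then have "(\<integral>x. defect ?F x \<partial>\<mu>) = (\<integral>x. ?a1 x - g x \<partial>\<mu>)"
    by (intro integral_cong_AE mu_meas) auto
  also have "\<dots> = (\<integral>x. ?a1 x \<partial>\<mu>)"
    using a1_int g_int g_zero by simp
  finally show ?thesis .
qed

end

section \<open>Linearity and sequential continuity of potentials and of the defect\<close>

lemma act_add:
  fixes f g :: "'a \<Rightarrow> real"
  assumes K: "K \<in> L \<rightarrow>\<^sub>M prob_algebra N" "x \<in> space L"
    and f: "f \<in> borel_measurable N" "\<And>y. y \<in> space N \<Longrightarrow> \<bar>f y\<bar> \<le> B"
    and g: "g \<in> borel_measurable N" "\<And>y. y \<in> space N \<Longrightarrow> \<bar>g y\<bar> \<le> C"
  shows "act K (\<lambda>y. f y + g y) x = act K f x + act K g x"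
  unfolding act_def
  by (rule Bochner_Integration.integral_add[OF kernel_integrable_bounded[OF K f] kernel_integrable_bounded[OF K g]])

lemma act_scale: "act K (\<lambda>y. c * f y) x = c * act K f x"
  by (simp add: act_def)

lemma act_tendsto_0:
  fixes d :: "nat \<Rightarrow> 'a \<Rightarrow> real"
  assumes K: "K \<in> L \<rightarrow>\<^sub>M prob_algebra N" "x \<in> space L"
    and d: "\<And>n. d n \<in> borel_measurable N" "\<And>n y. y \<in> space N \<Longrightarrow> \<bar>d n y\<bar> \<le> B"
    and lim: "\<And>y. y \<in> space N \<Longrightarrow> (\<lambda>n. d n y) \<longlonglongrightarrow> 0"
  shows "(\<lambda>n. act K (d n) x) \<longlonglongrightarrow> 0"
proof -
  interpret prob_space "K x" by (rule prob_algebra_kernelD[OF K])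
  have "(\<lambda>n. \<integral>y. d n y \<partial>K x) \<longlonglongrightarrow> (\<integral>y. 0 \<partial>K x)"
    by (rule integral_dominated_convergence[where w="\<lambda>_. B"])
      (use d lim prob_algebra_kernelD(3)[OF K] kernel_measurable_function[OF K d(1)] in \<open>auto intro!: AE_I2\<close>)
  then show ?thesis by (simp add: act_def)
qed

context pdmp_construction
begin

lemma potential_add:
  assumes x: "x \<in> space N"
    and f: "f \<in> borel_measurable N" "\<And>y. y \<in> space N \<Longrightarrow> \<bar>f y\<bar> \<le> B"
    and g: "g \<in> borel_measurable N" "\<And>y. y \<in> space N \<Longrightarrow> \<bar>g y\<bar> \<le> C"
  shows "potential t (\<lambda>y. f y + g y) x = potential t f x + potential t g x"
  using set_integral_add(2)[OF set_integrable_act_trans[OF f x order_refl, of t 0] set_integrable_act_trans[OF g x order_refl, of t 0]]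
  by (simp add: potential_def act_add[OF trans_kernel x f g])

lemma potential_scale: "potential t (\<lambda>y. c * f y) x = c * potential t f x"
  by (simp add: potential_def act_scale)

lemma potential_cong:
  assumes "x \<in> space N" "\<And>y. y \<in> space N \<Longrightarrow> f y = g y"
  shows "potential t f x = potential t g x"
  unfolding potential_def using act_cong[OF trans_kernel assms] by simp

lemma potential_tendsto_0:
  fixes d :: "nat \<Rightarrow> 'a \<Rightarrow> real"
  assumes x: "x \<in> space N" and d: "\<And>n. d n \<in> borel_measurable N" "\<And>n y. y \<in> space N \<Longrightarrow> \<bar>d n y\<bar> \<le> B"
    and lim: "\<And>y. y \<in> space N \<Longrightarrow> (\<lambda>n. d n y) \<longlonglongrightarrow> 0"
  shows "(\<lambda>n. potential t (d n) x) \<longlonglongrightarrow> 0"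
proof -
  have "(\<lambda>n. \<integral>s. indicator {0..t} s * act (trans s) (d n) x \<partial>lborel) \<longlonglongrightarrow> (\<integral>s. 0 \<partial>(lborel :: real measure))"
  proof (rule integral_dominated_convergence[where w="\<lambda>s. indicator {0..t} s * B"])
    show "(\<lambda>s. indicator {0..t} s * act (trans s) (d n) x) \<in> borel_measurable lborel" for n
      using x d(1)[of n] by measurable
    show "integrable lborel (\<lambda>s. indicator {0..t} s * B)"
      using borel_integrable_atLeastAtMost'[OF continuous_on_const, of 0 t B] by (simp add: set_integrable_def)
    show "AE s in lborel. (\<lambda>n. indicator {0..t} s * act (trans s) (d n) x) \<longlonglongrightarrow> 0"
      using act_tendsto_0[OF trans_kernel x d lim] by (intro AE_I2 tendsto_mult_right_zero)
    show "AE s in lborel. norm (indicator {0..t} s * act (trans s) (d n) x) \<le> indicator {0..t} s * B" for n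
      using act_trans_le[OF d x] by (intro AE_I2) (simp add: indicator_def)
  qed auto
  then show ?thesis by (simp add: potential_def set_lebesgue_integral_def)
qed

end

context pdmp_pair
begin

lemma defect_add:
  assumes x: "x \<in> space N"
    and f: "f \<in> borel_measurable N" "\<And>y. y \<in> space N \<Longrightarrow> \<bar>f y\<bar> \<le> B"
    and g: "g \<in> borel_measurable N" "\<And>y. y \<in> space N \<Longrightarrow> \<bar>g y\<bar> \<le> C"
  shows "defect (\<lambda>y. f y + g y) x = defect f x + defect g x"
  by (simp add: defect_eq act_add[OF A.kernel_measurable x f g] act_add[OF B.kernel_measurable x f g] algebra_simps)

lemma defect_scale: "defect (\<lambda>y. c * f y) x = c * defect f x"
  by (simp add: defect_eq act_scale algebra_simps)

lemma defect_const: "x \<in> space N \<Longrightarrow> defect (\<lambda>_. c) x = 0"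
  by (simp add: defect_eq act_const[OF A.kernel_measurable] act_const[OF B.kernel_measurable])

lemma defect_cong:
  assumes "x \<in> space N" "\<And>y. y \<in> space N \<Longrightarrow> f y = g y"
  shows "defect f x = defect g x"
  using assms(2)[OF assms(1)] act_cong[OF A.kernel_measurable assms] act_cong[OF B.kernel_measurable assms]
  by (simp add: defect_eq)

lemma defect_tendsto_0:
  fixes d :: "nat \<Rightarrow> 'a \<Rightarrow> real"
  assumes x: "x \<in> space N" and d: "\<And>n. d n \<in> borel_measurable N" "\<And>n y. y \<in> space N \<Longrightarrow> \<bar>d n y\<bar> \<le> B"
    and lim: "\<And>y. y \<in> space N \<Longrightarrow> (\<lambda>n. d n y) \<longlonglongrightarrow> 0"
  shows "(\<lambda>n. defect (d n) x) \<longlonglongrightarrow> 0"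
proof -
  have "(\<lambda>n. defect (d n) x) \<longlonglongrightarrow> r1 x * (0 - 0) - r2 x * (0 - 0)"
    unfolding defect_eq
    by (intro tendsto_intros lim x act_tendsto_0[OF A.kernel_measurable x d lim] act_tendsto_0[OF B.kernel_measurable x d lim])
  then show ?thesis by simp
qed

end

text \<open>The analytic input is reduced to two facts: the identity on C1 functions, and
  \<open>defect_bound\<close>, the homogeneous form of the supremum, here the number
  \<open>S\<close>, on bounded functions. From here on this locale refers to no generator.\<close>

locale pdmp_comparison = pdmp_pair "borel_on M" \<phi> r1 r2 Q1 Q2 G1 G2
  for M :: "'a::euclidean_space set" and \<phi> r1 r2 Q1 Q2 G1 G2 +
  fixes \<mu>1 \<mu>2 :: "'a measure" and V :: "'a \<Rightarrow> real" and C \<rho> S :: real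
  assumes \<mu>1: "prob_space \<mu>1" "sets \<mu>1 = sets (borel_on M)"
    and \<mu>2: "prob_space \<mu>2" "sets \<mu>2 = sets (borel_on M)"
    and V_ge_1: "\<And>x. x \<in> M \<Longrightarrow> 1 \<le> V x"
    and C: "0 < C" and \<rho>: "0 < \<rho>"
    and defect_bound: "\<And>h c. \<lbrakk>h \<in> bounded_measurable M; 0 < c; \<And>x. x \<in> M \<Longrightarrow> \<bar>h x\<bar> \<le> c * V x\<rbrakk> \<Longrightarrow>
      integrable \<mu>2 (defect h) \<and> (\<integral>x. \<bar>defect h x\<bar> \<partial>\<mu>2) \<le> c * S"
    and C1c_identity: "\<And>f t. \<lbrakk>f \<in> C1c M; 0 \<le> t\<rbrakk> \<Longrightarrow>
      (\<integral>x. defect (A.potential t f) x \<partial>\<mu>2) = (\<integral>x. act (A.trans t) f x - f x \<partial>\<mu>2)"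
begin

lemma space_N [simp]: "space (borel_on M) = M"
  by (simp add: space_restrict_space)

lemma space_\<mu>2 [simp]: "space \<mu>2 = M"
  using sets_eq_imp_space_eq[OF \<mu>2(2)] by simp

lemma \<mu>2_measurable:
  fixes u :: "'a \<Rightarrow> real"
  assumes "u \<in> borel_measurable (borel_on M)"
  shows "u \<in> borel_measurable \<mu>2"
  using assms measurable_cong_sets[OF \<mu>2(2) refl] by blast

lemma \<mu>2_integrable: "f \<in> bounded_measurable M \<Longrightarrow> integrable \<mu>2 f"
  by (erule bounded_measurableE) (rule prob_space.integrable_bounded[OF \<mu>2(1) \<mu>2_measurable], auto)

lemma act_trans_bounded_measurable:
  assumes "f \<in> bounded_measurable M"
  shows "act (A.trans t) f \<in> bounded_measurable M"
proof -
  from bounded_measurableE[OF assms] obtain B where f: "f \<in> borel_measurable (borel_on M)" "\<And>x. x \<in> M \<Longrightarrow> \<bar>f x\<bar> \<le> B" by metis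
  show ?thesis
    using A.act_trans_le[OF f(1), of B] A.act_trans_measurable_N[OF f(1), of B] f(2)
    by (intro bounded_measurableI[where B=B]) auto
qed

lemma potential_bounded_measurable:
  assumes "f \<in> bounded_measurable M" "0 \<le> t"
  shows "A.potential t f \<in> bounded_measurable M"
proof -
  from bounded_measurableE[OF assms(1)] obtain B where f: "f \<in> borel_measurable (borel_on M)" "\<And>x. x \<in> M \<Longrightarrow> \<bar>f x\<bar> \<le> B" by metis
  show ?thesis
    using A.potential_le[OF f(1), of B] A.potential_measurable[OF f(1), of B] f(2) assms(2)
    by (intro bounded_measurableI[where B="B * t"]) auto
qed

lemma defect_integrable:
  assumes "h \<in> bounded_measurable M"
  shows "integrable \<mu>2 (defect h)"
proof -
  from bounded_measurableE[OF assms] obtain B where B: "0 \<le> B" "\<And>x. x \<in> M \<Longrightarrow> \<bar>h x\<bar> \<le> B" by metis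
  \<comment> \<open>As \<open>1 \<le> V\<close>, a bounded function is below a multiple of
    \<open>V\<close>; \<open>B + 1\<close> is used because \<open>defect_bound\<close> asks for a
    positive factor.\<close>
  have "\<bar>h x\<bar> \<le> (B + 1) * V x" if "x \<in> M" for x
  proof -
    have "\<bar>h x\<bar> \<le> (B + 1) * 1" using B(2)[OF that] by simp
    also have "\<dots> \<le> (B + 1) * V x" using V_ge_1[OF that] B(1) by (intro mult_left_mono) auto
    finally show ?thesis .
  qed
  with defect_bound[OF assms, of "B + 1"] B(1) show ?thesis by auto
qed

lemma defect_potential_add:
  assumes "f \<in> bounded_measurable M" "g \<in> bounded_measurable M" "0 \<le> t" and x: "x \<in> M"
  shows "defect (A.potential t (\<lambda>y. f y + g y)) x = defect (A.potential t f) x + defect (A.potential t g) x"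
proof -
  from bounded_measurableE[OF assms(1)] obtain B where f: "f \<in> borel_measurable (borel_on M)" "\<And>x. x \<in> space (borel_on M) \<Longrightarrow> \<bar>f x\<bar> \<le> B"
    unfolding space_N by metis
  from bounded_measurableE[OF assms(2)] obtain C where g: "g \<in> borel_measurable (borel_on M)" "\<And>x. x \<in> space (borel_on M) \<Longrightarrow> \<bar>g x\<bar> \<le> C"
    unfolding space_N by metis
  have "defect (A.potential t (\<lambda>y. f y + g y)) x = defect (\<lambda>z. A.potential t f z + A.potential t g z) x"
    using x by (intro defect_cong A.potential_add[OF _ f g]) auto
  also have "\<dots> = defect (A.potential t f) x + defect (A.potential t g) x"
    by (rule defect_add[OF _ A.potential_measurable[OF f] A.potential_le[OF f] A.potential_measurable[OF g] A.potential_le[OF g]])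
      (use x assms(3) in auto)
  finally show ?thesis .
qed

lemma defect_potential_scale: "defect (A.potential t (\<lambda>y. c * f y)) x = c * defect (A.potential t f) x"
  by (simp add: A.potential_scale[abs_def] defect_scale)

text \<open>Order continuity of the defect side is the point, since its integrand has no majorant.
  Functions with values in \<open>{0..B}\<close> have potentials bounded by \<open>B * t\<close>,
  hence by \<open>(B * t + 1) * V\<close>, so their images have \<open>L1\<close> norm at most
  \<open>(B * t + 1) * S\<close>, and the gliding hump applies.\<close>

lemma identity_functional:
  assumes t: "0 \<le> t"
  shows "order_continuous_functional M (\<lambda>f. (\<integral>x. defect (A.potential t f) x \<partial>\<mu>2) - (\<integral>x. act (A.trans t) f x - f x \<partial>\<mu>2))"
    (is "order_continuous_functional M ?\<Phi>")
proof
  fix f g :: "'a \<Rightarrow> real"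
  assume fg: "f \<in> bounded_measurable M" "g \<in> bounded_measurable M"
  note i = defect_integrable[OF potential_bounded_measurable[OF fg(1) t]]
    defect_integrable[OF potential_bounded_measurable[OF fg(2) t]]
    \<mu>2_integrable[OF fg(1)] \<mu>2_integrable[OF fg(2)]
    \<mu>2_integrable[OF act_trans_bounded_measurable[OF fg(1), of t]]
    \<mu>2_integrable[OF act_trans_bounded_measurable[OF fg(2), of t]]
  have 1: "(\<integral>x. defect (A.potential t (\<lambda>x. f x + g x)) x \<partial>\<mu>2) =
      (\<integral>x. defect (A.potential t f) x + defect (A.potential t g) x \<partial>\<mu>2)"
    by (intro Bochner_Integration.integral_cong refl defect_potential_add fg t) simp
  have "act (A.trans t) (\<lambda>x. f x + g x) x = act (A.trans t) f x + act (A.trans t) g x" if "x \<in> M" for x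
  proof -
    from bounded_measurableE[OF fg(1)] obtain B where f: "f \<in> borel_measurable (borel_on M)" "\<And>x. x \<in> space (borel_on M) \<Longrightarrow> \<bar>f x\<bar> \<le> B"
      unfolding space_N by metis
    from bounded_measurableE[OF fg(2)] obtain C where g: "g \<in> borel_measurable (borel_on M)" "\<And>x. x \<in> space (borel_on M) \<Longrightarrow> \<bar>g x\<bar> \<le> C"
      unfolding space_N by metis
    show ?thesis by (rule act_add[OF A.trans_kernel _ f g]) (use that in simp)
  qed
  then have 2: "(\<integral>x. act (A.trans t) (\<lambda>x. f x + g x) x - (f x + g x) \<partial>\<mu>2) =
      (\<integral>x. (act (A.trans t) f x - f x) + (act (A.trans t) g x - g x) \<partial>\<mu>2)"
    by (intro Bochner_Integration.integral_cong refl) simp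
  show "?\<Phi> (\<lambda>x. f x + g x) = ?\<Phi> f + ?\<Phi> g"
    unfolding 1 2 using i by simp
next
  fix f :: "'a \<Rightarrow> real" and c :: real
  have "(\<integral>x. c * act (A.trans t) f x - c * f x \<partial>\<mu>2) = c * (\<integral>x. act (A.trans t) f x - f x \<partial>\<mu>2)"
    unfolding right_diff_distrib[symmetric] by simp
  then show "?\<Phi> (\<lambda>x. c * f x) = c * ?\<Phi> f"
    by (simp add: defect_potential_scale act_scale right_diff_distrib)
next
  fix f g :: "'a \<Rightarrow> real"
  assume eq: "\<And>x. x \<in> M \<Longrightarrow> f x = g x"
  have "(\<integral>x. defect (A.potential t f) x \<partial>\<mu>2) = (\<integral>x. defect (A.potential t g) x \<partial>\<mu>2)"
    by (intro Bochner_Integration.integral_cong refl defect_cong A.potential_cong) (simp_all add: eq)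
  moreover have "act (A.trans t) f x - f x = act (A.trans t) g x - g x" if "x \<in> M" for x
    using act_cong[OF A.trans_kernel, of x f g t] that eq by simp
  then have "(\<integral>x. act (A.trans t) f x - f x \<partial>\<mu>2) = (\<integral>x. act (A.trans t) g x - g x \<partial>\<mu>2)"
    by (intro Bochner_Integration.integral_cong refl) simp
  ultimately show "?\<Phi> f = ?\<Phi> g" by simp
next
  fix d :: "nat \<Rightarrow> 'a \<Rightarrow> real" and B :: real
  assume d [measurable]: "\<And>n. d n \<in> borel_measurable (borel_on M)" and decr: "\<And>m n x. \<lbrakk>m \<le> n; x \<in> M\<rbrakk> \<Longrightarrow> d n x \<le> d m x"
    and d_bounds: "\<And>n x. x \<in> M \<Longrightarrow> 0 \<le> d n x" "\<And>n x. x \<in> M \<Longrightarrow> d n x \<le> B"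
    and lim: "\<And>x. x \<in> M \<Longrightarrow> (\<lambda>n. d n x) \<longlonglongrightarrow> 0"
  have d_abs: "\<bar>d n x\<bar> \<le> B" if "x \<in> space (borel_on M)" for n x
    using d_bounds[of x n] that by simp
  have d_bm: "d n \<in> bounded_measurable M" for n
    using d d_abs by (intro bounded_measurableI[where B=B]) auto
  have "(\<lambda>n. \<integral>x. \<bar>defect (A.potential t (d n)) x\<bar> \<partial>\<mu>2) \<longlonglongrightarrow> 0"
  proof (rule bounded_operator_order_continuous[where T="\<lambda>f. defect (A.potential t f)" and N="borel_on M" and B=B
        and S="(B * t + 1) * S"])
    fix w :: "'a \<Rightarrow> real"
    assume w: "w \<in> borel_measurable (borel_on M)" "\<And>x. x \<in> space (borel_on M) \<Longrightarrow> 0 \<le> w x \<and> w x \<le> B"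
    then have w_abs: "\<bar>w x\<bar> \<le> B" if "x \<in> space (borel_on M)" for x
      using that by fastforce
    then have w_bm: "w \<in> bounded_measurable M"
      using w(1) by (intro bounded_measurableI[where B=B]) auto
    show "integrable \<mu>2 (defect (A.potential t w)) \<and> (\<integral>x. \<bar>defect (A.potential t w) x\<bar> \<partial>\<mu>2) \<le> (B * t + 1) * S"
    proof (cases "M = {}")
      case True
      with prob_space.not_empty[OF \<mu>2(1)] show ?thesis by simp
    next
      case False
      then have B0: "0 \<le> B" using w(2) by fastforce
      show ?thesis
      proof (rule defect_bound[OF potential_bounded_measurable[OF w_bm t]])
        show "0 < B * t + 1" using B0 t by (simp add: add_nonneg_pos)
        fix x assume x: "x \<in> M"
        have "\<bar>A.potential t w x\<bar> \<le> (B * t + 1) * 1"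
          using A.potential_le[OF w(1) w_abs _ t, of x] x by simp
        also have "\<dots> \<le> (B * t + 1) * V x"
          using V_ge_1[OF x] B0 t by (intro mult_left_mono) auto
        finally show "\<bar>A.potential t w x\<bar> \<le> (B * t + 1) * V x" .
      qed
    qed
    fix m k x assume x: "x \<in> space \<mu>2"
    have "defect (A.potential t (\<lambda>y. w y + (d m y + (-1) * d k y))) x =
        defect (A.potential t w) x + (defect (A.potential t (d m)) x + defect (A.potential t (\<lambda>y. (-1) * d k y)) x)"
      using x by (simp only: defect_potential_add[OF w_bm bounded_measurable_add[OF d_bm bounded_measurable_scale[OF d_bm]] t]
          defect_potential_add[OF d_bm bounded_measurable_scale[OF d_bm] t] space_\<mu>2)
    then show "defect (A.potential t (\<lambda>y. w y + (d m y - d k y))) x =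
        defect (A.potential t w) x + (defect (A.potential t (d m)) x - defect (A.potential t (d k)) x)"
      unfolding defect_potential_scale by simp
  next
    show "AE x in \<mu>2. (\<lambda>n. defect (A.potential t (d n)) x) \<longlonglongrightarrow> 0"
    proof (rule AE_I2)
      fix x assume x: "x \<in> space \<mu>2"
      show "(\<lambda>n. defect (A.potential t (d n)) x) \<longlonglongrightarrow> 0"
        by (rule defect_tendsto_0[where B="B * t"])
          (use x lim in \<open>auto intro!: A.potential_measurable[OF d d_abs] A.potential_le[OF d d_abs _ t] A.potential_tendsto_0[OF _ d d_abs]\<close>)
    qed
  qed (use decr d_bounds in auto)
  then have 1: "(\<lambda>n. \<integral>x. defect (A.potential t (d n)) x \<partial>\<mu>2) \<longlonglongrightarrow> 0"
    by (rule Lim_null_comparison[rotated]) (simp add: integral_abs_bound)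
  interpret prob_space \<mu>2 by (rule \<mu>2)
  \<comment> \<open>The semigroup side has the constant majorant \<open>2 * B\<close>, so ordinary
    dominated convergence suffices.\<close>
  have "(\<lambda>n. \<integral>x. act (A.trans t) (d n) x - d n x \<partial>\<mu>2) \<longlonglongrightarrow> (\<integral>x. 0 \<partial>\<mu>2)"
  proof (rule integral_dominated_convergence[where w="\<lambda>_. 2 * B"])
    show "(\<lambda>x. act (A.trans t) (d n) x - d n x) \<in> borel_measurable \<mu>2" for n
      by (rule \<mu>2_measurable) measurable
    show "AE x in \<mu>2. norm (act (A.trans t) (d n) x - d n x) \<le> 2 * B" for n
    proof (rule AE_I2)
      fix x assume "x \<in> space \<mu>2"
      then show "norm (act (A.trans t) (d n) x - d n x) \<le> 2 * B"
        using A.act_trans_le[OF d[of n] d_abs[of _ n], of x t] d_abs[of x n] by simp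
    qed
    show "AE x in \<mu>2. (\<lambda>n. act (A.trans t) (d n) x - d n x) \<longlonglongrightarrow> 0"
    proof (rule AE_I2)
      fix x assume x: "x \<in> space \<mu>2"
      have "(\<lambda>n. act (A.trans t) (d n) x - d n x) \<longlonglongrightarrow> 0 - 0"
        using x lim by (intro tendsto_diff act_tendsto_0[OF A.trans_kernel _ d d_abs]) auto
      then show "(\<lambda>n. act (A.trans t) (d n) x - d n x) \<longlonglongrightarrow> 0" by simp
    qed
  qed auto
  then have "(\<lambda>n. \<integral>x. act (A.trans t) (d n) x - d n x \<partial>\<mu>2) \<longlonglongrightarrow> 0" by simp
  from tendsto_diff[OF 1 this] show "(\<lambda>n. ?\<Phi> (d n)) \<longlonglongrightarrow> 0" by simp
qed

lemma bounded_identity: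
  assumes "f \<in> bounded_measurable M" "0 \<le> t"
  shows "(\<integral>x. defect (A.potential t f) x \<partial>\<mu>2) = (\<integral>x. act (A.trans t) f x - f x \<partial>\<mu>2)"
  using order_continuous_functional.zero_bounded_measurable[OF identity_functional[OF assms(2)] _ assms(1)]
    C1c_identity assms(2) by simp

section \<open>Estimates for one bounded test function\<close>

lemma integral_exp_le:
  assumes "0 \<le> t"
  shows "(LBINT s:{0..t}. C * exp (- \<rho> * s)) \<le> C / \<rho>"
proof -
  have "(\<integral>s. (C * exp (- \<rho> * s)) * indicator {0..t} s \<partial>lborel) = - (C / \<rho>) * exp (- \<rho> * t) - (- (C / \<rho>) * exp (- \<rho> * 0))"
    using \<rho> by (intro integral_FTC_Icc_real assms) (auto intro!: derivative_eq_intros continuous_intros)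
  also have "\<dots> \<le> C / \<rho>" using C \<rho> by simp
  also have "(\<integral>s. (C * exp (- \<rho> * s)) * indicator {0..t} s \<partial>lborel) = (LBINT s:{0..t}. C * exp (- \<rho> * s))"
    unfolding set_lebesgue_integral_def by (intro Bochner_Integration.integral_cong refl) simp
  finally show ?thesis .
qed

context
  fixes f :: "'a \<Rightarrow> real"
  assumes f: "f \<in> bounded_measurable M"
    and ergodic: "\<And>x s. \<lbrakk>x \<in> M; 0 \<le> s\<rbrakk> \<Longrightarrow> \<bar>(\<integral>y. f y \<partial>\<mu>1) - act (A.trans s) f x\<bar> \<le> C * exp (- \<rho> * s) * V x"
begin

text \<open>The hypothesis \<open>ergodic\<close> is geometric ergodicity for the Dirac law at
  \<open>x\<close>; its right-hand side is integrable over all times, so the bound is uniform in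
  \<open>t\<close>.\<close>

lemma centred_potential_le:
  assumes x: "x \<in> M" and t: "0 \<le> t"
  shows "\<bar>A.potential t f x - t * (\<integral>y. f y \<partial>\<mu>1)\<bar> \<le> C / \<rho> * V x"
proof -
  from bounded_measurableE[OF f] obtain B where fB: "f \<in> borel_measurable (borel_on M)" "\<And>x. x \<in> space (borel_on M) \<Longrightarrow> \<bar>f x\<bar> \<le> B"
    unfolding space_N by metis
  let ?m = "\<integral>y. f y \<partial>\<mu>1"
  have i: "set_integrable lborel {0..t} (\<lambda>s. act (A.trans s) f x)"
    using A.set_integrable_act_trans[OF fB _ order_refl, of x t 0] x by simp
  have c: "set_integrable lborel {0..t} (\<lambda>_. ?m)"
    by (rule borel_integrable_atLeastAtMost'[OF continuous_on_const])
  have e: "set_integrable lborel {0..t} (\<lambda>s. C * exp (- \<rho> * s) * V x)"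
    by (rule borel_integrable_atLeastAtMost') (intro continuous_intros)
  have eq: "A.potential t f x - t * ?m = (LBINT s:{0..t}. act (A.trans s) f x - ?m)"
    using t by (simp add: set_integral_diff(2)[OF i c] A.potential_def set_integral_const)
  have "\<bar>LBINT s:{0..t}. act (A.trans s) f x - ?m\<bar> \<le> (LBINT s:{0..t}. C * exp (- \<rho> * s) * V x)"
  proof -
    have "(LBINT s:{0..t}. act (A.trans s) f x - ?m) \<le> (LBINT s:{0..t}. C * exp (- \<rho> * s) * V x)"
      using ergodic[OF x] by (intro set_integral_mono set_integral_diff(1) i c e) (auto simp: abs_le_iff)
    moreover have "(LBINT s:{0..t}. ?m - act (A.trans s) f x) \<le> (LBINT s:{0..t}. C * exp (- \<rho> * s) * V x)"
      using ergodic[OF x] by (intro set_integral_mono set_integral_diff(1) i c e) (auto simp: abs_le_iff)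
    moreover have "(LBINT s:{0..t}. ?m - act (A.trans s) f x) = - (LBINT s:{0..t}. act (A.trans s) f x - ?m)"
      by (simp add: set_integral_diff(2)[OF i c] set_integral_diff(2)[OF c i])
    ultimately show ?thesis by (simp add: abs_le_iff)
  qed
  also have "\<dots> = (LBINT s:{0..t}. C * exp (- \<rho> * s)) * V x" by simp
  also have "\<dots> \<le> C / \<rho> * V x"
    using integral_exp_le[OF t] V_ge_1[OF x] by (intro mult_right_mono) auto
  finally show ?thesis unfolding eq .
qed

lemma abs_integral_increment_le:
  assumes t: "0 \<le> t"
  shows "\<bar>\<integral>x. act (A.trans t) f x - f x \<partial>\<mu>2\<bar> \<le> C / \<rho> * S"
proof -
  let ?m = "\<integral>y. f y \<partial>\<mu>1"
  let ?h = "\<lambda>x. A.potential t f x + - (t * ?m)"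
  from bounded_measurableE[OF f] obtain B where fB: "f \<in> borel_measurable (borel_on M)" "\<And>x. x \<in> space (borel_on M) \<Longrightarrow> \<bar>f x\<bar> \<le> B"
    unfolding space_N by metis
  have h: "?h \<in> bounded_measurable M"
    by (intro bounded_measurable_add potential_bounded_measurable f t bounded_measurableI[where B="\<bar>t * ?m\<bar>"]) auto
  have dh: "defect ?h x = defect (A.potential t f) x" if "x \<in> M" for x
  proof -
    have "defect ?h x = defect (A.potential t f) x + defect (\<lambda>_. - (t * ?m)) x"
      by (rule defect_add[OF _ A.potential_measurable[OF fB] A.potential_le[OF fB _ t], where C="\<bar>t * ?m\<bar>"])
        (use that in auto)
    then show ?thesis using defect_const[of x "- (t * ?m)"] that by simp
  qed
  have "\<bar>\<integral>x. act (A.trans t) f x - f x \<partial>\<mu>2\<bar> = \<bar>\<integral>x. defect ?h x \<partial>\<mu>2\<bar>"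
    unfolding bounded_identity[OF f t, symmetric]
    by (intro arg_cong[where f=abs] Bochner_Integration.integral_cong refl) (simp only: dh space_\<mu>2)
  also have "\<dots> \<le> (\<integral>x. \<bar>defect ?h x\<bar> \<partial>\<mu>2)" by (rule integral_abs_bound)
  also have "\<dots> \<le> C / \<rho> * S"
    using defect_bound[OF h, of "C / \<rho>"] centred_potential_le[OF _ t] C \<rho> by auto
  finally show ?thesis .
qed

text \<open>Ergodicity enters a second time, now for the initial law \<open>\<mu>2\<close>: the
  \<open>\<mu>2\<close>-mean of \<open>act (A.trans t) f\<close> tends to the
  \<open>\<mu>1\<close>-mean of \<open>f\<close>, while the increment bound does not depend on
  \<open>t\<close>. The constant \<open>I\<close> will be the \<open>\<mu>2\<close>-integral of
  \<open>V\<close>.\<close>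

lemma bounded_difference_le:
  assumes "\<And>t. 0 \<le> t \<Longrightarrow> \<bar>(\<integral>y. f y \<partial>\<mu>1) - (\<integral>x. act (A.trans t) f x \<partial>\<mu>2)\<bar> \<le> C * exp (- \<rho> * t) * I"
  shows "\<bar>(\<integral>y. f y \<partial>\<mu>1) - (\<integral>y. f y \<partial>\<mu>2)\<bar> \<le> C / \<rho> * S"
proof -
  have "\<bar>(\<integral>y. f y \<partial>\<mu>1) - (\<integral>y. f y \<partial>\<mu>2)\<bar> \<le> C * exp (- \<rho> * t) * I + C / \<rho> * S" if t: "0 \<le> t" for t
    using assms[OF t] abs_integral_increment_le[OF t]
      Bochner_Integration.integral_diff[OF \<mu>2_integrable[OF act_trans_bounded_measurable[OF f, of t]] \<mu>2_integrable[OF f]]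
    by linarith
  then have *: "\<forall>\<^sub>F t in at_top. \<bar>(\<integral>y. f y \<partial>\<mu>1) - (\<integral>y. f y \<partial>\<mu>2)\<bar> \<le> C * exp (- \<rho> * t) * I + C / \<rho> * S"
    by (auto intro: eventually_mono[OF eventually_ge_at_top[of 0]])
  have "filterlim (\<lambda>t. - \<rho> * t) at_bot at_top"
    using \<rho> by (intro filterlim_tendsto_neg_mult_at_bot[OF tendsto_const] filterlim_ident) auto
  then have "((\<lambda>t. exp (- \<rho> * t)) \<longlongrightarrow> 0) at_top"
    by (rule filterlim_compose[OF exp_at_bot])
  then have "((\<lambda>t. C * exp (- \<rho> * t) * I + C / \<rho> * S) \<longlongrightarrow> C * 0 * I + C / \<rho> * S) at_top"
    by (intro tendsto_intros)
  then show ?thesis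
    using tendsto_lowerbound[OF _ *] by simp
qed

end

end

section \<open>Identification of the transition kernels\<close>

lemma pdmp_space_eq: "pdmp_space \<mu> = \<mu> \<Otimes>\<^sub>M noise"
  by (simp add: pdmp_space_def noise_def jump_noise_def)

text \<open>With a Dirac initial law the sample space is a copy of the noise, so statements on
  \<open>pdmp_space\<close> become statements about \<open>\<omega>\<close> for fixed
  \<open>x\<close>.\<close>

lemma return_pair_noise:
  assumes x: "x \<in> space N"
  shows "return N x \<Otimes>\<^sub>M noise = distr noise (N \<Otimes>\<^sub>M noise) (Pair x)"
proof (rule measure_eqI)
  show "sets (return N x \<Otimes>\<^sub>M noise) = sets (distr noise (N \<Otimes>\<^sub>M noise) (Pair x))"
    unfolding sets_distr by (intro sets_pair_measure_cong) auto
next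
  fix A assume "A \<in> sets (return N x \<Otimes>\<^sub>M noise)"
  then have A [measurable]: "A \<in> sets (N \<Otimes>\<^sub>M noise)"
    using sets_pair_measure_cong[OF sets_return refl, of N x noise] by simp
  have [measurable]: "Pair x \<in> noise \<rightarrow>\<^sub>M N \<Otimes>\<^sub>M noise" using x by measurable
  have "emeasure (return N x \<Otimes>\<^sub>M noise) A = (\<integral>\<^sup>+y. emeasure noise (Pair y -` A) \<partial>return N x)"
    using \<open>A \<in> sets (return N x \<Otimes>\<^sub>M noise)\<close> by (rule noise.emeasure_pair_measure_alt)
  also have "\<dots> = emeasure noise (Pair x -` A)"
    using x by (intro nn_integral_return noise.measurable_emeasure_Pair) auto
  also have "Pair x -` A = Pair x -` A \<inter> space noise"
    using sets.sets_into_space[OF A] by (auto simp: space_pair_measure)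
  also have "emeasure noise \<dots> = emeasure (distr noise (N \<Otimes>\<^sub>M noise) (Pair x)) A"
    by (subst emeasure_distr) auto
  finally show "emeasure (return N x \<Otimes>\<^sub>M noise) A = emeasure (distr noise (N \<Otimes>\<^sub>M noise) (Pair x)) A" .
qed

lemma return_in_probs_on: "x \<in> M \<Longrightarrow> return (borel_on M) x \<in> probs_on M"
  by (simp add: space_prob_algebra prob_space_return space_restrict_space)

context pdmp_construction
begin

lemma pdmp_neq_None_iff:
  assumes "0 \<le> t"
  shows "pdmp \<phi> r G t (x, \<omega>) \<noteq> None \<longleftrightarrow> (\<exists>k. ereal t < fst (skel x \<omega> (Suc k)))"
proof
  assume "\<exists>k. ereal t < fst (skel x \<omega> (Suc k))"
  then have "ereal t < (SUP k. fst (skel x \<omega> k))"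
    unfolding less_SUP_iff by blast
  then show "pdmp \<phi> r G t (x, \<omega>) \<noteq> None"
    by (simp add: pdmp_def pdmp_skeleton_eq Let_def)
qed (rule pdmp_eq_state(1)[OF assms])

text \<open>When some jump time exceeds \<open>t\<close>, the value of \<open>pdmp\<close> is
  \<open>state\<close>; otherwise it is the cemetery point. This describes the event by measurable
  functions, and non-explosion then removes the extra condition.\<close>

lemma emeasure_pdmp:
  assumes x: "x \<in> space N" and t: "0 \<le> t" and A [measurable]: "A \<in> sets N"
  shows "emeasure (pdmp_space (return N x)) {p \<in> space (pdmp_space (return N x)). pdmp \<phi> r G t p \<in> Some ` A} =
    emeasure (trans t x) A"
proof -
  let ?B = "{z \<in> space (N \<Otimes>\<^sub>M noise). (\<exists>k. ereal t < fst (skel (fst z) (snd z) (Suc k))) \<and> state t (fst z) (snd z) \<in> A}"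
  have [measurable]: "Pair x \<in> noise \<rightarrow>\<^sub>M N \<Otimes>\<^sub>M noise" "state t x \<in> noise \<rightarrow>\<^sub>M N"
    "\<And>k. (\<lambda>\<omega>. fst (skel x \<omega> k)) \<in> borel_measurable noise"
    using x by measurable
  have sp: "space (pdmp_space (return N x)) = space (N \<Otimes>\<^sub>M noise)"
    by (simp add: pdmp_space_eq space_pair_measure)
  have iff: "pdmp \<phi> r G t (y, \<omega>) \<in> Some ` A \<longleftrightarrow> (\<exists>k. ereal t < fst (skel y \<omega> (Suc k))) \<and> state t y \<omega> \<in> A" for y \<omega>
    using pdmp_neq_None_iff[OF t, of y \<omega>] pdmp_eq_state(2)[OF t, of y \<omega>] by (cases "pdmp \<phi> r G t (y, \<omega>)") auto
  have "pdmp \<phi> r G t p \<in> Some ` A \<longleftrightarrow>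
      (\<exists>k. ereal t < fst (skel (fst p) (snd p) (Suc k))) \<and> state t (fst p) (snd p) \<in> A" for p
    using iff[of "fst p" "snd p"] unfolding prod.collapse .
  then have "{p \<in> space (pdmp_space (return N x)). pdmp \<phi> r G t p \<in> Some ` A} = ?B"
    unfolding sp by (simp only:)
  moreover have B: "?B \<in> sets (N \<Otimes>\<^sub>M noise)"
    by measurable
  moreover have "pdmp_space (return N x) = distr noise (N \<Otimes>\<^sub>M noise) (Pair x)"
    unfolding pdmp_space_eq by (rule return_pair_noise[OF x])
  ultimately have "emeasure (pdmp_space (return N x)) {p \<in> space (pdmp_space (return N x)). pdmp \<phi> r G t p \<in> Some ` A} =
      emeasure (distr noise (N \<Otimes>\<^sub>M noise) (Pair x)) ?B"
    by simp
  also have "\<dots> = emeasure noise {\<omega> \<in> space noise. (\<exists>k. ereal t < fst (skel x \<omega> (Suc k))) \<and> state t x \<omega> \<in> A}"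
    using B x by (subst emeasure_distr) (auto simp: space_pair_measure intro!: arg_cong[where f="emeasure noise"])
  also have "\<dots> = emeasure noise {\<omega> \<in> space noise. state t x \<omega> \<in> A}"
    by (rule emeasure_eq_AE) (use AE_jump_index[OF x t] in \<open>auto simp del: skel.simps\<close>)
  also have "\<dots> = emeasure (trans t x) A"
    unfolding trans_def by (subst emeasure_distr) (auto intro!: arg_cong[where f="emeasure noise"])
  finally show ?thesis .
qed

end

text \<open>\<open>measure_of\<close> returns a null measure unless its set function is countably
  additive; agreement with \<open>emeasure (trans t x)\<close> on all measurable sets guarantees
  this and identifies the result.\<close>

lemma pdmp_transition_eq:
  assumes "pdmp_construction (borel_on M) \<phi> r Q G" "0 \<le> t" "x \<in> M"
  shows "pdmp_transition M \<phi> r G t x = pdmp_construction.trans (borel_on M) \<phi> r G t x"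
proof -
  interpret pdmp_construction "borel_on M" \<phi> r Q G by fact
  have x: "x \<in> space (borel_on M)" using assms(3) by (simp add: space_restrict_space)
  have T: "sets (trans t x) = sets (borel_on M)" "space (trans t x) = M"
    using prob_algebra_kernelD(2,3)[OF trans_kernel x] by (simp_all add: space_restrict_space)
  have "pdmp_transition M \<phi> r G t x = measure_of M (sets (borel_on M)) (emeasure (trans t x))"
    unfolding pdmp_transition_def Let_def
  proof (rule measure_of_eq)
    show "sets (borel_on M) \<subseteq> Pow M"
      using sets.space_closed[of "borel_on M"] by (simp add: space_restrict_space)
    fix A assume "A \<in> sigma_sets M (sets (borel_on M))"
    then have "A \<in> sets (borel_on M)"
      using sets.sigma_sets_eq[of "borel_on M"] by (simp add: space_restrict_space)
    then show "emeasure (pdmp_space (return (borel_on M) x))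
        {p \<in> space (pdmp_space (return (borel_on M) x)). pdmp \<phi> r G t p \<in> Some ` A} = emeasure (trans t x) A"
      by (rule emeasure_pdmp[OF x assms(2)])
  qed
  also have "\<dots> = trans t x"
    using measure_of_of_measure[of "trans t x"] T by simp
  finally show ?thesis .
qed

lemma pdmp_construction_borel_on:
  fixes M :: "'a::euclidean_space set"
  assumes "homogeneous_characteristics M \<phi> r Q" "represents_kernel M Q G" "non_explosive M \<phi> r G"
  shows "pdmp_construction (borel_on M) \<phi> r Q G"
proof -
  let ?N = "borel_on M"
  have sp [simp]: "space ?N = M" by (simp add: space_restrict_space)
  have hf: "homogeneous_flow M \<phi>" and jr: "jump_rate M r" and Q: "Q \<in> ?N \<rightarrow>\<^sub>M prob_algebra ?N"
    using assms(1) by (simp_all add: homogeneous_characteristics_def markov_kernel_def)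
  have flow: "(\<lambda>(t, x). \<phi> t x) \<in> borel_on {0..} \<Otimes>\<^sub>M ?N \<rightarrow>\<^sub>M ?N" "\<And>x. x \<in> M \<Longrightarrow> \<phi> 0 x = x"
      "\<And>t s x. \<lbrakk>0 \<le> t; 0 \<le> s; x \<in> M\<rbrakk> \<Longrightarrow> \<phi> (t + s) x = \<phi> s (\<phi> t x)"
    using hf by (simp_all add: homogeneous_flow_def)
  have flow_diff: "\<exists>v. \<forall>t\<ge>0. ((\<lambda>s. \<phi> s x) has_vector_derivative v t) (at t within {0..})" if "x \<in> M" for x
    using hf that unfolding homogeneous_flow_def by metis
  have rate: "r \<in> borel_measurable ?N" "\<And>x. x \<in> M \<Longrightarrow> 0 \<le> r x"
      "\<And>K. \<lbrakk>K \<subseteq> M; compact K\<rbrakk> \<Longrightarrow> bounded (r ` K)"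
    using jr by (simp_all add: jump_rate_def)
  have flow_in: "\<phi> t x \<in> M" if "0 \<le> t" "x \<in> M" for t x
    using measurable_space[OF flow(1), of "(t, x)"] that by (simp add: space_pair_measure space_restrict_space)
  have max_meas: "(\<lambda>(t, x). (max 0 (t :: real), x)) \<in> borel \<Otimes>\<^sub>M ?N \<rightarrow>\<^sub>M borel_on {0..} \<Otimes>\<^sub>M ?N"
  proof -
    have "(\<lambda>z. max 0 (fst z)) \<in> borel \<Otimes>\<^sub>M ?N \<rightarrow>\<^sub>M borel_on {0 :: real..}"
      by (rule measurable_restrict_space2) auto
    then show ?thesis unfolding case_prod_beta by (intro measurable_Pair measurable_snd)
  qed
  interpret flow_with_rate ?N \<phi> r
  proof
    show "(\<lambda>(t, x). \<phi> (max 0 t) x) \<in> borel \<Otimes>\<^sub>M ?N \<rightarrow>\<^sub>M ?N"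
      using measurable_compose[OF max_meas flow(1)] by (simp add: case_prod_beta)
    fix x T assume "x \<in> space ?N"
    then have x: "x \<in> M" by simp
    obtain v where v: "\<And>t. 0 \<le> t \<Longrightarrow> ((\<lambda>s. \<phi> s x) has_vector_derivative v t) (at t within {0..})"
      using flow_diff[OF x] by blast
    \<comment> \<open>A finite piece of an orbit is then a compact subset of \<open>M\<close>, and
      the jump rate is bounded on it.\<close>
    have "continuous_on {0..} (\<lambda>s. \<phi> s x)"
      unfolding continuous_on_eq_continuous_within
      using has_vector_derivative_continuous[OF v] by simp
    then have "compact ((\<lambda>s. \<phi> s x) ` {0..T})"
      by (intro compact_continuous_image) (auto intro: continuous_on_subset)
    then have "bounded (r ` (\<lambda>s. \<phi> s x) ` {0..T})"
      using flow_in x by (intro rate(3)) auto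
    then obtain L where "\<forall>y\<in>r ` (\<lambda>s. \<phi> s x) ` {0..T}. \<bar>y\<bar> \<le> L"
      unfolding bounded_iff by auto
    then show "\<exists>L. \<forall>s\<in>{0..T}. r (\<phi> s x) \<le> L"
      by (intro exI[of _ L]) (auto simp: abs_le_iff)
  qed (use flow rate in auto)
  have u_sets: "sets uniform01 = sets (borel_on {0..1})"
    unfolding uniform01_def by (intro sets_restrict_space_cong) simp
  have G: "(\<lambda>(x, u). G x u) \<in> ?N \<Otimes>\<^sub>M uniform01 \<rightarrow>\<^sub>M ?N"
    using assms(2) measurable_cong_sets[OF sets_pair_measure_cong[OF refl u_sets] refl, of ?N ?N]
    unfolding represents_kernel_def by blast
  show ?thesis
  proof
    show "Q \<in> ?N \<rightarrow>\<^sub>M prob_algebra ?N" by fact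
    show "(\<lambda>(x, u). G x u) \<in> ?N \<Otimes>\<^sub>M uniform01 \<rightarrow>\<^sub>M ?N" by fact
  next
    fix x assume x: "x \<in> space ?N"
    have Gx: "G x \<in> uniform01 \<rightarrow>\<^sub>M ?N"
      using measurable_compose[OF measurable_Pair1'[OF x] G] by simp
    show "Q x = distr uniform01 ?N (G x)"
    proof (rule measure_eqI)
      show "sets (Q x) = sets (distr uniform01 ?N (G x))"
        using prob_algebra_kernelD(2)[OF Q x] by simp
      fix A assume "A \<in> sets (Q x)"
      then have A: "A \<in> sets ?N" using prob_algebra_kernelD(2)[OF Q x] by simp
      have "emeasure (Q x) A = emeasure uniform01 {u \<in> space uniform01. G x u \<in> A}"
        using assms(2) A x unfolding represents_kernel_def by simp
      also have "\<dots> = emeasure (distr uniform01 ?N (G x)) A"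
        using Gx A by (subst emeasure_distr) (auto intro!: arg_cong[where f="emeasure uniform01"])
      finally show "emeasure (Q x) A = emeasure (distr uniform01 ?N (G x)) A" .
    qed
    \<comment> \<open>Non-explosion, assumed for all initial laws, is taken at the Dirac law of
      \<open>x\<close>.\<close>
    have "AE p in pdmp_space (return ?N x). Inf {ereal t | t. 0 \<le> t \<and> pdmp \<phi> r G t p = None} = \<infinity>"
      using assms(3) return_in_probs_on[of x M] x unfolding non_explosive_def by simp
    then have "AE p in distr noise (?N \<Otimes>\<^sub>M noise) (Pair x). Inf {ereal t | t. 0 \<le> t \<and> pdmp \<phi> r G t p = None} = \<infinity>"
      unfolding pdmp_space_eq return_pair_noise[OF x] .
    then have "AE \<omega> in noise. Inf {ereal t | t. 0 \<le> t \<and> pdmp \<phi> r G t (x, \<omega>) = None} = \<infinity>"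
      by (rule AE_distrD[rotated]) (use x in measurable)
    then show "AE \<omega> in noise. \<forall>t\<ge>0. pdmp \<phi> r G t (x, \<omega>) \<noteq> None"
    proof eventually_elim
      case (elim \<omega>)
      show ?case
      proof (intro allI impI notI)
        fix t :: real assume t: "0 \<le> t" "pdmp \<phi> r G t (x, \<omega>) = None"
        then have "Inf {ereal t | t. 0 \<le> t \<and> pdmp \<phi> r G t (x, \<omega>) = None} \<le> ereal t"
          by (intro Inf_lower) auto
        with elim show False by simp
      qed
    qed
  qed
qed

section \<open>Test functions bounded by V and assembly of the estimate\<close>

lemma uniform_norm_cong: "(\<And>x. x \<in> M \<Longrightarrow> f x = g x) \<Longrightarrow> uniform_norm M f = uniform_norm M g"
  unfolding uniform_norm_def by (intro SUP_cong) auto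

lemma uniform_norm_ratio_le_1_iff:
  assumes "\<And>x. x \<in> M \<Longrightarrow> 1 \<le> V x"
  shows "uniform_norm M (\<lambda>x. h x / V x) \<le> 1 \<longleftrightarrow> (\<forall>x\<in>M. \<bar>h x\<bar> \<le> V x)"
proof -
  have "ennreal \<bar>h x / V x\<bar> \<le> 1 \<longleftrightarrow> \<bar>h x\<bar> \<le> V x" if "x \<in> M" for x
    using assms[OF that] by (simp add: ennreal_le_1 abs_divide divide_le_eq)
  then show ?thesis by (simp add: uniform_norm_def SUP_le_iff)
qed

lemma truncation_tendsto: "(\<lambda>n. max (- real n) (min (real n) y)) \<longlonglongrightarrow> y"
proof (rule tendsto_eventually)
  obtain n0 :: nat where "\<bar>y\<bar> < real n0" using reals_Archimedean2 by blast
  then have "max (- real n) (min (real n) y) = y" if "n0 \<le> n" for n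
    using that by (auto simp: max_def min_def abs_less_iff)
  then show "\<forall>\<^sub>F n in sequentially. max (- real n) (min (real n) y) = y"
    by (auto simp: eventually_sequentially)
qed

theorem theorem25:
  fixes M :: "'a::euclidean_space set"
    and \<phi> :: "real \<Rightarrow> 'a \<Rightarrow> 'a"
    and r1 r2 :: "'a \<Rightarrow> real"
    and Q1 Q2 :: "'a \<Rightarrow> 'a measure"
    and P1 P2 :: "real \<Rightarrow> 'a \<Rightarrow> 'a measure"
    and \<mu>1 \<mu>2 :: "'a measure"
    and V :: "'a \<Rightarrow> real"
    and C \<rho> :: real
  assumes "smooth_closed_submanifold M"
    and "non_explosive_pdmp_semigroup M \<phi> r1 Q1 P1"
    and "non_explosive_pdmp_semigroup M \<phi> r2 Q2 P2"
    and "\<mu>1 \<in> probs_on M" and "invariant_measure P1 \<mu>1"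
    and "\<mu>2 \<in> probs_on M" and "invariant_measure P2 \<mu>2"
    and "V \<in> borel_measurable (borel_on M)" and "\<forall>x\<in>M. 1 \<le> V x"
    and "0 < C" and "0 < \<rho>"
    and "V_uniformly_geometrically_ergodic M P1 \<mu>1 V C \<rho>"
    and "(\<integral>\<^sup>+x. V x \<partial>\<mu>2) < \<infinity>"
    and "C1c M \<subseteq> B0 M P1"
    and "\<forall>t\<ge>0. \<forall>f\<in>C1c M. (\<lambda>x. LBINT s:{0..t}. act (P1 s) f x) \<in> strong_generator_domain M P2"
  shows "V_distance M V \<mu>1 \<mu>2 \<le> ennreal (C / \<rho>) *
    (SUP h\<in>{h \<in> borel_measurable (borel_on M).
              uniform_norm M (\<lambda>x. h x / V x) \<le> 1 \<and>
              (AE x in \<mu>2. integrable (Q1 x) h \<and> integrable (Q2 x) h)}.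
       \<integral>\<^sup>+x. ennreal \<bar>r1 x * act Q1 h x - r2 x * act Q2 h x + (r2 x - r1 x) * h x\<bar> \<partial>\<mu>2)"
    (is "_ \<le> _ * ?S")
proof (cases "?S = \<top>")
  \<comment> \<open>An infinite supremum makes the right-hand side infinite, because
    \<open>C / \<rho>\<close> is positive.\<close>
  case True
  have "ennreal (C / \<rho>) \<noteq> 0" using assms(10,11) by simp
  then show ?thesis unfolding True by (simp add: ennreal_mult_top)
next
  case False
  define S where "S = enn2real ?S"
  have S: "?S = ennreal S" "0 \<le> S"
    unfolding S_def by (rule ennreal_enn2real[OF False[unfolded less_top], symmetric], rule enn2real_nonneg)
  have V1: "1 \<le> V x" if "x \<in> M" for x using assms(9) that by blast
  obtain G1 where G1: "homogeneous_characteristics M \<phi> r1 Q1" "represents_kernel M Q1 G1" "non_explosive M \<phi> r1 G1"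
      "\<And>t x. \<lbrakk>0 \<le> t; x \<in> M\<rbrakk> \<Longrightarrow> P1 t x = pdmp_transition M \<phi> r1 G1 t x"
    using assms(2) unfolding non_explosive_pdmp_semigroup_def by blast
  obtain G2 where G2: "homogeneous_characteristics M \<phi> r2 Q2" "represents_kernel M Q2 G2" "non_explosive M \<phi> r2 G2"
      "\<And>t x. \<lbrakk>0 \<le> t; x \<in> M\<rbrakk> \<Longrightarrow> P2 t x = pdmp_transition M \<phi> r2 G2 t x"
    using assms(3) unfolding non_explosive_pdmp_semigroup_def by blast
  note c1 = pdmp_construction_borel_on[OF G1(1-3)] and c2 = pdmp_construction_borel_on[OF G2(1-3)]
  interpret pdmp_pair "borel_on M" \<phi> r1 r2 Q1 Q2 G1 G2
    by (intro pdmp_pair.intro c1 c2)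
  have P1: "P1 t x = A.trans t x" if "0 \<le> t" "x \<in> M" for t x
    using G1(4) pdmp_transition_eq[OF c1] that by simp
  have P2: "P2 t x = B.trans t x" if "0 \<le> t" "x \<in> M" for t x
    using G2(4) pdmp_transition_eq[OF c2] that by simp
  have act1: "act (P1 t) f x = act (A.trans t) f x" if "0 \<le> t" "x \<in> M" for t f x
    using P1[OF that] by (simp add: act_def)
  have act2: "act (P2 t) f x = act (B.trans t) f x" if "0 \<le> t" "x \<in> M" for t f x
    using P2[OF that] by (simp add: act_def)
  have sp: "space (borel_on M) = M" by (simp add: space_restrict_space)
  have \<mu>1: "prob_space \<mu>1" "sets \<mu>1 = sets (borel_on M)"
    using assms(4) by (auto simp: space_prob_algebra)
  have \<mu>2: "prob_space \<mu>2" "sets \<mu>2 = sets (borel_on M)"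
    using assms(6) by (auto simp: space_prob_algebra)
  have sp1: "space \<mu>1 = M" and sp2: "space \<mu>2 = M"
    using sets_eq_imp_space_eq[OF \<mu>1(2)] sets_eq_imp_space_eq[OF \<mu>2(2)] sp by auto
  have inv: "\<mu>2 \<bind> B.trans t = \<mu>2" if "0 \<le> t" for t
  proof -
    have "\<mu>2 \<bind> B.trans t = \<mu>2 \<bind> P2 t"
      using P2[OF that] sp2 by (intro bind_cong) auto
    then show ?thesis using assms(7) that by (simp add: invariant_measure_def)
  qed
  have bm_E: "\<exists>B. f \<in> borel_measurable (borel_on M) \<and> (\<forall>x\<in>space (borel_on M). \<bar>f x\<bar> \<le> B)"
    if "f \<in> bounded_measurable M" for f
    using bounded_measurableE[OF that] unfolding sp by metis
  interpret pdmp_comparison M \<phi> r1 r2 Q1 Q2 G1 G2 \<mu>1 \<mu>2 V C \<rho> S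
  proof (intro pdmp_comparison.intro pdmp_comparison_axioms.intro)
    fix h :: "'a \<Rightarrow> real" and c :: real
    assume h: "h \<in> bounded_measurable M" "0 < c" "\<And>x. x \<in> M \<Longrightarrow> \<bar>h x\<bar> \<le> c * V x"
    obtain B where hB: "h \<in> borel_measurable (borel_on M)" "\<And>x. x \<in> space (borel_on M) \<Longrightarrow> \<bar>h x\<bar> \<le> B"
      using bm_E[OF h(1)] by blast
    \<comment> \<open>Scaling by \<open>1 / c\<close> makes \<open>h\<close> admissible in the
      supremum; being bounded, it is integrable for every \<open>Q1 x\<close> and
      \<open>Q2 x\<close> with \<open>x\<close> in \<open>M\<close>, as the index set demands.
      Scaling back gives the factor \<open>c\<close>.\<close>
    let ?h = "\<lambda>x. 1 / c * h x"
    have dh_meas: "defect h \<in> borel_measurable \<mu>2"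
      using defect_measurable[OF hB(1)] measurable_cong_sets[OF \<mu>2(2) refl] by blast
    have "?h \<in> {h \<in> borel_measurable (borel_on M). uniform_norm M (\<lambda>x. h x / V x) \<le> 1 \<and>
        (AE x in \<mu>2. integrable (Q1 x) h \<and> integrable (Q2 x) h)}"
    proof (intro CollectI conjI AE_I2)
      show "?h \<in> borel_measurable (borel_on M)" using hB(1) by simp
      show "uniform_norm M (\<lambda>x. ?h x / V x) \<le> 1"
        using h(2,3) by (subst uniform_norm_ratio_le_1_iff[OF V1]) (auto simp: abs_mult pos_divide_le_eq mult.commute)
      fix x assume "x \<in> space \<mu>2"
      then have x: "x \<in> space (borel_on M)" using sp sp2 by simp
      show "integrable (Q1 x) ?h" "integrable (Q2 x) ?h"
        using kernel_integrable_bounded[OF A.kernel_measurable x hB] kernel_integrable_bounded[OF B.kernel_measurable x hB]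
        by auto
    qed
    then have "(\<integral>\<^sup>+x. ennreal \<bar>r1 x * act Q1 ?h x - r2 x * act Q2 ?h x + (r2 x - r1 x) * ?h x\<bar> \<partial>\<mu>2) \<le> ?S"
      by (rule SUP_upper)
    then have "(\<integral>\<^sup>+x. ennreal \<bar>defect ?h x\<bar> \<partial>\<mu>2) \<le> ?S"
      unfolding defect_def .
    then have le: "(\<integral>\<^sup>+x. ennreal \<bar>1 / c * defect h x\<bar> \<partial>\<mu>2) \<le> ennreal S"
      unfolding S(1) defect_scale .
    have "(\<integral>\<^sup>+x. ennreal \<bar>defect h x\<bar> \<partial>\<mu>2) = (\<integral>\<^sup>+x. ennreal c * ennreal \<bar>1 / c * defect h x\<bar> \<partial>\<mu>2)"
      using h(2) by (intro nn_integral_cong) (simp add: ennreal_mult[symmetric] abs_mult)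
    also have "\<dots> = ennreal c * (\<integral>\<^sup>+x. ennreal \<bar>1 / c * defect h x\<bar> \<partial>\<mu>2)"
      by (intro nn_integral_cmult measurable_compose[OF dh_meas]) measurable
    also have "\<dots> \<le> ennreal c * ennreal S"
      using le by (rule mult_left_mono) simp
    also have "\<dots> = ennreal (c * S)"
      using h(2) S(2) by (simp add: ennreal_mult)
    finally have le': "(\<integral>\<^sup>+x. ennreal \<bar>defect h x\<bar> \<partial>\<mu>2) \<le> ennreal (c * S)" .
    have int: "integrable \<mu>2 (defect h)"
      using le_less_trans[OF le' ennreal_less_top] by (intro integrableI_bounded dh_meas) simp
    have "ennreal (\<integral>x. \<bar>defect h x\<bar> \<partial>\<mu>2) \<le> ennreal (c * S)"
      using le' int by (subst nn_integral_eq_integral[symmetric]) auto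
    with int h(2) S(2) show "integrable \<mu>2 (defect h) \<and> (\<integral>x. \<bar>defect h x\<bar> \<partial>\<mu>2) \<le> c * S"
      by (simp add: ennreal_le_iff)
  next
    fix f :: "'a \<Rightarrow> real" and t :: real
    assume f: "f \<in> C1c M" and t: "0 \<le> t"
    let ?F = "\<lambda>x. LBINT s:{0..t}. act (P1 s) f x"
    have f0: "f \<in> B0 M P1" using assms(14) f by blast
    then have f_bm: "f \<in> bounded_measurable M" by (simp add: B0_def)
    obtain B where fB: "f \<in> borel_measurable (borel_on M)" "\<And>x. x \<in> space (borel_on M) \<Longrightarrow> \<bar>f x\<bar> \<le> B"
      using bm_E[OF f_bm] by blast
    have F: "?F x = A.potential t f x" if "x \<in> M" for x
      unfolding A.potential_def using that by (intro set_lebesgue_integral_cong) (auto simp: act1)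
    have actF: "act (P2 h) ?F x = act (B.trans h) (A.potential t f) x" if "0 \<le> h" "x \<in> M" for h x
      unfolding act2[OF that] by (rule act_cong[OF B.trans_kernel]) (use that F sp in auto)
    have "?F \<in> strong_generator_domain M P2" using assms(15) f t by blast
    then obtain g where
      F0: "((\<lambda>h. uniform_norm M (\<lambda>x. act (P2 h) ?F x - ?F x)) \<longlongrightarrow> 0) (at_right 0)" and
      Fg: "((\<lambda>h. uniform_norm M (\<lambda>x. (act (P2 h) ?F x - ?F x) / h - g x)) \<longlongrightarrow> 0) (at_right 0)"
      unfolding strong_generator_domain_def B0_def by blast
    show "(\<integral>x. defect (A.potential t f) x \<partial>\<mu>2) = (\<integral>x. act (A.trans t) f x - f x \<partial>\<mu>2)"
    proof (rule integral_defect_potential[OF fB _ t _ _ \<mu>2 inv])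
      show "((\<lambda>t. uniform_norm (space (borel_on M)) (\<lambda>x. act (A.trans t) f x - f x)) \<longlongrightarrow> 0) (at_right 0)"
      proof (rule Lim_transform_eventually)
        show "((\<lambda>t. uniform_norm M (\<lambda>x. act (P1 t) f x - f x)) \<longlongrightarrow> 0) (at_right 0)"
          using f0 by (simp add: B0_def)
        show "\<forall>\<^sub>F t in at_right 0. uniform_norm M (\<lambda>x. act (P1 t) f x - f x) =
            uniform_norm (space (borel_on M)) (\<lambda>x. act (A.trans t) f x - f x)"
          unfolding sp by (intro eventually_mono[OF eventually_at_right_less[of 0]] uniform_norm_cong) (simp add: act1)
      qed
      show "((\<lambda>h. uniform_norm (space (borel_on M)) (\<lambda>x. act (B.trans h) (A.potential t f) x - A.potential t f x)) \<longlongrightarrow> 0) (at_right 0)"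
      proof (rule Lim_transform_eventually[OF F0])
        show "\<forall>\<^sub>F h in at_right 0. uniform_norm M (\<lambda>x. act (P2 h) ?F x - ?F x) =
            uniform_norm (space (borel_on M)) (\<lambda>x. act (B.trans h) (A.potential t f) x - A.potential t f x)"
          unfolding sp by (intro eventually_mono[OF eventually_at_right_less[of 0]] uniform_norm_cong) (simp add: actF F)
      qed
      show "((\<lambda>h. uniform_norm (space (borel_on M))
          (\<lambda>x. (act (B.trans h) (A.potential t f) x - A.potential t f x) / h - g x)) \<longlongrightarrow> 0) (at_right 0)"
      proof (rule Lim_transform_eventually[OF Fg])
        show "\<forall>\<^sub>F h in at_right 0. uniform_norm M (\<lambda>x. (act (P2 h) ?F x - ?F x) / h - g x) =
            uniform_norm (space (borel_on M)) (\<lambda>x. (act (B.trans h) (A.potential t f) x - A.potential t f x) / h - g x)"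
          unfolding sp by (intro eventually_mono[OF eventually_at_right_less[of 0]] uniform_norm_cong) (simp add: actF F)
      qed
    qed
  qed (rule \<mu>1 \<mu>2 V1 assms(10,11) pdmp_pair_axioms | assumption)+

  have V_ergodic: "\<bar>(\<integral>y. f y \<partial>\<mu>1) - (\<integral>y. f y \<partial>(\<nu> \<bind> P1 t))\<bar> \<le> C * exp (- \<rho> * t) * enn2real (\<integral>\<^sup>+x. V x \<partial>\<nu>)"
    if f: "f \<in> borel_measurable (borel_on M)" "\<And>x. x \<in> M \<Longrightarrow> \<bar>f x\<bar> \<le> V x"
      and \<nu>: "\<nu> \<in> probs_on M" "(\<integral>\<^sup>+x. V x \<partial>\<nu>) < \<infinity>" and t: "0 \<le> t" for f \<nu> t
  proof -
    have "ennreal \<bar>(\<integral>y. f y \<partial>\<mu>1) - (\<integral>y. f y \<partial>(\<nu> \<bind> P1 t))\<bar> \<le> V_distance M V \<mu>1 (\<nu> \<bind> P1 t)"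
      unfolding V_distance_def using f
      by (intro SUP_upper) (auto simp: uniform_norm_ratio_le_1_iff[OF V1])
    also have "\<dots> \<le> ennreal (C * exp (- \<rho> * t)) * (\<integral>\<^sup>+x. V x \<partial>\<nu>)"
      using assms(12) \<nu> t unfolding V_uniformly_geometrically_ergodic_def by blast
    also have "\<dots> = ennreal (C * exp (- \<rho> * t) * enn2real (\<integral>\<^sup>+x. V x \<partial>\<nu>))"
      using \<nu>(2) assms(10) by (simp add: ennreal_mult ennreal_enn2real)
    finally show ?thesis
      using assms(10) by (subst (asm) ennreal_le_iff) auto
  qed

  have bounded_le: "\<bar>(\<integral>y. f y \<partial>\<mu>1) - (\<integral>y. f y \<partial>\<mu>2)\<bar> \<le> C / \<rho> * S"
    if f: "f \<in> bounded_measurable M" "\<And>x. x \<in> M \<Longrightarrow> \<bar>f x\<bar> \<le> V x" for f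
  proof -
    obtain B where fB: "f \<in> borel_measurable (borel_on M)" "\<And>x. x \<in> space (borel_on M) \<Longrightarrow> \<bar>f x\<bar> \<le> B"
      using bm_E[OF f(1)] by blast
    show ?thesis
    \<comment> \<open>The two uses of ergodicity: from Dirac laws, for which the initial integral of
      \<open>V\<close> is \<open>V x\<close>, and from \<open>\<mu>2\<close>.\<close>
    proof (rule bounded_difference_le[OF f(1), where I="enn2real (\<integral>\<^sup>+x. V x \<partial>\<mu>2)"])
      fix x and s :: real assume x: "x \<in> M" and s: "0 \<le> s"
      have "return (borel_on M) x \<bind> P1 s = return (borel_on M) x \<bind> A.trans s"
        using P1[OF s] sp by (intro bind_cong) auto
      also have "\<dots> = A.trans s x"
        by (rule bind_return[OF measurable_prob_algebraD[OF A.trans_kernel]]) (use x sp in simp)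
      finally have b: "return (borel_on M) x \<bind> P1 s = A.trans s x" .
      have v: "(\<integral>\<^sup>+y. V y \<partial>return (borel_on M) x) = ennreal (V x)"
        using x sp assms(8) by (intro nn_integral_return) auto
      show "\<bar>(\<integral>y. f y \<partial>\<mu>1) - act (A.trans s) f x\<bar> \<le> C * exp (- \<rho> * s) * V x"
        using V_ergodic[OF fB(1) f(2) return_in_probs_on[OF x] _ s] V1[OF x] by (simp add: b v act_def)
    next
      fix t :: real assume t: "0 \<le> t"
      have "\<mu>2 \<bind> P1 t = \<mu>2 \<bind> A.trans t"
        using P1[OF t] sp2 by (intro bind_cong) auto
      then have "(\<integral>y. f y \<partial>(\<mu>2 \<bind> P1 t)) = (\<integral>x. act (A.trans t) f x \<partial>\<mu>2)"
        using integral_bind_kernel[OF A.trans_kernel \<mu>2 fB] by simp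
      then show "\<bar>(\<integral>y. f y \<partial>\<mu>1) - (\<integral>x. act (A.trans t) f x \<partial>\<mu>2)\<bar> \<le>
          C * exp (- \<rho> * t) * enn2real (\<integral>\<^sup>+x. V x \<partial>\<mu>2)"
        using V_ergodic[OF fB(1) f(2) assms(6,13) t] by simp
    qed
  qed

  have V_int: "integrable \<mu> V" if "sets \<mu> = sets (borel_on M)" "(\<integral>\<^sup>+x. V x \<partial>\<mu>) < \<infinity>" for \<mu>
  proof (rule integrableI_nonneg)
    show "V \<in> borel_measurable \<mu>"
      using assms(8) measurable_cong_sets[OF that(1) refl] by blast
    show "AE x in \<mu>. 0 \<le> V x"
    proof (rule AE_I2)
      fix x assume "x \<in> space \<mu>"
      then have "x \<in> M" using sets_eq_imp_space_eq[OF that(1)] sp by simp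
      then show "0 \<le> V x" using V1 by fastforce
    qed
  qed fact
  \<comment> \<open>Truncation at level \<open>n\<close> preserves the bound by \<open>V\<close> and
    makes the function bounded; the estimate for bounded functions does not depend on
    \<open>n\<close>, and \<open>V\<close> is integrable for both measures.\<close>
  have general_le: "\<bar>(\<integral>y. f y \<partial>\<mu>1) - (\<integral>y. f y \<partial>\<mu>2)\<bar> \<le> C / \<rho> * S"
    if f: "f \<in> borel_measurable (borel_on M)" "\<And>x. x \<in> M \<Longrightarrow> \<bar>f x\<bar> \<le> V x" for f
  proof -
    let ?f = "\<lambda>n y. max (- real n) (min (real n) (f y))"
    have f_le: "\<bar>?f n y\<bar> \<le> \<bar>f y\<bar>" "\<bar>?f n y\<bar> \<le> real n" for n y
      by (auto simp: max_def min_def abs_le_iff)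
    have conv: "(\<lambda>n. \<integral>y. ?f n y \<partial>\<mu>) \<longlonglongrightarrow> (\<integral>y. f y \<partial>\<mu>)"
      if \<mu>: "sets \<mu> = sets (borel_on M)" "(\<integral>\<^sup>+x. V x \<partial>\<mu>) < \<infinity>" for \<mu>
    proof (rule integral_dominated_convergence[where w=V])
      have m: "f \<in> borel_measurable \<mu>" using f(1) measurable_cong_sets[OF \<mu>(1) refl] by blast
      then show "f \<in> borel_measurable \<mu>" "?f n \<in> borel_measurable \<mu>" for n by measurable
      show "integrable \<mu> V" by (rule V_int[OF \<mu>])
      show "AE y in \<mu>. (\<lambda>n. ?f n y) \<longlonglongrightarrow> f y" by (intro AE_I2 truncation_tendsto)
      show "AE y in \<mu>. norm (?f n y) \<le> V y" for n
      proof (rule AE_I2)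
        fix y assume "y \<in> space \<mu>"
        then have "y \<in> M" using sets_eq_imp_space_eq[OF \<mu>(1)] sp by simp
        from order_trans[OF f_le(1) f(2)[OF this]] show "norm (?f n y) \<le> V y"
          unfolding real_norm_def .
      qed
    qed
    have V1_fin: "(\<integral>\<^sup>+x. V x \<partial>\<mu>1) < \<infinity>"
      using assms(12) by (simp add: V_uniformly_geometrically_ergodic_def)
    have "(\<lambda>n. \<bar>(\<integral>y. ?f n y \<partial>\<mu>1) - (\<integral>y. ?f n y \<partial>\<mu>2)\<bar>) \<longlonglongrightarrow> \<bar>(\<integral>y. f y \<partial>\<mu>1) - (\<integral>y. f y \<partial>\<mu>2)\<bar>"
      by (intro tendsto_rabs tendsto_diff conv \<mu>1 \<mu>2 V1_fin assms(13))
    moreover have "\<bar>(\<integral>y. ?f n y \<partial>\<mu>1) - (\<integral>y. ?f n y \<partial>\<mu>2)\<bar> \<le> C / \<rho> * S" for n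
    proof (rule bounded_le)
      show "?f n \<in> bounded_measurable M"
      proof (rule bounded_measurableI[where B="real n"])
        show "?f n \<in> borel_measurable (borel_on M)" using f(1) by measurable
      qed (rule f_le(2))
      show "\<bar>?f n x\<bar> \<le> V x" if "x \<in> M" for x
        using f_le(1)[of n x] f(2)[OF that] by linarith
    qed
    ultimately show ?thesis by (intro LIMSEQ_le_const2) auto
  qed
  have "V_distance M V \<mu>1 \<mu>2 \<le> ennreal (C / \<rho> * S)"
    unfolding V_distance_def
  proof (rule SUP_least)
    fix f assume "f \<in> {f \<in> borel_measurable (borel_on M). uniform_norm M (\<lambda>x. f x / V x) \<le> 1}"
    then have "f \<in> borel_measurable (borel_on M)" "\<And>x. x \<in> M \<Longrightarrow> \<bar>f x\<bar> \<le> V x"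
      by (auto simp: uniform_norm_ratio_le_1_iff[OF V1])
    then show "ennreal \<bar>(\<integral>x. f x \<partial>\<mu>1) - (\<integral>x. f x \<partial>\<mu>2)\<bar> \<le> ennreal (C / \<rho> * S)"
      by (intro ennreal_leI general_le)
  qed
  also have "\<dots> = ennreal (C / \<rho>) * ?S"
    unfolding S(1) by (rule ennreal_mult) (use assms(10,11) S(2) in auto)
  finally show ?thesis .
qed

end
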